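(* Let $\mathcal{S}$ be a normed arithmetic semigroup satisfying at least one of the following two growth conditions: (A) for some constants $A>0$ and $\delta>0$, $$\nu_{\mathcal{S}}(x)=Ax\left(1+O\left(\frac{1}{x^{\delta}}\right)\right);$$ (B) for some constants $\theta_0>0$, $\theta_0\ne 1$, and $\epsilon>0$, $$\pi_{\mathcal{S}}(x)=\theta_0\,\frac{x}{\log x}\left(1+O\left(\frac{1}{(\log x)^{\epsilon}}\right)\right).$$ Given $n>1$, let $s$ be chosen uniformly from the (finitely many) elements of $\mathcal{S}$ with norm not exceeding $n$. Let $s=\mathfrak{p}_1\mathfrak{p}_2\cdots$ be a decomposition into prime factors, with $|\mathfrak{p}_1|\ge|\mathfrak{p}_2|\ge\cdots$. For each $n$ define a process $L(n)=(L_1(n),L_2(n),\dots)$, where all $L_i(n)=0$ if $s=1$, and otherwise $$L_i(n)=\frac{\log|\mathfrak{p}_i|}{\log n}\ \text{ for } i\le\Omega(s),\qquad L_i(n)=0\ \text{ for } i>\Omega(s).$$ Then, as $n\to\infty$, $L(n)$ converges in distribution to the Poisson-Dirichlet process PD($\theta$), where $\theta=1$ if (A) holds, and otherwise $\theta=\theta_0$ is the constant in (B).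
   Context: A normed arithmetic semigroup $\mathcal{S}$ is a commutative (multiplicative) semigroup with identity $1$, whose only unit is $1$, admitting unique factorization into prime elements (free generators), and equipped with a nonnegative real-valued multiplicative norm $s\mapsto|s|$ for which any set of elements with bounded norm is finite. (It follows that $|s|>1$ for every $s\ne 1$.) For $x>0$, $\nu_{\mathcal{S}}(x)$ is the number of elements $s\in\mathcal{S}$ with $|s|\le x$, and $\pi_{\mathcal{S}}(x)$ is the number of primes $\mathfrak{p}\in\mathcal{S}$ with $|\mathfrak{p}|\le x$. The $O$-terms are as $x\to\infty$. $\Omega(s)$ is the number of prime factors of $s$, counted with multiplicity. Poisson-Dirichlet process PD($\theta$), $\theta>0$: let $U_1,U_2,\dots$ be independent uniform random variables on $(0,1)$, $V_i=U_i^{1/\theta}$, and $G_1=1-V_1$, $G_2=V_1(1-V_2)$, $G_3=V_1V_2(1-V_3),\dots$. Then PD($\theta$) is the distribution of the sequence $L_1\ge L_2\ge\cdots$ obtained by sorting $G_1,G_2,\dots$ into descending order. (Equivalently, it is the Poisson point process with intensity $\theta\,dx/x$ on $(0,1)$ conditioned on the sum of the arrivals being $1$.) Convergence in distribution of sequences means convergence in distribution of the first $k$ coordinates for every $k$. *)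

theory Defs
  imports "HOL-Probability.Probability" "HOL-Algebra.Divisibility" "HOL-Library.Landau_Symbols"
begin

hide_const (open) Factorial_Ring.prime Factorial_Ring.irreducible

section \<open>Normed arithmetic semigroups\<close>

text \<open>
  A \<open>factorial_monoid\<close> is commutative and cancellative with unique factorization up to
  associates. Since the identity is required to be the only unit, associated elements are equal
  and the monoid is freely generated by its primes. The weak inequality \<open>0 \<le> nrm s\<close> is
  the only positivity required of the norm.
\<close>

locale normed_arithmetic_semigroup = factorial_monoid S
  for S :: "('a, 'b) monoid_scheme" (structure) +
  fixes nrm :: "'a \<Rightarrow> real"
  assumes Units_eq: "Units S = {\<one>}"
    and nrm_nonneg: "s \<in> carrier S \<Longrightarrow> 0 \<le> nrm s"
    and nrm_mult: "\<lbrakk>s \<in> carrier S; t \<in> carrier S\<rbrakk> \<Longrightarrow> nrm (s \<otimes> t) = nrm s * nrm t"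
    and finite_nrm_le: "finite {s \<in> carrier S. nrm s \<le> x}"

definition elements_upto :: "('a, 'b) monoid_scheme \<Rightarrow> ('a \<Rightarrow> real) \<Rightarrow> real \<Rightarrow> 'a set" where
  "elements_upto S nrm x = {s \<in> carrier S. nrm s \<le> x}"

definition primes_of :: "('a, 'b) monoid_scheme \<Rightarrow> 'a set" where
  "primes_of S = {p \<in> carrier S. Divisibility.prime S p}"

definition nu :: "('a, 'b) monoid_scheme \<Rightarrow> ('a \<Rightarrow> real) \<Rightarrow> real \<Rightarrow> real" where
  "nu S nrm x = real (card (elements_upto S nrm x))"

definition prime_count :: "('a, 'b) monoid_scheme \<Rightarrow> ('a \<Rightarrow> real) \<Rightarrow> real \<Rightarrow> real" where
  "prime_count S nrm x = real (card {p \<in> primes_of S. nrm p \<le> x})"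

definition growth_A :: "('a, 'b) monoid_scheme \<Rightarrow> ('a \<Rightarrow> real) \<Rightarrow> bool" where
  "growth_A S nrm \<longleftrightarrow>
     (\<exists>A \<delta> E. A > 0 \<and> \<delta> > 0 \<and> E \<in> O[at_top](\<lambda>x. 1 / x powr \<delta>) \<and>
        (\<forall>\<^sub>F x in at_top. nu S nrm x = A * x * (1 + E x)))"

definition growth_B :: "('a, 'b) monoid_scheme \<Rightarrow> ('a \<Rightarrow> real) \<Rightarrow> real \<Rightarrow> bool" where
  "growth_B S nrm \<theta>\<^sub>0 \<longleftrightarrow>
     \<theta>\<^sub>0 > 0 \<and> \<theta>\<^sub>0 \<noteq> 1 \<and>
     (\<exists>\<epsilon> E. \<epsilon> > 0 \<and> E \<in> O[at_top](\<lambda>x. 1 / ln x powr \<epsilon>) \<and>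
        (\<forall>\<^sub>F x in at_top. prime_count S nrm x = \<theta>\<^sub>0 * (x / ln x) * (1 + E x)))"


section \<open>The process of normalized logarithms of prime factors\<close>

definition sorted_prime_factors ::
  "('a, 'b) monoid_scheme \<Rightarrow> ('a \<Rightarrow> real) \<Rightarrow> 'a \<Rightarrow> 'a list \<Rightarrow> bool" where
  "sorted_prime_factors S nrm s ps \<longleftrightarrow>
     set ps \<subseteq> primes_of S \<and> foldr (\<otimes>\<^bsub>S\<^esub>) ps \<one>\<^bsub>S\<^esub> = s \<and>
     sorted_wrt (\<lambda>p q. nrm p \<ge> nrm q) ps"

text \<open>
  The choice below only concerns the order of distinct primes of equal norm; see
  \<open>ex_sorted_prime_factors\<close> and \<open>sorted_prime_factors_nrm_unique\<close>. Coordinates are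
  counted from 0.
\<close>

definition L_process ::
  "('a, 'b) monoid_scheme \<Rightarrow> ('a \<Rightarrow> real) \<Rightarrow> real \<Rightarrow> 'a \<Rightarrow> nat \<Rightarrow> real" where
  "L_process S nrm n s i =
     (let ps = (SOME ps. sorted_prime_factors S nrm s ps)
      in if i < length ps then ln (nrm (ps ! i)) / ln n else 0)"

definition L_law :: "('a, 'b) monoid_scheme \<Rightarrow> ('a \<Rightarrow> real) \<Rightarrow> real \<Rightarrow> (nat \<Rightarrow> real) measure" where
  "L_law S nrm n =
     distr (measure_pmf (pmf_of_set (elements_upto S nrm n))) (\<Pi>\<^sub>M i\<in>UNIV. borel)
       (L_process S nrm n)"


section \<open>The Poisson-Dirichlet process\<close>

definition stick_breaking :: "real \<Rightarrow> (nat \<Rightarrow> real) \<Rightarrow> nat \<Rightarrow> real" where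
  "stick_breaking \<theta> u i =
     (\<Prod>j<i. u j powr (1 / \<theta>)) * (1 - u i powr (1 / \<theta>))"

definition is_descending_sort :: "(nat \<Rightarrow> real) \<Rightarrow> (nat \<Rightarrow> real) \<Rightarrow> bool" where
  "is_descending_sort g l \<longleftrightarrow> decseq l \<and> (\<exists>\<sigma>. bij \<sigma> \<and> l = g \<circ> \<sigma>)"

definition descending_sort :: "(nat \<Rightarrow> real) \<Rightarrow> nat \<Rightarrow> real" where
  "descending_sort g = (THE l. is_descending_sort g l)"

text \<open>
  The uniform variables live on the open interval itself, so every stick-breaking sequence is
  positive and tends to 0. Hence the sorted sequence exists everywhere and not just almost surely.
\<close>

definition uniform_sequence :: "(nat \<Rightarrow> real) measure" where
  "uniform_sequence = (\<Pi>\<^sub>M i\<in>UNIV. restrict_space lborel {0<..<1})"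

definition PD :: "real \<Rightarrow> (nat \<Rightarrow> real) measure" where
  "PD \<theta> = distr uniform_sequence (\<Pi>\<^sub>M i\<in>UNIV. borel) (descending_sort \<circ> stick_breaking \<theta>)"


section \<open>Convergence in distribution of sequences\<close>

text \<open>
  For each \<open>k\<close>, the laws of the first \<open>k\<close> coordinates converge weakly: integrals of
  bounded continuous functions on \<open>k\<close>-dimensional real space converge. That space is
  rendered as the product topology on extensional functions on \<open>{..<k}\<close>.
\<close>

definition converges_in_distribution ::
  "('c \<Rightarrow> (nat \<Rightarrow> real) measure) \<Rightarrow> (nat \<Rightarrow> real) measure \<Rightarrow> 'c filter \<Rightarrow> bool" where
  "converges_in_distribution M N F \<longleftrightarrow>
     (\<forall>k f. continuous_map (powertop_real {..<k}) euclideanreal f \<and>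
            bounded (f ` topspace (powertop_real {..<k})) \<longrightarrow>
        ((\<lambda>n. \<integral>x. f (restrict x {..<k}) \<partial>M n) \<longlongrightarrow> (\<integral>x. f (restrict x {..<k}) \<partial>N)) F)"


section \<open>Well-definedness\<close>

context normed_arithmetic_semigroup
begin

lemma ex_sorted_prime_factors:
  assumes "s \<in> carrier S"
  shows "\<exists>ps. sorted_prime_factors S nrm s ps"
proof -
  obtain fs where fs: "set fs \<subseteq> carrier S" "factors S fs s"
  proof (cases "s \<in> Units S")
    case True
    then have "factors S [] s" using Units_eq by (simp add: factors_def)
    then show ?thesis using that[of "[]"] by simp
  next
    case False
    then show ?thesis using factors_exist[OF assms] that by blast
  qed
  define ps where "ps = sort_key (\<lambda>p. - nrm p) fs"
  have m: "mset fs = mset ps" by (simp add: ps_def)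
  then have set_eq: "set ps = set fs" by (metis set_mset_mset)
  have "foldr (\<otimes>) fs \<one> = foldr (\<otimes>) ps \<one>"
    using multlist_perm_cong[of fs ps] m fs(1) by simp
  moreover have "sorted_wrt (\<lambda>p q. nrm p \<ge> nrm q) ps"
    using sorted_sort_key[of "\<lambda>p. - nrm p" fs] by (simp add: ps_def sorted_map)
  moreover have "set ps \<subseteq> primes_of S"
    using fs irreducible_prime by (auto simp: set_eq primes_of_def factors_def)
  ultimately show ?thesis
    using fs(2) unfolding sorted_prime_factors_def factors_def by auto
qed

lemma sorted_prime_factors_nrm_unique:
  assumes "s \<in> carrier S" "sorted_prime_factors S nrm s ps" "sorted_prime_factors S nrm s qs"
  shows "map nrm ps = map nrm qs"
proof -
  have fac: "set xs \<subseteq> carrier S \<and> wfactors S xs s" if "sorted_prime_factors S nrm s xs" for xs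
  proof -
    have c: "set xs \<subseteq> carrier S" and e: "foldr (\<otimes>) xs \<one> = s"
      and p: "\<forall>x\<in>set xs. irreducible S x"
      using that prime_irreducible by (auto simp: sorted_prime_factors_def primes_of_def)
    then show ?thesis using assms(1) by (auto simp: wfactors_def)
  qed
  have "essentially_equal S ps qs"
    using wfactors_unique[of ps s qs] fac assms by blast
  then obtain rs where rs: "mset ps = mset rs" "list_all2 (\<sim>\<^bsub>S\<^esub>) rs qs"
    by (auto simp: essentially_equal_def)
  have assoc_eq: "x = y" if "x \<sim> y" "x \<in> carrier S" "y \<in> carrier S" for x y
    using that Units_eq by (metis associatedE2 singletonD r_one)
  have "set rs \<subseteq> carrier S" "set qs \<subseteq> carrier S"
    using fac assms rs(1) by (metis set_mset_mset)+
  then have "rs = qs"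
    using rs(2) assoc_eq
    by (auto simp: list_all2_conv_all_nth in_mono intro!: nth_equalityI assoc_eq)
  then have "mset (map (\<lambda>p. - nrm p) ps) = mset (map (\<lambda>p. - nrm p) qs)"
    using rs(1) by simp
  moreover have "sorted (map (\<lambda>p. - nrm p) ps)" "sorted (map (\<lambda>p. - nrm p) qs)"
    using assms by (simp_all add: sorted_prime_factors_def sorted_map)
  ultimately have "map (\<lambda>p. - nrm p) ps = map (\<lambda>p. - nrm p) qs"
    by (metis properties_for_sort)
  then have "map uminus (map (\<lambda>p. - nrm p) ps) = map uminus (map (\<lambda>p. - nrm p) qs)"
    by simp
  then show ?thesis by (simp add: o_def)
qed

end

lemma is_descending_sort_gt_iff:
  assumes "is_descending_sort g l"
  shows "l i > t \<longleftrightarrow> (\<exists>J. finite J \<and> card J = Suc i \<and> (\<forall>j\<in>J. g j > t))"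
proof -
  from assms obtain \<sigma> where s: "decseq l" "bij \<sigma>" "l = g \<circ> \<sigma>"
    by (auto simp: is_descending_sort_def)
  show ?thesis
  proof
    assume "l i > t"
    then have "\<forall>k\<le>i. l k > t" using decseqD[OF s(1)] by (blast intro: less_le_trans)
    then have "\<forall>j\<in>\<sigma> ` {..i}. g j > t" using s(3) by auto
    moreover have "card (\<sigma> ` {..i}) = Suc i"
      using s(2) by (simp add: card_image bij_def inj_on_def)
    ultimately show "\<exists>J. finite J \<and> card J = Suc i \<and> (\<forall>j\<in>J. g j > t)" by blast
  next
    assume "\<exists>J. finite J \<and> card J = Suc i \<and> (\<forall>j\<in>J. g j > t)"
    then obtain J where J: "finite J" "card J = Suc i" "\<forall>j\<in>J. g j > t" by blast
    have b: "bij (inv_into UNIV \<sigma>)" using s(2) by (rule bij_imp_bij_inv)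
    have "card (inv_into UNIV \<sigma> ` J) = Suc i"
      using J(2) b by (metis bij_def card_image inj_on_subset subset_UNIV)
    then have "\<not> inv_into UNIV \<sigma> ` J \<subseteq> {..<i}"
      using card_mono[of "{..<i}" "inv_into UNIV \<sigma> ` J"] by auto
    then obtain j where j: "j \<in> J" "inv_into UNIV \<sigma> j \<ge> i" by (auto simp: subset_eq not_less)
    have "l (inv_into UNIV \<sigma> j) = g j" using s(2,3) by (simp add: bij_def surj_f_inv_f)
    then show "l i > t" using J(3) j s(1) by (metis decseqD less_le_trans)
  qed
qed

lemma is_descending_sort_unique:
  assumes "is_descending_sort g l" "is_descending_sort g l'"
  shows "l = l'"
proof
  fix i
  have "l i > t \<longleftrightarrow> l' i > t" for t
    using is_descending_sort_gt_iff[OF assms(1)] is_descending_sort_gt_iff[OF assms(2)] by simp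
  then show "l i = l' i" by (metis less_irrefl linorder_neqE)
qed

lemma ex_descending_sort:
  assumes pos: "\<And>i. g i > (0::real)" and lim: "g \<longlonglongrightarrow> 0"
  shows "\<exists>l. is_descending_sort g l"
proof -
  define before where "before = (\<lambda>j. {k. g k > g j \<or> (g k = g j \<and> k < j)})"
  define r where "r = (\<lambda>j. card (before j))"
  have fin: "finite (before j)" for j
  proof -
    have "eventually (\<lambda>k. g k < g j) sequentially"
      using lim pos[of j] by (rule order_tendstoD(2))
    then obtain N where N: "\<And>k. k \<ge> N \<Longrightarrow> g k < g j"
      by (auto simp: eventually_sequentially)
    have "before j \<subseteq> {..<N}"
    proof
      fix k assume "k \<in> before j"
      then show "k \<in> {..<N}" using N[of k] by (cases "N \<le> k") (auto simp: before_def)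
    qed
    then show ?thesis by (rule finite_subset) simp
  qed
  have less: "r k < r j" if "k \<in> before j" for k j
    unfolding r_def
  proof (rule psubset_card_mono[OF fin])
    show "before k \<subset> before j"
    proof
      show "before k \<subseteq> before j" using that by (auto simp: before_def)
      show "before k \<noteq> before j" using that by (auto simp: before_def)
    qed
  qed
  have total: "k \<in> before j \<or> j \<in> before k \<or> k = j" for j k
    by (auto simp: before_def)
  have inj: "inj r"
    by (rule injI) (metis less total less_irrefl)
  have r_image: "r ` before j = {..<r j}" for j
  proof (rule card_subset_eq)
    show "r ` before j \<subseteq> {..<r j}" using less by auto
    show "card (r ` before j) = card {..<r j}"
      using inj by (simp add: card_image inj_on_subset r_def)
  qed simp
  have "surj r"
  proof -
    have "\<exists>j. r j > m" for m
    proof -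
      have "infinite (range r)" using inj by (simp add: finite_image_iff)
      then show ?thesis by (metis finite_nat_set_iff_bounded_le rangeE linorder_not_le)
    qed
    then have "m \<in> range r" for m
    proof -
      obtain j where "m \<in> {..<r j}" using \<open>\<exists>j. r j > m\<close> by auto
      then have "m \<in> r ` before j" by (simp only: r_image)
      then show ?thesis by blast
    qed
    then show ?thesis by auto
  qed
  with inj have b: "bij r" by (simp add: bij_def)
  have "decseq (g \<circ> inv_into UNIV r)"
  proof (rule decseq_SucI, rule ccontr)
    fix n
    assume "\<not> (g \<circ> inv_into UNIV r) (Suc n) \<le> (g \<circ> inv_into UNIV r) n"
    then have "inv_into UNIV r (Suc n) \<in> before (inv_into UNIV r n)" by (auto simp: before_def)
    then have "r (inv_into UNIV r (Suc n)) < r (inv_into UNIV r n)" by (rule less)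
    then show False using b by (simp add: bij_def surj_f_inv_f)
  qed
  then show ?thesis
    using b by (auto simp: is_descending_sort_def intro: bij_imp_bij_inv)
qed

lemma stick_breaking_pos:
  assumes "\<theta> > 0" "\<And>i. u i \<in> {0<..<1}"
  shows "stick_breaking \<theta> u i > 0"
proof -
  have "u i > 0" "u i < 1" for i using assms(2)[of i] by auto
  then have "u i powr (1 / \<theta>) < 1" "u i powr (1 / \<theta>) > 0" for i
    using assms(1) powr_less_mono2[of "1 / \<theta>" "u i" 1] by (simp_all add: less_imp_le less_imp_neq[symmetric])
  then show ?thesis by (auto simp: stick_breaking_def intro!: mult_pos_pos prod_pos)
qed

lemma stick_breaking_tendsto_0:
  assumes "\<theta> > 0" "\<And>i. u i \<in> {0<..<1}"
  shows "stick_breaking \<theta> u \<longlonglongrightarrow> 0"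
proof -
  have eq: "(\<Sum>i<n. stick_breaking \<theta> u i) = 1 - (\<Prod>j<n. u j powr (1 / \<theta>))" for n
    by (induction n) (auto simp: stick_breaking_def algebra_simps)
  have "summable (stick_breaking \<theta> u)"
  proof (rule summableI_nonneg_bounded)
    show "0 \<le> stick_breaking \<theta> u n" for n
      using stick_breaking_pos[OF assms] by (rule less_imp_le)
    show "(\<Sum>i<n. stick_breaking \<theta> u i) \<le> 1" for n
      unfolding eq by (simp add: prod_nonneg)
  qed
  then show ?thesis by (rule summable_LIMSEQ_zero)
qed

lemma space_uniform_sequence: "space uniform_sequence = {u. \<forall>i. u i \<in> {0<..<1}}"
  by (auto simp: uniform_sequence_def space_PiM space_restrict_space PiE_def)

lemma is_descending_sort_descending_sort:
  assumes "\<theta> > 0" "u \<in> space uniform_sequence"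
  shows "is_descending_sort (stick_breaking \<theta> u) (descending_sort (stick_breaking \<theta> u))"
proof -
  have "\<And>i. u i \<in> {0<..<1}" using assms(2) unfolding space_uniform_sequence by blast
  then obtain l where "is_descending_sort (stick_breaking \<theta> u) l"
    using ex_descending_sort stick_breaking_pos stick_breaking_tendsto_0 assms(1) by metis
  then show ?thesis
    unfolding descending_sort_def by (metis is_descending_sort_unique theI)
qed

lemma measurable_stick_breaking:
  "(\<lambda>u. stick_breaking \<theta> u i) \<in> borel_measurable uniform_sequence"
proof -
  have "(\<lambda>u. u j) \<in> measurable uniform_sequence (restrict_space lborel {0<..<1::real})" for j
    unfolding uniform_sequence_def by (rule measurable_component_singleton) simp
  then have [measurable]: "(\<lambda>u. u j) \<in> borel_measurable uniform_sequence" for j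
    by (auto simp: measurable_restrict_space2_iff)
  show ?thesis unfolding stick_breaking_def by measurable
qed

lemma measurable_descending_sort:
  assumes "\<theta> > 0"
  shows "descending_sort \<circ> stick_breaking \<theta> \<in> measurable uniform_sequence (\<Pi>\<^sub>M i\<in>UNIV. borel)"
proof (rule measurable_PiM_single')
  fix i :: nat
  show "(\<lambda>u. (descending_sort \<circ> stick_breaking \<theta>) u i) \<in> borel_measurable uniform_sequence"
    unfolding borel_measurable_iff_greater
  proof
    fix t
    note [measurable] = measurable_stick_breaking
    have "{u \<in> space uniform_sequence. t < (descending_sort \<circ> stick_breaking \<theta>) u i} =
      (\<Union>J\<in>{J. finite J \<and> card J = Suc i}. {u \<in> space uniform_sequence. \<forall>j\<in>J. t < stick_breaking \<theta> u j})"
      using is_descending_sort_gt_iff[OF is_descending_sort_descending_sort[OF assms]]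
      by auto
    also have "\<dots> \<in> sets uniform_sequence"
    proof (rule sets.countable_UN'')
      show "countable {J :: nat set. finite J \<and> card J = Suc i}"
        by (rule countable_subset[OF _ countable_Collect_finite]) auto
    next
      show "{u \<in> space uniform_sequence. \<forall>j\<in>J. t < stick_breaking \<theta> u j} \<in> sets uniform_sequence"
        if "J \<in> {J. finite J \<and> card J = Suc i}" for J
        using that by (intro sets.sets_Collect_finite_All') auto
    qed
    finally show "{u \<in> space uniform_sequence. t < (descending_sort \<circ> stick_breaking \<theta>) u i}
      \<in> sets uniform_sequence" .
  qed
qed (auto simp: PiE_def)

lemma prob_space_PD:
  assumes "\<theta> > 0"
  shows "prob_space (PD \<theta>)"
proof -
  have "prob_space (restrict_space lborel {0<..<1::real})"
    by (intro prob_spaceI) (simp add: emeasure_restrict_space space_restrict_space)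
  then have "prob_space uniform_sequence"
    unfolding uniform_sequence_def by (intro prob_space_PiM)
  then show ?thesis
    unfolding PD_def by (intro prob_space.prob_space_distr measurable_descending_sort[OF assms])
qed

end

theory Submission
  imports Defs "HOL-Real_Asymp.Real_Asymp"
begin

text \<open>
  Pick the prime factors of a random \<open>s\<close> with \<open>|s| \<le> n\<close> one after the other without replacement,
  each with probability proportional to its logarithm. On the scale \<open>t = ln n\<close>, the prime \<open>p\<close> is
  picked first with probability about \<open>ln |p| / t \<cdot> \<nu>(n / |p|) / \<nu>(n)\<close>, and the cofactor is then
  again uniform, now on the scale \<open>t - ln |p|\<close>. If the sum of \<open>ln |p| / |p|\<close> over
  \<open>|p| \<le> exp t\<close> is asymptotic to \<open>\<theta> t\<close> and \<open>\<nu>(exp t) exp (-t)\<close> varies regularly with index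
  \<open>\<theta> - 1\<close>, then \<open>ln |p| / t\<close> is distributed in the limit as the first stick \<open>1 - U powr (1 / \<theta>)\<close>,
  and induction on the number of picks gives the unsorted stick-breaking sequence. Since
  its total mass is 1, lower bounds suffice throughout. Sorting is a contraction in the supremum
  norm, and the mass not covered by \<open>K\<close> picks bounds the effect of ignoring the other factors.

  Under (A) the asymptotics of the prime sum follow from
  \<open>\<Sum>\<^bsub>|s| \<le> n\<^esub> ln |s| = \<Sum>\<^bsub>(p, k)\<^esub> ln |p| \<nu>(n / |p|\<^sup>k)\<close>. Under (B) the same identity, read as a sum of
  Chebyshev functions over \<open>s\<close>, shows that \<open>t \<nu>(exp t) exp (-t)\<close> is asymptotic to \<open>\<theta> R t\<close> for a
  function \<open>R\<close> with derivative \<open>\<nu>(exp t) exp (-t)\<close>, so that \<open>t R' / R\<close> tends to \<open>\<theta>\<close> and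
  \<open>R\<close> varies regularly.
\<close>

subsection \<open>Functions with piecewise derivatives\<close>

text \<open>Picking primes with weight \<open>lam p\<close> has the effect that their distribution
  enters only through the averaged sum \<open>prime_mass\<close>, which the counting function of the
  elements determines under (A). The obstacle under (B) is that the identity between primes and
  elements compares \<open>N t\<close> with an exponentially weighted sum over all elements up to
  \<open>t\<close>, not with \<open>N\<close> at another point. The continuous function
  \<open>R\<close> is introduced for this reason: it turns the identity into an asymptotic
  differential equation, which can be integrated in the variable \<open>ln t\<close>, whereas
  \<open>N\<close> itself jumps. On the probabilistic side the same lower bound is applied to a
  bounded function and to a constant minus that function; this yields both inequalities. Hence mass
  may be discarded at any point, as long as the total loss is small: primes outside finitely many
  cells, repeated factors, cofactors on a bounded scale. The price is that all test functions have
  to be nonnegative, and that this has to survive freezing the first stick and subtracting an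
  error.\<close>

definition piecewise_deriv :: "(real \<Rightarrow> real) \<Rightarrow> (real \<Rightarrow> real) \<Rightarrow> bool" where
  "piecewise_deriv f f' \<longleftrightarrow> (\<forall>a b. continuous_on {a..b} f) \<and>
     (\<forall>b. \<exists>S. finite S \<and> (\<forall>x. x < b \<longrightarrow> x \<notin> S \<longrightarrow> (f has_real_derivative f' x) (at x)))"

lemma piecewise_deriv_mono:
  assumes "finite S" "a \<le> b" "continuous_on {a..b} f"
    and "\<And>x. x \<in> {a<..<b} - S \<Longrightarrow> (f has_real_derivative f' x) (at x)"
    and "\<And>x. x \<in> {a<..<b} - S \<Longrightarrow> 0 \<le> f' x"
  shows "f a \<le> (f b :: real)"
proof -
  \<comment> \<open>At the exceptional points and the endpoints \<open>f'\<close> is arbitrary; the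
    value 0 there keeps the integrand nonnegative on the whole interval.\<close>
  define h where "h = (\<lambda>x. if x \<in> {a<..<b} - S then f' x else 0)"
  have "(h has_integral (f b - f a)) {a..b}"
  proof (rule fundamental_theorem_of_calculus_interior_strong[OF assms(1,2) _ assms(3)])
    fix x assume "x \<in> {a<..<b} - S"
    then show "(f has_vector_derivative h x) (at x)"
      using assms(4) by (simp add: h_def has_real_derivative_iff_has_vector_derivative[symmetric])
  qed
  then have "0 \<le> f b - f a"
    by (rule has_integral_nonneg) (use assms(5) in \<open>auto simp: h_def\<close>)
  then show ?thesis by simp
qed

text \<open>Beyond some \<open>t0\<close> both \<open>f t - (\<theta> - d) * t\<close> and
  \<open>(\<theta> + d) * t - f t\<close> are increasing, so \<open>f t\<close> differs from
  \<open>\<theta> * t\<close> by at most \<open>d * t\<close> plus a constant. This is l'Hopital's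
  rule for functions with kinks.\<close>

lemma piecewise_deriv_imp_average:
  assumes pd: "piecewise_deriv f f'" and lim: "(f' \<longlongrightarrow> \<theta>) at_top"
  shows "((\<lambda>t. f t / t) \<longlongrightarrow> \<theta>) at_top"
proof (rule tendstoI)
  fix e :: real assume "e > 0"
  define d where "d = e / 2"
  have d: "d > 0" using \<open>e > 0\<close> by (simp add: d_def)
  from tendstoD[OF lim d] obtain t0 where t0: "\<And>t. t \<ge> t0 \<Longrightarrow> \<bar>f' t - \<theta>\<bar> < d"
    by (auto simp: eventually_at_top_linorder dist_real_def)
  have close: "\<bar>f t - f t0 - \<theta> * (t - t0)\<bar> \<le> d * (t - t0)" if t: "t \<ge> t0" for t
  proof -
    from pd obtain S where S: "finite S" 
        "\<And>x. x < t \<Longrightarrow> x \<notin> S \<Longrightarrow> (f has_real_derivative f' x) (at x)"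
      unfolding piecewise_deriv_def by blast
    have c: "continuous_on {t0..t} f" using pd unfolding piecewise_deriv_def by blast
    have "f t0 - (\<theta> - d) * t0 \<le> f t - (\<theta> - d) * t"
    proof (rule piecewise_deriv_mono[OF S(1) t])
      show "continuous_on {t0..t} (\<lambda>x. f x - (\<theta> - d) * x)" using c by (intro continuous_intros)
      fix x assume x: "x \<in> {t0<..<t} - S"
      show "((\<lambda>x. f x - (\<theta> - d) * x) has_real_derivative f' x - (\<theta> - d)) (at x)"
        using S(2)[of x] x by (auto intro!: derivative_eq_intros)
      show "0 \<le> f' x - (\<theta> - d)" using t0[of x] x by auto
    qed
    moreover have "(\<theta> + d) * t0 - f t0 \<le> (\<theta> + d) * t - f t"
    proof (rule piecewise_deriv_mono[OF S(1) t])
      show "continuous_on {t0..t} (\<lambda>x. (\<theta> + d) * x - f x)" using c by (intro continuous_intros)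
      fix x assume x: "x \<in> {t0<..<t} - S"
      show "((\<lambda>x. (\<theta> + d) * x - f x) has_real_derivative (\<theta> + d) - f' x) (at x)"
        using S(2)[of x] x by (auto intro!: derivative_eq_intros)
      show "0 \<le> (\<theta> + d) - f' x" using t0[of x] x by auto
    qed
    ultimately show ?thesis by (simp add: abs_le_iff algebra_simps)
  qed
  define C where "C = \<bar>f t0\<bar> + \<bar>\<theta>\<bar> * \<bar>t0\<bar> + d * \<bar>t0\<bar>"
  have "\<forall>\<^sub>F t in at_top. C / t < d"
    using d by real_asymp
  then show "\<forall>\<^sub>F t in at_top. dist (f t / t) \<theta> < e"
    using eventually_ge_at_top[of t0] eventually_gt_at_top[of 0]
  proof eventually_elim
    case (elim t)
    have "\<bar>f t - \<theta> * t\<bar> \<le> \<bar>f t - f t0 - \<theta> * (t - t0)\<bar> + \<bar>f t0\<bar> + \<bar>\<theta> * t0\<bar>"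
      by (simp add: algebra_simps abs_if)
    also have "\<dots> \<le> d * t + C"
    proof -
      have "- (d * t0) \<le> d * \<bar>t0\<bar>" using d by (metis abs_ge_minus_self abs_mult abs_of_pos)
      then show ?thesis using close[OF elim(2)] by (simp add: C_def abs_mult algebra_simps)
    qed
    finally have "\<bar>f t - \<theta> * t\<bar> / t \<le> d + C / t"
      using elim(3) by (simp add: field_simps)
    moreover have "\<bar>f t / t - \<theta>\<bar> = \<bar>f t - \<theta> * t\<bar> / t"
    proof -
      have "f t / t - \<theta> = (f t - \<theta> * t) / t" using elim(3) by (simp add: field_simps)
      then show ?thesis using elim(3) by (simp add: abs_divide)
    qed
    ultimately show ?case using elim(1) unfolding dist_real_def d_def by linarith
  qed
qed

text \<open>The quotient \<open>t * f' t / f t\<close> is the derivative of \<open>ln f\<close> with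
  respect to \<open>ln t\<close>. Once it is within \<open>d\<close> of \<open>\<kappa>\<close>,
  comparing \<open>ln f\<close> with \<open>(\<kappa> - d) * ln\<close> and
  \<open>(\<kappa> + d) * ln\<close> on the interval from \<open>u * t\<close> to \<open>t\<close>
  traps the ratio between two powers of \<open>u\<close>, and \<open>d\<close> tends to 0.\<close>

lemma piecewise_deriv_imp_regular_variation:
  assumes pd: "piecewise_deriv f f'" and lim: "((\<lambda>t. t * f' t / f t) \<longlongrightarrow> \<kappa>) at_top"
    and pos: "\<forall>\<^sub>F t in at_top. f t > 0" and u: "0 < u" "u \<le> 1"
  shows "((\<lambda>t. f (u * t) / f t) \<longlongrightarrow> u powr \<kappa>) at_top"
proof -
  have bounds: "\<forall>\<^sub>F t in at_top. u powr (\<kappa> + d) \<le> f (u * t) / f t \<and> f (u * t) / f t \<le> u powr (\<kappa> - d)"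
    if d: "d > 0" for d
  proof -
    have "\<forall>\<^sub>F t in at_top. \<bar>t * f' t / f t - \<kappa>\<bar> < d \<and> f t > 0 \<and> t > 0"
      using tendstoD[OF lim d] pos eventually_gt_at_top[of 0]
      by eventually_elim (simp add: dist_real_def)
    then obtain t0 where t0: "\<And>t. t \<ge> t0 \<Longrightarrow> \<bar>t * f' t / f t - \<kappa>\<bar> < d \<and> f t > 0 \<and> t > 0"
      by (auto simp: eventually_at_top_linorder)
    have deriv_bounds: "(\<kappa> - d) / x \<le> f' x / f x \<and> f' x / f x \<le> (\<kappa> + d) / x" if "x \<ge> t0" for x
    proof -
      have "x > 0" "\<kappa> - d \<le> x * (f' x / f x)" "x * (f' x / f x) \<le> \<kappa> + d"
        using t0[OF that] by (auto simp: abs_less_iff)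
      then show ?thesis by (simp add: field_simps)
    qed
    have main: "u powr (\<kappa> + d) \<le> f (u * t) / f t \<and> f (u * t) / f t \<le> u powr (\<kappa> - d)"
      if t: "u * t \<ge> t0" for t
    proof -
      have ut: "u * t > 0" using t0[OF t] by simp
      then have tp: "t > 0" using u by (simp add: zero_less_mult_iff)
      then have le: "u * t \<le> t" using u by (simp add: mult_left_le_one_le)
      from pd obtain S where S: "finite S" 
          "\<And>x. x < t \<Longrightarrow> x \<notin> S \<Longrightarrow> (f has_real_derivative f' x) (at x)"
        unfolding piecewise_deriv_def by blast
      have c: "continuous_on {u*t..t} f" using pd unfolding piecewise_deriv_def by blast
      have ge: "t0 \<le> x" if "x \<in> {u*t..t}" for x using that t by simp
      have ge': "t0 \<le> x" if "x \<in> {u*t<..<t} - S" for x using that t by simp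
      have cln: "continuous_on {u*t..t} (\<lambda>x. ln (f x))" "continuous_on {u*t..t} (\<lambda>x::real. ln x)"
      proof -
        have nz: "f x \<noteq> 0" "x \<noteq> 0" if "x \<in> {u*t..t}" for x
          using t0[OF ge[OF that]] by simp_all
        show "continuous_on {u*t..t} (\<lambda>x. ln (f x))" "continuous_on {u*t..t} (\<lambda>x::real. ln x)"
          by (intro continuous_on_ln c continuous_on_id ballI nz; assumption)+
      qed
      have dlnf: "((\<lambda>x. ln (f x)) has_real_derivative 1 / f x * f' x) (at x)"
        and dln: "((\<lambda>x. c * ln x) has_real_derivative c * (1 / x)) (at x)"
        if x: "x \<in> {u*t<..<t} - S" for x c
      proof -
        have "f x > 0" "x > 0" using t0[OF ge'[OF x]] by simp_all
        moreover have "(f has_real_derivative f' x) (at x)" using S(2) x by simp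
        ultimately show "((\<lambda>x. ln (f x)) has_real_derivative 1 / f x * f' x) (at x)"
          and "((\<lambda>x. c * ln x) has_real_derivative c * (1 / x)) (at x)"
          by (blast intro: DERIV_chain2[OF DERIV_ln_divide] DERIV_cmult DERIV_ln_divide)+
      qed
      have "ln (f (u*t)) - (\<kappa> - d) * ln (u*t) \<le> ln (f t) - (\<kappa> - d) * ln t"
      proof (rule piecewise_deriv_mono[OF S(1) le])
        show "continuous_on {u*t..t} (\<lambda>x. ln (f x) - (\<kappa> - d) * ln x)"
          by (intro continuous_on_diff continuous_on_mult_left cln)
        fix x assume x: "x \<in> {u*t<..<t} - S"
        show "((\<lambda>x. ln (f x) - (\<kappa> - d) * ln x) has_real_derivative f' x / f x - (\<kappa> - d) / x) (at x)"
          using DERIV_diff[OF dlnf[OF x] dln[OF x, of "\<kappa> - d"]] by simp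
        show "0 \<le> f' x / f x - (\<kappa> - d) / x" using deriv_bounds[OF ge'[OF x]] by simp
      qed
      moreover have "(\<kappa> + d) * ln (u*t) - ln (f (u*t)) \<le> (\<kappa> + d) * ln t - ln (f t)"
      proof (rule piecewise_deriv_mono[OF S(1) le])
        show "continuous_on {u*t..t} (\<lambda>x. (\<kappa> + d) * ln x - ln (f x))"
          by (intro continuous_on_diff continuous_on_mult_left cln)
        fix x assume x: "x \<in> {u*t<..<t} - S"
        show "((\<lambda>x. (\<kappa> + d) * ln x - ln (f x)) has_real_derivative (\<kappa> + d) / x - f' x / f x) (at x)"
          using DERIV_diff[OF dln[OF x, of "\<kappa> + d"] dlnf[OF x]] by simp
        show "0 \<le> (\<kappa> + d) / x - f' x / f x" using deriv_bounds[OF ge'[OF x]] by simp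
      qed
      moreover have fp: "f (u*t) > 0" "f t > 0"
        using t0[OF t] t0[of t] t le by auto
      ultimately have "(\<kappa> + d) * ln u \<le> ln (f (u*t) / f t)" "ln (f (u*t) / f t) \<le> (\<kappa> - d) * ln u"
        using u tp by (simp_all add: ln_mult ln_div algebra_simps)
      then have "exp ((\<kappa> + d) * ln u) \<le> f (u*t) / f t" "f (u*t) / f t \<le> exp ((\<kappa> - d) * ln u)"
        using fp by (metis divide_pos_pos exp_le_cancel_iff exp_ln)+
      then show ?thesis using u by (simp add: powr_def)
    qed
    have "\<forall>\<^sub>F t in at_top. u * t \<ge> t0"
      using u by real_asymp
    then show ?thesis by eventually_elim (rule main)
  qed
  show ?thesis
  proof (rule tendstoI)
    fix e :: real assume e: "e > 0"
    have "((\<lambda>d. u powr (\<kappa> + d)) \<longlongrightarrow> u powr (\<kappa> + 0)) (at_right 0)"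
         "((\<lambda>d. u powr (\<kappa> - d)) \<longlongrightarrow> u powr (\<kappa> - 0)) (at_right 0)"
      using u by (intro tendsto_intros; simp)+
    then have "\<forall>\<^sub>F d in at_right 0. dist (u powr (\<kappa> + d)) (u powr \<kappa>) < e \<and> dist (u powr (\<kappa> - d)) (u powr \<kappa>) < e \<and> 0 < (d::real)"
      using e by (intro eventually_conj tendstoD eventually_at_right_less) simp_all
    then obtain d where d: "dist (u powr (\<kappa> + d)) (u powr \<kappa>) < e" "dist (u powr (\<kappa> - d)) (u powr \<kappa>) < e" "0 < d"
      using eventually_happens[of _ "at_right (0::real)"] by force
    from bounds[OF d(3)] show "\<forall>\<^sub>F t in at_top. dist (f (u * t) / f t) (u powr \<kappa>) < e"
      by eventually_elim (use d in \<open>auto simp: dist_real_def\<close>)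
  qed
qed

definition step :: "'i set \<Rightarrow> ('i \<Rightarrow> real) \<Rightarrow> ('i \<Rightarrow> real) \<Rightarrow> real \<Rightarrow> real" where
  "step X pos w t = (\<Sum>i | i \<in> X \<and> pos i \<le> t. w i)"

text \<open>This is the integral of \<open>exp (- x) * step X pos w x\<close> over all
  \<open>x\<close> up to \<open>t\<close>, written as a sum.\<close>

definition ramp :: "'i set \<Rightarrow> ('i \<Rightarrow> real) \<Rightarrow> ('i \<Rightarrow> real) \<Rightarrow> real \<Rightarrow> real" where
  "ramp X pos w t = (\<Sum>i | i \<in> X \<and> pos i \<le> t. w i * (exp (- pos i) - exp (- t)))"

text \<open>Makes the index set independent of \<open>t\<close>, so that continuity and
  differentiation can be treated term by term.\<close>

lemma ramp_eq_max:
  assumes "finite {i \<in> X. pos i \<le> b}" "t \<le> b"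
  shows "ramp X pos w t = (\<Sum>i | i \<in> X \<and> pos i \<le> b. w i * max 0 (exp (- pos i) - exp (- t)))"
  unfolding ramp_def
  by (rule sum.mono_neutral_cong_left) (use assms in \<open>auto simp: max_def not_le\<close>)

text \<open>Kinks occur only at the positions of the jumps, of which there are finitely many below
  every bound. The set of all kinks may be infinite, hence the exceptional set in
  \<open>piecewise_deriv\<close> depends on \<open>b\<close>.\<close>

lemma piecewise_deriv_ramp:
  assumes fin: "\<And>b. finite {i \<in> X. pos i \<le> b}"
  shows "piecewise_deriv (ramp X pos w) (\<lambda>t. exp (- t) * step X pos w t)"
  unfolding piecewise_deriv_def
proof (intro conjI allI)
  fix a b :: real
  have "continuous_on {a..b} (\<lambda>t. \<Sum>i | i \<in> X \<and> pos i \<le> b. w i * max 0 (exp (- pos i) - exp (- t)))"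
    by (intro continuous_intros)
  then show "continuous_on {a..b} (ramp X pos w)"
    by (rule continuous_on_eq) (simp add: ramp_eq_max[OF fin[of b]])
  show "\<exists>S. finite S \<and> (\<forall>x. x < b \<longrightarrow> x \<notin> S \<longrightarrow>
    (ramp X pos w has_real_derivative exp (- x) * step X pos w x) (at x))"
  proof (intro exI conjI allI impI)
    show "finite (pos ` {i \<in> X. pos i \<le> b})" using fin[of b] by simp
    fix x assume x: "x < b" "x \<notin> pos ` {i \<in> X. pos i \<le> b}"
    have d1: "((\<lambda>t. w i * max 0 (exp (- pos i) - exp (- t))) has_real_derivative
      (if pos i \<le> x then w i * exp (- x) else 0)) (at x)" if i: "i \<in> X" "pos i \<le> b" for i
    proof (cases "pos i \<le> x")
      case True
      then have "pos i < x" using x i by force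
      then have ev: "\<forall>\<^sub>F t in nhds x. w i * (exp (- pos i) - exp (- t)) = w i * max 0 (exp (- pos i) - exp (- t))"
        by (intro eventually_mono[OF eventually_nhds_in_open[of "{pos i<..}" x]]) auto
      have d: "((\<lambda>t. w i * (exp (- pos i) - exp (- t))) has_real_derivative w i * exp (- x)) (at x)"
        by (auto intro!: derivative_eq_intros)
      show ?thesis using iffD1[OF DERIV_cong_ev[OF refl ev refl] d] True by simp
    next
      case False
      then have ev: "\<forall>\<^sub>F t in nhds x. 0 = w i * max 0 (exp (- pos i) - exp (- t))"
        by (intro eventually_mono[OF eventually_nhds_in_open[of "{..<pos i}" x]]) auto
      have d: "((\<lambda>t. 0) has_real_derivative 0) (at x)" by simp
      show ?thesis using iffD1[OF DERIV_cong_ev[OF refl ev refl] d] False by simp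
    qed
    have "((\<lambda>t. \<Sum>i | i \<in> X \<and> pos i \<le> b. w i * max 0 (exp (- pos i) - exp (- t))) has_real_derivative
      (\<Sum>i | i \<in> X \<and> pos i \<le> b. if pos i \<le> x then w i * exp (- x) else 0)) (at x)"
      by (intro DERIV_sum d1) auto
    also have "(\<Sum>i | i \<in> X \<and> pos i \<le> b. if pos i \<le> x then w i * exp (- x) else 0) =
      exp (- x) * step X pos w x"
      unfolding step_def sum_distrib_left
      by (rule sum.mono_neutral_cong_right) (use fin[of b] x in auto)
    finally have D: "((\<lambda>t. \<Sum>i | i \<in> X \<and> pos i \<le> b. w i * max 0 (exp (- pos i) - exp (- t))) has_real_derivative
       exp (- x) * step X pos w x) (at x)" .
    have ev: "\<forall>\<^sub>F t in nhds x. (\<Sum>i | i \<in> X \<and> pos i \<le> b. w i * max 0 (exp (- pos i) - exp (- t))) = ramp X pos w t"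
      by (intro eventually_mono[OF eventually_nhds_in_open[of "{..<b}" x]])
        (use x in \<open>auto simp: ramp_eq_max[OF fin[of b]]\<close>)
    show "(ramp X pos w has_real_derivative exp (- x) * step X pos w x) (at x)"
      by (rule iffD1[OF DERIV_cong_ev[OF refl ev refl] D])
  qed
qed


subsection \<open>Weighted free commutative monoids\<close>

text \<open>Since the count grows like \<open>exp t\<close> up to a power of \<open>t\<close>,
  almost all indices have a position within a constant distance of \<open>t\<close>, and weighting
  by the position multiplies the count by about \<open>t\<close>. The case \<open>j = 0\<close> is
  used for elements under (A), \<open>j = 1\<close> for primes under (B).\<close>

lemma weighted_count_asymp:
  fixes pos :: "'i \<Rightarrow> real"
  assumes fin: "\<And>t. finite {i \<in> X. pos i \<le> t}" and nonneg: "\<And>i. i \<in> X \<Longrightarrow> 0 \<le> pos i"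
    and lim: "((\<lambda>t. real (card {i \<in> X. pos i \<le> t}) * exp (- t) * t ^ j) \<longlongrightarrow> \<theta>) at_top"
  shows "((\<lambda>t. step X pos pos t * exp (- t) * t ^ j / t) \<longlongrightarrow> \<theta>) at_top"
proof -
  define g where "g = (\<lambda>t. real (card {i \<in> X. pos i \<le> t}) * exp (- t) * t ^ j)"
  have g: "(g \<longlongrightarrow> \<theta>) at_top" using lim by (simp add: g_def)
  have upper: "\<forall>\<^sub>F t in at_top. step X pos pos t * exp (- t) * t ^ j / t \<le> g t"
    using eventually_gt_at_top[of 0]
  proof eventually_elim
    case (elim t)
    have "step X pos pos t \<le> of_nat (card {i \<in> X. pos i \<le> t}) * t"
      unfolding step_def by (rule sum_bounded_above) auto
    then have "step X pos pos t * (exp (- t) * t ^ j / t) \<le> (of_nat (card {i \<in> X. pos i \<le> t}) * t) * (exp (- t) * t ^ j / t)"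
      using elim by (intro mult_right_mono) auto
    then show ?case using elim by (simp add: g_def mult_ac)
  qed
  \<comment> \<open>Positions up to \<open>t - K\<close> are discarded, the others count at least
    \<open>t - K\<close> each. The discarded ones form a fraction of about
    \<open>exp (- K)\<close>.\<close>
  have lower: "\<forall>\<^sub>F t in at_top. (t - K) / t * (g t - g (t - K) * (exp (- K) * (t / (t - K)) ^ j))
     \<le> step X pos pos t * exp (- t) * t ^ j / t" if K: "K > 0" for K
    using eventually_gt_at_top[of K]
  proof eventually_elim
    case (elim t)
    let ?A = "{i \<in> X. pos i \<le> t}" and ?B = "{i \<in> X. pos i \<le> t - K}"
    have sub: "?B \<subseteq> ?A" using K by auto
    have "(real (card ?A) - real (card ?B)) * (t - K) = real (card (?A - ?B)) * (t - K)"
      using card_Diff_subset[OF fin sub] card_mono[OF fin sub] by (simp add: of_nat_diff)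
    also have "\<dots> \<le> sum pos (?A - ?B)" by (rule sum_bounded_below) auto
    also have "\<dots> \<le> step X pos pos t"
      unfolding step_def using fin nonneg by (intro sum_mono2) auto
    finally have *: "(real (card ?A) - real (card ?B)) * (t - K) * (exp (- t) * t ^ j / t) \<le>
       step X pos pos t * (exp (- t) * t ^ j / t)"
      using elim K by (intro mult_right_mono) auto
    have "g (t - K) * (exp (- K) * (t / (t - K)) ^ j) = real (card ?B) * (exp (- (t - K)) * exp (- K)) * t ^ j"
      using elim K by (simp add: g_def power_divide)
    also have "exp (- (t - K)) * exp (- K) = exp (- t)" by (simp add: exp_add[symmetric])
    finally have gB: "g (t - K) * (exp (- K) * (t / (t - K)) ^ j) = real (card ?B) * exp (- t) * t ^ j" .
    have "(t - K) / t * (g t - g (t - K) * (exp (- K) * (t / (t - K)) ^ j)) =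
       (real (card ?A) - real (card ?B)) * (t - K) * (exp (- t) * t ^ j / t)"
      unfolding gB by (simp add: g_def algebra_simps diff_divide_distrib)
    moreover have "step X pos pos t * exp (- t) * t ^ j / t = step X pos pos t * (exp (- t) * t ^ j / t)"
      by simp
    ultimately show ?case using * by (simp only:)
  qed
  show ?thesis
  proof (rule tendstoI)
    fix e :: real assume e: "e > 0"
    have "((\<lambda>K. \<theta> - \<theta> * exp (- K)) \<longlongrightarrow> \<theta>) at_top" by real_asymp
    then have "\<forall>\<^sub>F K in at_top. dist (\<theta> - \<theta> * exp (- K)) \<theta> < e / 2 \<and> K > 0"
      using e by (intro eventually_conj tendstoD eventually_gt_at_top) auto
    then obtain K where K: "dist (\<theta> - \<theta> * exp (- K)) \<theta> < e / 2" "K > 0"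
      using eventually_happens by force
    have gK: "((\<lambda>t. g (t - K)) \<longlongrightarrow> \<theta>) at_top"
      by (rule filterlim_compose[OF g]) real_asymp
    have r1: "((\<lambda>t::real. (t - K) / t) \<longlongrightarrow> 1) at_top" "((\<lambda>t::real. t / (t - K)) \<longlongrightarrow> 1) at_top"
      by real_asymp+
    have "((\<lambda>t. (t - K) / t * (g t - g (t - K) * (exp (- K) * (t / (t - K)) ^ j))) \<longlongrightarrow>
       1 * (\<theta> - \<theta> * (exp (- K) * 1 ^ j))) at_top"
      by (intro tendsto_intros g gK r1)
    then have "((\<lambda>t. (t - K) / t * (g t - g (t - K) * (exp (- K) * (t / (t - K)) ^ j))) \<longlongrightarrow>
       \<theta> - \<theta> * exp (- K)) at_top" by simp
    from lower[OF K(2)] upper tendstoD[OF this half_gt_zero[OF e]] tendstoD[OF g e]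
    show "\<forall>\<^sub>F t in at_top. dist (step X pos pos t * exp (- t) * t ^ j / t) \<theta> < e"
    proof eventually_elim
      case (elim t)
      then show ?case using K(1) unfolding dist_real_def by linarith
    qed
  qed
qed

lemma sum_mset_eq_sum_count:
  fixes f :: "'i \<Rightarrow> real"
  shows "(\<Sum>p\<in>#m. f p) = (\<Sum>p\<in>set_mset m. real (count m p) * f p)"
proof (induction m)
  case (add x m)
  have "(\<Sum>p\<in>set_mset (add_mset x m). real (count (add_mset x m) p) * f p) =
    (\<Sum>p\<in>insert x (set_mset m). (if p = x then f p else 0) + real (count m p) * f p)"
    by (intro sum.cong) (auto simp: algebra_simps)
  also have "\<dots> = f x + (\<Sum>p\<in>insert x (set_mset m). real (count m p) * f p)"
    by (simp add: sum.distrib)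
  also have "(\<Sum>p\<in>insert x (set_mset m). real (count m p) * f p) = (\<Sum>p\<in>set_mset m. real (count m p) * f p)"
    by (rule sum.mono_neutral_right) (auto simp: count_eq_zero_iff)
  finally show ?case using add by simp
qed simp

text \<open>The semigroup on a logarithmic scale: an element is the multiset of its prime factors,
  \<open>lam p\<close> plays the role of the logarithm of the norm, and multiplicativity becomes
  additivity of \<open>size_of\<close>.\<close>

locale weighted_primes =
  fixes P :: "'a set" and lam :: "'a \<Rightarrow> real"
  assumes lam_pos: "p \<in> P \<Longrightarrow> 0 < lam p"
    and finite_upto: "finite {m. set_mset m \<subseteq> P \<and> (\<Sum>p\<in>#m. lam p) \<le> t}"
begin

definition size_of :: "'a multiset \<Rightarrow> real" where
  "size_of m = (\<Sum>p\<in>#m. lam p)"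

definition upto :: "real \<Rightarrow> 'a multiset set" where
  "upto t = {m. set_mset m \<subseteq> P \<and> size_of m \<le> t}"

definition N :: "real \<Rightarrow> real" where
  "N t = real (card (upto t))"

text \<open>The sum in Mertens' first theorem, at \<open>exp t\<close>.\<close>

definition prime_mass :: "real \<Rightarrow> real" where
  "prime_mass = step P lam (\<lambda>p. lam p * exp (- lam p))"

definition powers :: "real \<Rightarrow> ('a \<times> nat) set" where
  "powers t = {(p, k). p \<in> P \<and> 1 \<le> k \<and> real k * lam p \<le> t}"

text \<open>Chebyshev's function psi at \<open>exp t\<close>: each prime power contributes the
  logarithm of its prime.\<close>

definition psi :: "real \<Rightarrow> real" where
  "psi t = (\<Sum>(p, k)\<in>powers t. lam p)"

lemma size_of_simps [simp]:
  "size_of {#} = 0" "size_of (add_mset p m) = lam p + size_of m"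
  "size_of (m + m') = size_of m + size_of m'" "size_of (replicate_mset k p) = real k * lam p"
  by (simp_all add: size_of_def)

lemma size_of_nonneg: "set_mset m \<subseteq> P \<Longrightarrow> 0 \<le> size_of m"
  unfolding size_of_def by (induction m) (auto simp: less_imp_le[OF lam_pos])

lemma finite_upto' [simp, intro]: "finite (upto t)"
  using finite_upto by (simp add: upto_def size_of_def)

lemma upto_mono: "s \<le> t \<Longrightarrow> upto s \<subseteq> upto t"
  by (auto simp: upto_def)

lemma empty_in_upto: "0 \<le> t \<Longrightarrow> {#} \<in> upto t"
  by (simp add: upto_def)

lemma N_mono: "s \<le> t \<Longrightarrow> N s \<le> N t"
  unfolding N_def by (simp add: card_mono upto_mono)

lemma N_nonneg [simp]: "0 \<le> N t"
  by (simp add: N_def)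

lemma N_ge_1: "0 \<le> t \<Longrightarrow> 1 \<le> N t"
  unfolding N_def using empty_in_upto[of t] card_gt_0_iff[of "upto t"] by (auto simp: Suc_le_eq)

lemma finite_primes_upto [simp, intro]: "finite {p \<in> P. lam p \<le> t}"
proof (rule inj_on_finite[of "\<lambda>p. {#p#}" _ "upto t"])
  show "inj_on (\<lambda>p. {#p#}) {p \<in> P. lam p \<le> t}" by (simp add: inj_on_def)
  show "(\<lambda>p. {#p#}) ` {p \<in> P. lam p \<le> t} \<subseteq> upto t" by (auto simp: upto_def)
qed simp

lemma finite_powers [simp, intro]: "finite (powers t)"
proof (rule inj_on_finite[of "\<lambda>(p, k). replicate_mset k p" _ "upto t"])
  show "inj_on (\<lambda>(p, k). replicate_mset k p) (powers t)"
  proof (intro inj_onI, clarsimp simp: powers_def, intro conjI)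
    fix p q :: 'a and k l :: nat
    assume eq: "replicate_mset k p = replicate_mset l q" and "Suc 0 \<le> k" "Suc 0 \<le> l"
    have "p \<in># replicate_mset k p" using \<open>Suc 0 \<le> k\<close> by simp
    then show "p = q" using eq by (simp only: in_replicate_mset)
    show "k = l" using eq by (metis size_replicate_mset)
  qed
  show "(\<lambda>(p, k). replicate_mset k p) ` powers t \<subseteq> upto t"
    by (auto simp: upto_def powers_def split: if_splits)
qed simp

text \<open>The identity behind the von Mangoldt function: the logarithm of an element is the sum of
  \<open>lam p\<close> over all prime powers that divide it. A divisor of \<open>m\<close> is no
  larger than \<open>m\<close>, which places these powers in \<open>powers t\<close>.\<close>

lemma size_of_eq_sum_powers:
  assumes "m \<in> upto t"
  shows "size_of m = (\<Sum>(p, k)\<in>{(p, k) \<in> powers t. k \<le> count m p}. lam p)"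
proof -
  have "size_of m = (\<Sum>p\<in>set_mset m. real (count m p) * lam p)"
    unfolding size_of_def by (rule sum_mset_eq_sum_count)
  also have "\<dots> = (\<Sum>p\<in>set_mset m. \<Sum>k\<in>{1..count m p}. lam p)" by simp
  also have "\<dots> = (\<Sum>(p, k)\<in>Sigma (set_mset m) (\<lambda>p. {1..count m p}). lam p)"
    by (rule sum.Sigma) auto
  also have "Sigma (set_mset m) (\<lambda>p. {1..count m p}) = {(p, k) \<in> powers t. k \<le> count m p}"
  proof -
    have "real k * lam p \<le> t" if "p \<in># m" "k \<le> count m p" for p k
    proof -
      have "replicate_mset k p + (m - replicate_mset k p) = m"
        using that by (simp add: count_le_replicate_mset_subset_eq)
      from arg_cong[OF this, of size_of]
      have "size_of m = real k * lam p + size_of (m - replicate_mset k p)" by simp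
      moreover have "0 \<le> size_of (m - replicate_mset k p)"
        using assms by (intro size_of_nonneg) (auto simp: upto_def dest: in_diffD)
      ultimately show ?thesis using assms by (simp add: upto_def)
    qed
    then show ?thesis using assms
      by (auto simp: powers_def upto_def Suc_le_eq intro!: count_inI)
  qed
  finally show ?thesis .
qed

lemma card_upto_multiples:
  assumes "p \<in> P"
  shows "card {m \<in> upto t. k \<le> count m p} = card (upto (t - real k * lam p))"
proof -
  have "bij_betw (\<lambda>m. m + replicate_mset k p) (upto (t - real k * lam p)) {m \<in> upto t. k \<le> count m p}"
  proof (rule bij_betwI[where g = "\<lambda>m. m - replicate_mset k p"])
    show "(\<lambda>m. m + replicate_mset k p) \<in> upto (t - real k * lam p) \<rightarrow> {m \<in> upto t. k \<le> count m p}"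
      using assms by (auto simp: upto_def split: if_splits)
    have sub: "m - replicate_mset k p + replicate_mset k p = m" if "k \<le> count m p" for m
      using that by (simp add: count_le_replicate_mset_subset_eq)
    show "(\<lambda>m. m - replicate_mset k p) \<in> {m \<in> upto t. k \<le> count m p} \<rightarrow> upto (t - real k * lam p)"
    proof
      fix m assume m: "m \<in> {m \<in> upto t. k \<le> count m p}"
      then have "size_of m = size_of (m - replicate_mset k p) + real k * lam p"
        using arg_cong[OF sub[of m], of size_of] by simp
      with m show "m - replicate_mset k p \<in> upto (t - real k * lam p)"
        by (auto simp: upto_def dest: in_diffD)
    qed
    show "x - replicate_mset k p + replicate_mset k p = x" if "x \<in> {m \<in> upto t. k \<le> count m p}" for x
      using sub that by simp
  qed simp
  then show ?thesis by (rule bij_betw_same_card[symmetric])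
qed

lemma sum_size_of_eq:
  "(\<Sum>m\<in>upto t. size_of m) = (\<Sum>(p, k)\<in>powers t. lam p * N (t - real k * lam p))"
proof -
  have "(\<Sum>m\<in>upto t. size_of m) = (\<Sum>m\<in>upto t. \<Sum>q | q \<in> powers t \<and> snd q \<le> count m (fst q). lam (fst q))"
    by (intro sum.cong refl, subst size_of_eq_sum_powers) (auto simp: case_prod_unfold intro!: sum.cong)
  also have "\<dots> = (\<Sum>q\<in>powers t. \<Sum>m | m \<in> upto t \<and> snd q \<le> count m (fst q). lam (fst q))"
    by (rule sum.swap_restrict) auto
  also have "\<dots> = (\<Sum>(p, k)\<in>powers t. lam p * N (t - real k * lam p))"
    by (intro sum.cong refl) (auto simp: powers_def N_def card_upto_multiples)
  finally show ?thesis .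
qed

text \<open>Both sides sum \<open>lam p\<close> over the pairs of an element and a prime power with
  total size at most \<open>t\<close>; here the outer sum runs over the element.\<close>

lemma sum_size_of_eq_psi: "(\<Sum>m\<in>upto t. size_of m) = (\<Sum>m\<in>upto t. psi (t - size_of m))"
proof -
  have "(\<Sum>m\<in>upto t. size_of m) = (\<Sum>q\<in>powers t. \<Sum>m | m \<in> upto t \<and> size_of m + real (snd q) * lam (fst q) \<le> t. lam (fst q))"
    unfolding sum_size_of_eq
  proof (intro sum.cong refl)
    fix q assume "q \<in> powers t"
    moreover obtain p k where q: "q = (p, k)" by (cases q)
    ultimately have "(p, k) \<in> powers t" by simp
    then have "0 \<le> real k * lam p" using lam_pos by (auto simp: powers_def intro!: mult_nonneg_nonneg less_imp_le)
    then have "{m \<in> upto t. size_of m + real k * lam p \<le> t} = upto (t - real k * lam p)"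
      by (auto simp: upto_def)
    then show "(case q of (p, k) \<Rightarrow> lam p * N (t - real k * lam p)) =
      (\<Sum>m | m \<in> upto t \<and> size_of m + real (snd q) * lam (fst q) \<le> t. lam (fst q))"
      by (simp add: N_def q)
  qed
  also have "\<dots> = (\<Sum>m\<in>upto t. \<Sum>q | q \<in> powers t \<and> size_of m + real (snd q) * lam (fst q) \<le> t. lam (fst q))"
    by (rule sum.swap_restrict[symmetric]) auto
  also have "\<dots> = (\<Sum>m\<in>upto t. psi (t - size_of m))"
  proof (intro sum.cong refl)
    fix m assume m: "m \<in> upto t"
    then have "{q. q \<in> powers t \<and> size_of m + real (snd q) * lam (fst q) \<le> t} = powers (t - size_of m)"
      using size_of_nonneg[of m] by (auto simp: powers_def upto_def)
    then show "(\<Sum>q | q \<in> powers t \<and> size_of m + real (snd q) * lam (fst q) \<le> t. lam (fst q)) = psi (t - size_of m)"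
      by (simp add: psi_def case_prod_unfold)
  qed
  finally show ?thesis .
qed

end


subsection \<open>Prime mass and regular variation of the counting function\<close>

text \<open>The full geometric series has the sum \<open>x / (exp x - 1)\<close>, and that this is
  at most \<open>(1 + x) * exp (- x)\<close> amounts to \<open>1 + x \<le> exp x\<close>. The bound
  is uniform in \<open>x\<close>, so primes of norm close to 1 do no harm.\<close>

lemma geometric_exp_bound:
  assumes "x > (0::real)"
  shows "(\<Sum>k\<in>{1..n}. x * exp (- (real k * x))) \<le> x * exp (- x) + exp (- x)"
proof -
  have e: "exp x - 1 > 0" using assms by simp
  have "(exp x - 1) * (\<Sum>k\<in>{1..n}. exp (- (real k * x))) = 1 - exp (- (real n * x))"
  proof (induction n)
    case (Suc n)
    have "(exp x - 1) * exp (- (real (Suc n) * x)) = exp (- (real n * x)) - exp (- (real (Suc n) * x))"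
      by (simp add: algebra_simps exp_add[symmetric])
    then show ?case using Suc by (simp add: algebra_simps)
  qed simp
  also have "\<dots> \<le> 1" by simp
  finally have "(\<Sum>k\<in>{1..n}. exp (- (real k * x))) \<le> 1 / (exp x - 1)"
    using e by (simp add: field_simps)
  then have "x * (\<Sum>k\<in>{1..n}. exp (- (real k * x))) \<le> x * (1 / (exp x - 1))"
    using assms by (intro mult_left_mono) auto
  also have "\<dots> \<le> (1 + x) / exp x"
  proof -
    have "x * exp x \<le> (1 + x) * (exp x - 1)"
      using exp_ge_add_one_self[of x] by (simp add: algebra_simps)
    then show ?thesis using e by (simp add: divide_simps)
  qed
  also have "\<dots> = x * exp (- x) + exp (- x)"
    by (simp add: exp_minus field_simps)
  finally show ?thesis by (simp add: sum_distrib_left)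
qed

context weighted_primes
begin

text \<open>\<open>prime_mass\<close> with prime powers included: the sum of the von Mangoldt
  function divided by the norm.\<close>

definition power_mass :: "real \<Rightarrow> real" where
  "power_mass t = (\<Sum>(p, k)\<in>powers t. lam p * exp (- (real k * lam p)))"

text \<open>Under (A), \<open>W = 1\<close> and \<open>j = 0\<close>. Under (B), \<open>j = 1\<close> and \<open>W\<close> is a primitive of
  \<open>exp (- t) * N t\<close>.\<close>

definition regular_count :: "real \<Rightarrow> bool" where
  "regular_count \<theta> \<longleftrightarrow> (\<exists>W (j::nat) c. c > 0 \<and> (\<forall>s t. 0 < s \<longrightarrow> s \<le> t \<longrightarrow> 0 < W s \<and> W s \<le> W t) \<and>
     ((\<lambda>t. exp (- t) * N t * t ^ j / W t) \<longlongrightarrow> c) at_top \<and>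
     (\<forall>u. 0 < u \<longrightarrow> u \<le> 1 \<longrightarrow> ((\<lambda>t. W (u * t) / W t) \<longlongrightarrow> u powr (\<theta> - 1 + real j)) at_top))"

lemma powers_eq_Sigma:
  "powers t = Sigma {p \<in> P. lam p \<le> t} (\<lambda>p. {1..nat \<lfloor>t / lam p\<rfloor>})"
proof -
  have "(1 \<le> k \<and> real k * lam p \<le> t) \<longleftrightarrow> (lam p \<le> t \<and> k \<in> {1..nat \<lfloor>t / lam p\<rfloor>})"
    if p: "p \<in> P" for p k
  proof
    assume k: "1 \<le> k \<and> real k * lam p \<le> t"
    then have "1 * lam p \<le> real k * lam p" using lam_pos[OF p] by (intro mult_right_mono) auto
    then have "lam p \<le> t" using k by linarith
    moreover have "int k \<le> \<lfloor>t / lam p\<rfloor>"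
      using k lam_pos[OF p] by (simp add: le_floor_iff pos_le_divide_eq)
    ultimately show "lam p \<le> t \<and> k \<in> {1..nat \<lfloor>t / lam p\<rfloor>}"
      using k by auto
  next
    assume k: "lam p \<le> t \<and> k \<in> {1..nat \<lfloor>t / lam p\<rfloor>}"
    then have "int k \<le> \<lfloor>t / lam p\<rfloor>" by auto
    then show "1 \<le> k \<and> real k * lam p \<le> t"
      using k lam_pos[OF p] by (auto simp: le_floor_iff field_simps)
  qed
  then show ?thesis unfolding powers_def by blast
qed

lemma floor_ge_1: "p \<in> P \<Longrightarrow> lam p \<le> t \<Longrightarrow> 1 \<le> nat \<lfloor>t / lam p\<rfloor>"
  using lam_pos[of p] by (simp add: le_nat_iff le_floor_iff)

lemma prime_mass_le_power_mass: "prime_mass t \<le> power_mass t"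
proof -
  have "prime_mass t \<le> (\<Sum>p | p \<in> P \<and> lam p \<le> t. \<Sum>k\<in>{1..nat \<lfloor>t / lam p\<rfloor>}. lam p * exp (- (real k * lam p)))"
    unfolding prime_mass_def step_def
  proof (rule sum_mono)
    fix p assume p: "p \<in> {p \<in> P. lam p \<le> t}"
    then have "(\<Sum>k\<in>{1}. lam p * exp (- (real k * lam p))) \<le> (\<Sum>k\<in>{1..nat \<lfloor>t / lam p\<rfloor>}. lam p * exp (- (real k * lam p)))"
      using floor_ge_1[of p t] lam_pos[of p] by (intro sum_mono2) auto
    then show "lam p * exp (- lam p) \<le> (\<Sum>k\<in>{1..nat \<lfloor>t / lam p\<rfloor>}. lam p * exp (- (real k * lam p)))"
      by simp
  qed
  then show ?thesis unfolding power_mass_def powers_eq_Sigma by (subst sum.Sigma[symmetric]) auto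
qed

lemma power_mass_le: "power_mass t \<le> prime_mass t + step P lam (\<lambda>p. exp (- lam p)) t"
proof -
  have "power_mass t = (\<Sum>p | p \<in> P \<and> lam p \<le> t. \<Sum>k\<in>{1..nat \<lfloor>t / lam p\<rfloor>}. lam p * exp (- (real k * lam p)))"
    unfolding power_mass_def powers_eq_Sigma by (subst sum.Sigma[symmetric]) auto
  also have "\<dots> \<le> (\<Sum>p | p \<in> P \<and> lam p \<le> t. lam p * exp (- lam p) + exp (- lam p))"
    by (intro sum_mono geometric_exp_bound) (simp add: lam_pos)
  finally show ?thesis by (simp add: prime_mass_def step_def sum.distrib)
qed

lemma step_le_psi: "step P lam lam t \<le> psi t"
proof -
  have "step P lam lam t \<le> (\<Sum>p | p \<in> P \<and> lam p \<le> t. \<Sum>k\<in>{1..nat \<lfloor>t / lam p\<rfloor>}. lam p)"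
    unfolding step_def
  proof (rule sum_mono)
    fix p assume p: "p \<in> {p \<in> P. lam p \<le> t}"
    then have "1 * lam p \<le> real (nat \<lfloor>t / lam p\<rfloor>) * lam p"
      using floor_ge_1[of p t] lam_pos[of p] by (intro mult_right_mono) auto
    then show "lam p \<le> (\<Sum>k\<in>{1..nat \<lfloor>t / lam p\<rfloor>}. lam p)" by simp
  qed
  then show ?thesis unfolding psi_def powers_eq_Sigma by (subst sum.Sigma[symmetric]) auto
qed

text \<open>A prime of size above \<open>t / 2\<close> has only its first power below
  \<open>t\<close>. The powers of any smaller prime contribute at most \<open>t\<close>
  together.\<close>

lemma psi_le_step: 
  assumes "0 \<le> t"
  shows "psi t \<le> step P lam lam t + real (card {p \<in> P. lam p \<le> t / 2}) * t"
proof -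
  have "psi t = (\<Sum>p | p \<in> P \<and> lam p \<le> t. \<Sum>k\<in>{1..nat \<lfloor>t / lam p\<rfloor>}. lam p)"
    unfolding psi_def powers_eq_Sigma by (subst sum.Sigma[symmetric]) auto
  also have "\<dots> \<le> (\<Sum>p | p \<in> P \<and> lam p \<le> t. lam p + (if lam p \<le> t / 2 then t else 0))"
  proof (rule sum_mono)
    fix p assume p: "p \<in> {p \<in> P. lam p \<le> t}"
    define n where "n = nat \<lfloor>t / lam p\<rfloor>"
    have "real n \<le> t / lam p"
      using p lam_pos[of p] assms by (simp add: n_def)
    then have n: "real n * lam p \<le> t"
      using p lam_pos[of p] by (simp add: pos_le_divide_eq)
    have "real n * lam p \<le> lam p + (if lam p \<le> t / 2 then t else 0)"
    proof (cases "n \<le> 1")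
      case True
      then have "real n * lam p \<le> 1 * lam p" using p lam_pos[of p] by (intro mult_right_mono) auto
      then show ?thesis using assms by auto
    next
      case False
      then have "2 * lam p \<le> real n * lam p" using p lam_pos[of p] by (intro mult_right_mono) auto
      then have "2 * lam p \<le> t" using n by linarith
      then show ?thesis using n p lam_pos[of p] by auto
    qed
    then show "(\<Sum>k\<in>{1..nat \<lfloor>t / lam p\<rfloor>}. lam p) \<le> lam p + (if lam p \<le> t / 2 then t else 0)"
      by (simp add: n_def)
  qed
  also have "\<dots> = step P lam lam t + (\<Sum>p | p \<in> P \<and> lam p \<le> t. if lam p \<le> t / 2 then t else 0)"
    by (simp add: sum.distrib step_def)
  also have "(\<Sum>p | p \<in> P \<and> lam p \<le> t. if lam p \<le> t / 2 then t else 0) = (\<Sum>p | p \<in> P \<and> lam p \<le> t / 2. t)"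
    by (rule sum.mono_neutral_cong_right) (use assms in auto)
  finally show ?thesis by simp
qed

lemma psi_mono: "s \<le> t \<Longrightarrow> psi s \<le> psi t"
  unfolding psi_def by (rule sum_mono2[OF finite_powers]) (auto simp: powers_def less_imp_le[OF lam_pos])

lemma psi_nonneg: "0 \<le> psi t"
  unfolding psi_def by (rule sum_nonneg) (auto simp: powers_def less_imp_le[OF lam_pos])

section \<open>Condition (B): from the prime count to regular variation of the count of
  elements\<close>

context
  fixes \<theta> :: real
  assumes \<theta>: "\<theta> > 0"
    and prime_count_lim: "((\<lambda>t. real (card {p \<in> P. lam p \<le> t}) * exp (- t) * t) \<longlongrightarrow> \<theta>) at_top"
begin

lemma theta_lim: "((\<lambda>t. exp (- t) * step P lam lam t) \<longlongrightarrow> \<theta>) at_top"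
proof -
  have "((\<lambda>t. step P lam lam t * exp (- t) * t ^ 1 / t) \<longlongrightarrow> \<theta>) at_top"
    by (rule weighted_count_asymp) (use prime_count_lim lam_pos in \<open>auto simp: less_imp_le\<close>)
  then show ?thesis
    by (rule Lim_transform_eventually)
      (use eventually_gt_at_top[of 0] in eventually_elim, auto)
qed

text \<open>Partial summation: splitting off \<open>exp (- t)\<close> from each term leaves
  \<open>ramp P lam lam\<close>, whose derivative tends to \<theta>. The part split off stays
  bounded.\<close>

lemma prime_mass_lim_B: "((\<lambda>t. prime_mass t / t) \<longlongrightarrow> \<theta>) at_top"
proof -
  have eq: "prime_mass t = ramp P lam lam t + exp (- t) * step P lam lam t" for t
    unfolding prime_mass_def ramp_def step_def sum_distrib_left sum.distrib[symmetric]
    by (simp add: algebra_simps)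
  have "((\<lambda>t. ramp P lam lam t / t) \<longlongrightarrow> \<theta>) at_top"
    by (rule piecewise_deriv_imp_average[OF piecewise_deriv_ramp theta_lim]) simp
  moreover have "((\<lambda>t. (exp (- t) * step P lam lam t) * (1 / t)) \<longlongrightarrow> \<theta> * 0) at_top"
    by (intro tendsto_mult theta_lim) real_asymp
  ultimately have "((\<lambda>t. ramp P lam lam t / t + (exp (- t) * step P lam lam t) * (1 / t)) \<longlongrightarrow> \<theta> + \<theta> * 0) at_top"
    by (rule tendsto_add)
  then show ?thesis by (simp add: eq add_divide_distrib)
qed

lemma psi_lim: "((\<lambda>t. exp (- t) * psi t) \<longlongrightarrow> \<theta>) at_top"
proof (rule tendsto_sandwich[OF _ _ theta_lim])
  show "\<forall>\<^sub>F t in at_top. exp (- t) * step P lam lam t \<le> exp (- t) * psi t"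
    by (simp add: step_le_psi)
  \<comment> \<open>The argument \<open>t / 2\<close> normalises the primes up to
    \<open>t / 2\<close> with \<open>exp (- (t / 2)) * (t / 2)\<close>, so their share of
    \<open>exp (- t) * psi t\<close> carries the vanishing factor
    \<open>2 * exp (- (t / 2))\<close>.\<close>
  define g where "g = (\<lambda>t. real (card {p \<in> P. lam p \<le> t}) * exp (- t) * t)"
  show "\<forall>\<^sub>F t in at_top. exp (- t) * psi t \<le> exp (- t) * step P lam lam t + g (t / 2) * (2 * exp (- (t / 2)))"
    using eventually_ge_at_top[of 0]
  proof eventually_elim
    case (elim t)
    have "exp (- t) * psi t \<le> exp (- t) * (step P lam lam t + real (card {p \<in> P. lam p \<le> t / 2}) * t)"
      using psi_le_step[OF elim] by (intro mult_left_mono) auto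
    moreover have "exp (- t) = exp (- (t / 2)) * exp (- (t / 2))"
      by (simp add: exp_add[symmetric])
    ultimately show ?case by (simp add: g_def algebra_simps)
  qed
  have "((\<lambda>t. g (t / 2)) \<longlongrightarrow> \<theta>) at_top"
    by (rule filterlim_compose[of g]) (use prime_count_lim in \<open>simp add: g_def\<close>, real_asymp)
  then have "((\<lambda>t. exp (- t) * step P lam lam t + g (t / 2) * (2 * exp (- (t / 2)))) \<longlongrightarrow> \<theta> + \<theta> * 0) at_top"
    by (intro tendsto_add tendsto_mult theta_lim) (assumption, real_asymp)
  then show "((\<lambda>t. exp (- t) * step P lam lam t + g (t / 2) * (2 * exp (- (t / 2)))) \<longlongrightarrow> \<theta>) at_top" by simp
qed

text \<open>The partial sum at \<open>exp t\<close> of the reciprocal norms, that is of the zeta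
  function of the semigroup at 1.\<close>

definition V :: "real \<Rightarrow> real" where
  "V t = (\<Sum>m\<in>upto t. exp (- size_of m))"

text \<open>Adding \<open>t - size_of m\<close> to every term of \<open>sum_size_of_eq_psi\<close>
  turns the left side into exactly \<open>t * N t\<close>, and the right side into a sum of
  \<open>psi u + u\<close> with \<open>u = t - size_of m\<close>. Replacing this by
  \<open>\<theta> * exp u\<close> produces \<open>V\<close>; the error \<open>d * exp u + C\<close>
  produces the two terms of the bound.\<close>

lemma N_V_comparison:
  assumes d: "d > 0"
  shows "\<exists>C\<ge>0. \<forall>t\<ge>0. \<bar>t * (exp (- t) * N t) - \<theta> * V t\<bar> \<le> d * V t + C * (exp (- t) * N t)"
proof -
  define \<phi> where "\<phi> = (\<lambda>u. psi u + u - \<theta> * exp u)"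
  have "((\<lambda>u. exp (- u) * psi u + u * exp (- u) - \<theta>) \<longlongrightarrow> \<theta> + 0 - \<theta>) at_top"
    by (intro tendsto_intros psi_lim) real_asymp
  then have "\<forall>\<^sub>F u in at_top. \<bar>exp (- u) * psi u + u * exp (- u) - \<theta>\<bar> < d"
    using tendstoD[OF _ d] by (fastforce simp: dist_real_def)
  then obtain u0 where u0: "\<And>u. u \<ge> u0 \<Longrightarrow> \<bar>exp (- u) * psi u + u * exp (- u) - \<theta>\<bar> < d"
    by (auto simp: eventually_at_top_linorder)
  \<comment> \<open>Bounds the deviation for arguments between 0 and \<open>u0\<close>, where the
    asymptotics of \<open>psi\<close> is not yet available.\<close>
  define C where "C = psi u0 + \<bar>u0\<bar> + \<theta> * exp u0"
  have C: "C \<ge> 0" using psi_nonneg \<theta> by (simp add: C_def)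
  have \<phi>: "\<bar>\<phi> u\<bar> \<le> d * exp u + C" if u: "u \<ge> 0" for u
  proof (cases "u \<ge> u0")
    case True
    have "\<phi> u = exp u * (exp (- u) * psi u + u * exp (- u) - \<theta>)"
      by (simp add: \<phi>_def algebra_simps exp_minus)
    then have "\<bar>\<phi> u\<bar> \<le> exp u * d"
      using u0[OF True] by (simp add: abs_mult)
    then show ?thesis using C by (simp add: mult.commute)
  next
    case False
    have "psi u \<le> psi u0" "exp u \<le> exp u0" using False by (auto intro: psi_mono)
    then have "\<theta> * exp u \<le> \<theta> * exp u0" "0 \<le> \<theta> * exp u" using \<theta> by auto
    then have "\<bar>\<phi> u\<bar> \<le> C" using \<open>psi u \<le> psi u0\<close> psi_nonneg[of u] u False by (simp add: \<phi>_def C_def abs_le_iff)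
    then show ?thesis using d by (simp add: add_increasing)
  qed
  have "\<bar>t * (exp (- t) * N t) - \<theta> * V t\<bar> \<le> d * V t + C * (exp (- t) * N t)" if t: "t \<ge> 0" for t
  proof -
    have "t * N t = (\<Sum>m\<in>upto t. size_of m) + (\<Sum>m\<in>upto t. t - size_of m)"
      by (simp add: sum_subtractf N_def)
    also have "\<dots> = (\<Sum>m\<in>upto t. psi (t - size_of m) + (t - size_of m))"
      unfolding sum_size_of_eq_psi by (rule sum.distrib[symmetric])
    also have "\<dots> = (\<Sum>m\<in>upto t. \<phi> (t - size_of m) + \<theta> * exp (t - size_of m))"
      by (simp add: \<phi>_def)
    also have "\<dots> = (\<Sum>m\<in>upto t. \<phi> (t - size_of m)) + \<theta> * exp t * V t"
      unfolding V_def sum_distrib_left sum.distrib[symmetric]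
      by (simp add: exp_diff exp_minus field_simps)
    finally have "\<bar>t * N t - \<theta> * exp t * V t\<bar> = \<bar>\<Sum>m\<in>upto t. \<phi> (t - size_of m)\<bar>" by simp
    also have "\<dots> \<le> (\<Sum>m\<in>upto t. d * exp (t - size_of m) + C)"
      by (rule order.trans[OF sum_abs sum_mono[OF \<phi>]]) (simp add: upto_def)
    also have "\<dots> = d * exp t * V t + C * N t"
      by (simp add: sum.distrib V_def sum_distrib_left N_def exp_diff exp_minus divide_inverse mult_ac)
    finally have "exp (- t) * \<bar>t * N t - \<theta> * exp t * V t\<bar> \<le> exp (- t) * (d * exp t * V t + C * N t)"
      by simp
    moreover have "exp (- t) * \<bar>t * N t - \<theta> * exp t * V t\<bar> = \<bar>t * (exp (- t) * N t) - \<theta> * V t\<bar>"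
    proof -
      have "t * (exp (- t) * N t) - \<theta> * V t = exp (- t) * (t * N t - \<theta> * exp t * V t)"
        by (simp add: algebra_simps exp_minus)
      then show ?thesis by (simp add: abs_mult)
    qed
    moreover have "exp (- t) * (d * exp t * V t + C * N t) = d * V t + C * (exp (- t) * N t)"
      by (simp add: algebra_simps exp_minus)
    ultimately show ?thesis by simp
  qed
  with C show ?thesis by blast
qed

lemma V_ge_1: "0 \<le> t \<Longrightarrow> 1 \<le> V t"
proof -
  assume "0 \<le> t"
  then have "(\<Sum>m\<in>{{#}}. exp (- size_of m)) \<le> V t"
    unfolding V_def by (intro sum_mono2) (auto simp: empty_in_upto)
  then show ?thesis by simp
qed

text \<open>The error in \<open>N_V_comparison\<close> contains \<open>N\<close> itself, so the
  comparison is used twice: first it shows that \<open>a\<close>, the quotient of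
  \<open>exp (- t) * N t\<close> and \<open>V t\<close>, is at most
  \<open>(\<theta> + 1) / (t - C)\<close>, and with this \<open>C * a\<close> becomes smaller than
  \<open>d\<close>.\<close>

lemma N_over_V: "((\<lambda>t. t * (exp (- t) * N t) / V t) \<longlongrightarrow> \<theta>) at_top"
proof (rule tendstoI)
  fix e :: real assume e: "e > 0"
  define d where "d = min 1 (e / 4)"
  have d: "d > 0" "d \<le> 1" "d \<le> e / 4" using e by (auto simp: d_def)
  obtain C where C: "C \<ge> 0" "\<And>t. t \<ge> 0 \<Longrightarrow> \<bar>t * (exp (- t) * N t) - \<theta> * V t\<bar> \<le> d * V t + C * (exp (- t) * N t)"
    using N_V_comparison[OF d(1)] by blast
  have "\<forall>\<^sub>F t in at_top. C * (\<theta> + 1) / (t - C) < d" using d(1) by real_asymp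
  then show "\<forall>\<^sub>F t in at_top. dist (t * (exp (- t) * N t) / V t) \<theta> < e"
    using eventually_gt_at_top[of C]
  proof eventually_elim
    case (elim t)
    define a where "a = exp (- t) * N t / V t"
    have V: "V t > 0" using V_ge_1[of t] elim(2) C(1) by simp
    have a0: "a \<ge> 0" using V by (simp add: a_def)
    have "\<bar>t * (exp (- t) * N t) - \<theta> * V t\<bar> / V t \<le> (d * V t + C * (exp (- t) * N t)) / V t"
      using C elim V by (intro divide_right_mono) auto
    moreover have "\<bar>t * (exp (- t) * N t) - \<theta> * V t\<bar> / V t = \<bar>t * a - \<theta>\<bar>"
    proof -
      have "t * a - \<theta> = (t * (exp (- t) * N t) - \<theta> * V t) / V t" using V by (simp add: a_def field_simps)
      then show ?thesis using V by simp
    qed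
    moreover have "(d * V t + C * (exp (- t) * N t)) / V t = d + C * a"
      using V by (simp add: a_def field_simps)
    ultimately have *: "\<bar>t * a - \<theta>\<bar> \<le> d + C * a" by simp
    then have "(t - C) * a \<le> \<theta> + 1" using d by (simp add: abs_le_iff algebra_simps)
    then have "a \<le> (\<theta> + 1) / (t - C)" using elim by (simp add: field_simps)
    then have "C * a \<le> C * ((\<theta> + 1) / (t - C))" using C(1) by (rule mult_left_mono)
    then have "C * a < d" using elim(1) by simp
    with * have "\<bar>t * a - \<theta>\<bar> < e" using d e by linarith
    then show ?case by (simp add: a_def dist_real_def)
  qed
qed

text \<open>\<open>R\<close> is a primitive of \<open>exp (- t) * N t\<close> and equals
  \<open>V t - exp (- t) * N t\<close>. By \<open>N_over_V\<close> the difference from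
  \<open>V\<close> is negligible, so \<open>t * R' / R\<close> inherits the limit \<theta>. This is
  the index \<open>\<theta> - 1 + j\<close> for \<open>j = 1\<close>.\<close>

lemma regular_count_B: "regular_count \<theta>"
proof -
  define R where "R = ramp {m. set_mset m \<subseteq> P} size_of (\<lambda>_. 1)"
  have up: "{m \<in> {m. set_mset m \<subseteq> P}. size_of m \<le> t} = upto t" for t by (auto simp: upto_def)
  have R_eq: "R t = V t - exp (- t) * N t" for t
    using up[of t] by (simp add: R_def ramp_def V_def N_def sum_subtractf)
  have st: "step {m. set_mset m \<subseteq> P} size_of (\<lambda>_. 1) t = N t" for t
    using up[of t] by (simp add: step_def N_def)
  have pd: "piecewise_deriv R (\<lambda>t. exp (- t) * N t)"
    using piecewise_deriv_ramp[of "{m. set_mset m \<subseteq> P}" size_of "\<lambda>_. 1"] up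
    by (simp add: R_def st)
  have R_pos: "R t > 0" if "t > 0" for t
  proof -
    have "(\<Sum>m\<in>{{#}}. exp (- size_of m) - exp (- t)) \<le> (\<Sum>m\<in>upto t. exp (- size_of m) - exp (- t))"
      using that by (intro sum_mono2[OF finite_upto']) (auto simp: empty_in_upto upto_def)
    then have "1 - exp (- t) \<le> R t" by (simp add: R_eq V_def N_def sum_subtractf mult.commute)
    moreover have "exp (- t) < 1" using that by simp
    ultimately show ?thesis by linarith
  qed
  have R_mono: "R s \<le> R t" if st: "s \<le> t" for s t
  proof -
    obtain S where S: "finite S" "\<And>x. x < t \<Longrightarrow> x \<notin> S \<Longrightarrow> (R has_real_derivative exp (- x) * N x) (at x)"
      using pd unfolding piecewise_deriv_def by blast
    show ?thesis
      by (rule piecewise_deriv_mono[OF S(1) st, of R "\<lambda>x. exp (- x) * N x"])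
        (use pd S(2) in \<open>auto simp: piecewise_deriv_def\<close>)
  qed
  have "((\<lambda>t. (t * (exp (- t) * N t) / V t) * (1 / t)) \<longlongrightarrow> \<theta> * 0) at_top"
    by (intro tendsto_mult N_over_V) real_asymp
  then have "((\<lambda>t. 1 - (t * (exp (- t) * N t) / V t) * (1 / t)) \<longlongrightarrow> 1 - \<theta> * 0) at_top"
    by (intro tendsto_diff tendsto_const)
  then have "((\<lambda>t. (t * (exp (- t) * N t) / V t) / (1 - (t * (exp (- t) * N t) / V t) * (1 / t))) \<longlongrightarrow> \<theta>) at_top"
    using tendsto_divide[OF N_over_V] by fastforce
  moreover have
    "\<forall>\<^sub>F t in at_top. (t * (exp (- t) * N t) / V t) / (1 - (t * (exp (- t) * N t) / V t) * (1 / t)) = t * (exp (- t) * N t) / R t"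
  proof -
    show ?thesis
      using eventually_gt_at_top[of 0]
    proof eventually_elim
      case (elim t)
      then have "V t > 0" "R t > 0" using V_ge_1[of t] R_pos by auto
      moreover have "1 - (t * (exp (- t) * N t) / V t) * (1 / t) = R t / V t"
        using \<open>V t > 0\<close> elim by (simp add: R_eq field_simps)
      ultimately show ?case by simp
    qed
  qed
  ultimately have lim: "((\<lambda>t. t * (exp (- t) * N t) / R t) \<longlongrightarrow> \<theta>) at_top"
    by (rule Lim_transform_eventually)
  have "((\<lambda>t. R (u * t) / R t) \<longlongrightarrow> u powr \<theta>) at_top" if "0 < u" "u \<le> 1" for u
  proof (rule piecewise_deriv_imp_regular_variation[OF pd lim _ that])
    show "\<forall>\<^sub>F t in at_top. R t > 0"
      using eventually_gt_at_top[of 0] by eventually_elim (rule R_pos)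
  qed
  then show ?thesis unfolding regular_count_def
    using R_pos R_mono \<theta> lim by (intro exI[of _ R] exI[of _ 1] exI[of _ \<theta>]) (auto simp: mult_ac)
qed

end

section \<open>Condition (A): from the count of elements to the prime sum\<close>

lemma regular_count_A:
  assumes "A > 0" "((\<lambda>t. exp (- t) * N t) \<longlongrightarrow> A) at_top"
  shows "regular_count 1"
  unfolding regular_count_def
  by (intro exI[of _ "\<lambda>_. 1"] exI[of _ 0] exI[of _ A]) (use assms in auto)

lemma power_mass_mono: "s \<le> t \<Longrightarrow> power_mass s \<le> power_mass t"
  unfolding power_mass_def
  by (rule sum_mono2[OF finite_powers]) (auto simp: powers_def less_imp_le[OF lam_pos])

lemma power_mass_nonneg: "0 \<le> power_mass t"
  unfolding power_mass_def by (rule sum_nonneg) (auto simp: powers_def less_imp_le[OF lam_pos])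

text \<open>By \<open>sum_size_of_eq\<close>, \<tau> is a sum of
  \<open>lam p * N (t - k * lam p)\<close> scaled by \<open>exp (- t)\<close>. Inserting
  \<open>A * exp y\<close> for \<open>N y\<close> turns it into \<open>A * power_mass t\<close>,
  while \<tau> is asymptotic to \<open>A * t\<close>. The replacement fails for \<open>y\<close>
  below \<open>y0\<close>, and the prime powers concerned have to be controlled without knowing
  their mass.\<close>

lemma power_mass_lim_A:
  assumes A: "A > 0" and lim: "((\<lambda>t. exp (- t) * N t) \<longlongrightarrow> A) at_top"
  shows "((\<lambda>t. power_mass t / t) \<longlongrightarrow> 1) at_top"
proof (rule tendstoI)
  fix e :: real assume e: "e > 0"
  define \<eta> where "\<eta> = min (1/4) (e / 8)"
  have \<eta>: "\<eta> > 0" "\<eta> \<le> 1/4" "4 * \<eta> < e" using e by (auto simp: \<eta>_def)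
  define \<tau> where "\<tau> = (\<lambda>t. exp (- t) * (\<Sum>m\<in>upto t. size_of m))"
  have up: "{m. set_mset m \<subseteq> P \<and> size_of m \<le> t} = upto t" for t by (auto simp: upto_def)
  have "((\<lambda>t. step {m. set_mset m \<subseteq> P} size_of size_of t * exp (- t) * t ^ 0 / t) \<longlongrightarrow> A) at_top"
    by (rule weighted_count_asymp)
      (use lim in \<open>auto simp: up size_of_nonneg N_def mult.commute\<close>)
  then have \<tau>_lim: "((\<lambda>t. \<tau> t / t) \<longlongrightarrow> A) at_top"
    by (simp add: step_def up \<tau>_def mult.commute)
  have \<tau>_shift: "((\<lambda>t. \<tau> (t + c) / t) \<longlongrightarrow> A) at_top" for c
  proof -
    have "((\<lambda>t. \<tau> (t + c) / (t + c)) \<longlongrightarrow> A) at_top"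
      by (rule filterlim_compose[OF \<tau>_lim]) real_asymp
    then have "((\<lambda>t. \<tau> (t + c) / (t + c) * ((t + c) / t)) \<longlongrightarrow> A * 1) at_top"
      by (intro tendsto_mult) (assumption, real_asymp)
    moreover have "\<forall>\<^sub>F t in at_top. \<tau> (t + c) / (t + c) * ((t + c) / t) = \<tau> (t + c) / t"
      using eventually_gt_at_top[of "\<bar>c\<bar>"] by eventually_elim auto
    ultimately show ?thesis using Lim_transform_eventually by force
  qed
  have "\<forall>\<^sub>F y in at_top. dist (exp (- y) * N y) A < A * \<eta>"
    using A \<eta> by (intro tendstoD[OF lim]) auto
  then obtain y1 where y1: "\<And>y. y \<ge> y1 \<Longrightarrow> dist (exp (- y) * N y) A < A * \<eta>"
    by (auto simp: eventually_at_top_linorder)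
  define y0 where "y0 = max 0 y1"
  have y0: "y0 \<ge> 0" by (simp add: y0_def)
  have N_bounds: "A * (1 - \<eta>) * exp y \<le> N y \<and> N y \<le> A * (1 + \<eta>) * exp y" if "y \<ge> y0" for y
  proof -
    have "\<bar>exp (- y) * N y - A\<bar> < A * \<eta>" using y1[of y] that by (simp add: y0_def dist_real_def)
    then have "A * (1 - \<eta>) \<le> exp (- y) * N y" "exp (- y) * N y \<le> A * (1 + \<eta>)"
      by (simp_all add: abs_less_iff algebra_simps)
    then have "exp y * (A * (1 - \<eta>)) \<le> exp y * (exp (- y) * N y)"
      "exp y * (exp (- y) * N y) \<le> exp y * (A * (1 + \<eta>))" by simp_all
    moreover have "exp y * (exp (- y) * N y) = N y" by (simp add: exp_minus)
    ultimately show ?thesis by (simp add: mult_ac)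
  qed
  define C where "C = N y0"
  have C: "C \<ge> 0" by (simp add: C_def)
  \<comment> \<open>A bound valid down to 0: below \<open>y0\<close> the constant \<open>C\<close>
    is added to the coefficient.\<close>
  have N_le: "N y \<le> (A * (1 + \<eta>) + (if y < y0 then C else 0)) * exp y" if "y \<ge> 0" for y
  proof (cases "y < y0")
    case True
    have "N y \<le> C * 1" using N_mono[of y y0] True by (simp add: C_def)
    also have "\<dots> \<le> C * exp y" using C that by (intro mult_left_mono) auto
    also have "\<dots> \<le> (A * (1 + \<eta>) + C) * exp y"
      using A \<eta> by (intro mult_right_mono) auto
    finally show ?thesis using True by simp
  qed (use N_bounds[of y] in auto)
  have sub: "powers (t - y0) \<subseteq> powers t" for t using y0 by (auto simp: powers_def)
  \<comment> \<open>Bounds \<open>power_mass\<close> from above: only prime powers of size at most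
    \<open>t - y0\<close> are kept, for which the asymptotics of \<open>N\<close> holds.\<close>
  have upper: "A * (1 - \<eta>) * power_mass (t - y0) \<le> \<tau> t" for t
  proof -
    have "exp t * (A * (1 - \<eta>) * power_mass (t - y0)) \<le>
       (\<Sum>(p, k)\<in>powers (t - y0). lam p * N (t - real k * lam p))"
      unfolding power_mass_def sum_distrib_left
    proof (rule sum_mono, clarify)
      fix p k assume pk: "(p, k) \<in> powers (t - y0)"
      then have l: "lam p \<ge> 0" by (auto simp: powers_def less_imp_le[OF lam_pos])
      have "A * (1 - \<eta>) * exp (t - real k * lam p) \<le> N (t - real k * lam p)"
        using N_bounds[of "t - real k * lam p"] pk by (auto simp: powers_def)
      then have "lam p * (A * (1 - \<eta>) * exp (t - real k * lam p)) \<le> lam p * N (t - real k * lam p)"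
        using l by (rule mult_left_mono)
      then show "exp t * (A * (1 - \<eta>) * (lam p * exp (- (real k * lam p)))) \<le> lam p * N (t - real k * lam p)"
        by (simp add: exp_diff exp_minus divide_inverse mult_ac)
    qed
    also have "\<dots> \<le> (\<Sum>(p, k)\<in>powers t. lam p * N (t - real k * lam p))"
      by (intro sum_mono2[OF finite_powers] sub) (auto simp: powers_def less_imp_le[OF lam_pos])
    also have "\<dots> = exp t * \<tau> t"
      by (simp add: \<tau>_def sum_size_of_eq exp_minus)
    finally show ?thesis by simp
  qed
  \<comment> \<open>Bounds \<open>power_mass\<close> from below: prime powers in the window from
    \<open>t - y0\<close> to \<open>t\<close> pay the extra coefficient \<open>C\<close>.\<close>
  have lower: "\<tau> t \<le> A * (1 + \<eta>) * power_mass t + C * (power_mass t - power_mass (t - y0))" for t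
  proof -
    let ?f = "\<lambda>(p, k). lam p * exp (- (real k * lam p))"
    have "exp t * \<tau> t = (\<Sum>(p, k)\<in>powers t. lam p * N (t - real k * lam p))"
      by (simp add: \<tau>_def sum_size_of_eq exp_minus)
    also have "\<dots> \<le> (\<Sum>q\<in>powers t. exp t * (A * (1 + \<eta>) * ?f q + C * (if q \<in> powers t - powers (t - y0) then ?f q else 0)))"
    proof (rule sum_mono, clarify)
      fix p k assume pk: "(p, k) \<in> powers t"
      then have l: "lam p \<ge> 0" by (auto simp: powers_def less_imp_le[OF lam_pos])
      have "N (t - real k * lam p) \<le> (A * (1 + \<eta>) + (if t - real k * lam p < y0 then C else 0)) * exp (t - real k * lam p)"
        using pk by (intro N_le) (auto simp: powers_def)
      also have "(t - real k * lam p < y0) = ((p, k) \<in> powers t - powers (t - y0))"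
        using pk by (auto simp: powers_def)
      finally have "lam p * N (t - real k * lam p) \<le> lam p * ((A * (1 + \<eta>) + (if (p, k) \<in> powers t - powers (t - y0) then C else 0)) * exp (t - real k * lam p))"
        using l by (rule mult_left_mono)
      also have "\<dots> = exp t * (A * (1 + \<eta>) * ?f (p, k) + C * (if (p, k) \<in> powers t - powers (t - y0) then ?f (p, k) else 0))"
        by (auto simp: exp_diff exp_minus divide_inverse algebra_simps)
      finally show "lam p * N (t - real k * lam p) \<le> exp t * (A * (1 + \<eta>) * (lam p * exp (- (real k * lam p))) + C * (if (p, k) \<in> powers t - powers (t - y0) then lam p * exp (- (real k * lam p)) else 0))"
        by (simp only: prod.case)
    qed
    also have "\<dots> = exp t * (A * (1 + \<eta>) * sum ?f (powers t) + C * (\<Sum>q\<in>powers t. if q \<in> powers t - powers (t - y0) then ?f q else 0))"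
      by (simp only: sum_distrib_left[symmetric] sum.distrib)
    also have "(\<Sum>q\<in>powers t. if q \<in> powers t - powers (t - y0) then ?f q else 0) = sum ?f (powers t - powers (t - y0))"
      by (rule sum.mono_neutral_cong_right) auto
    also have "\<dots> = power_mass t - power_mass (t - y0)"
      by (simp add: sum_diff sub power_mass_def)
    finally show ?thesis by (simp add: power_mass_def)
  qed
  \<comment> \<open>The error in \<open>lower\<close> is an increment of \<open>power_mass\<close> over a window of length \<open>y0\<close>. Averaging
    over \<open>n\<close> adjacent windows telescopes it and divides it by \<open>n\<close>.\<close>
  obtain n :: nat where n: "real n \<ge> C / (A * \<eta>) + 1" using real_arch_simple by blast
  have npos: "real n > 0" using n C A \<eta> by (smt (verit) divide_nonneg_pos mult_pos_pos)
  have nC: "C \<le> real n * A * \<eta>"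
  proof -
    have "C / (A * \<eta>) \<le> real n" using n by linarith
    then show ?thesis using A \<eta> by (simp add: pos_divide_le_eq mult_ac)
  qed
  have ev_up: "\<forall>\<^sub>F t in at_top. dist (\<tau> (t + y0) / t) A < A * \<eta>"
    using A \<eta> by (intro tendstoD[OF \<tau>_shift]) auto
  have "((\<lambda>t. \<Sum>i<n. \<tau> (t + - (real i * y0)) / t) \<longlongrightarrow> (\<Sum>i<n. A)) at_top"
    by (intro tendsto_sum \<tau>_shift)
  then have ev_low: "\<forall>\<^sub>F t in at_top. dist (\<Sum>i<n. \<tau> (t + - (real i * y0)) / t) (\<Sum>i<n. A) < real n * A * \<eta>"
    using A \<eta> npos by (intro tendstoD) auto
  show "\<forall>\<^sub>F t in at_top. dist (power_mass t / t) 1 < e"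
    using ev_up ev_low eventually_gt_at_top[of 0]
  proof eventually_elim
    case (elim t)
    have "A * (1 - \<eta>) * power_mass t \<le> \<tau> (t + y0)" using upper[of "t + y0"] by simp
    also have "\<dots> \<le> A * (1 + \<eta>) * t"
    proof -
      have "\<tau> (t + y0) / t \<le> A * (1 + \<eta>)" using elim(1) by (simp add: dist_real_def abs_less_iff algebra_simps)
      then show ?thesis using elim(3) by (simp add: pos_divide_le_eq)
    qed
    finally have "A * ((1 - \<eta>) * power_mass t) \<le> A * ((1 + \<eta>) * t)" by (simp add: mult_ac)
    then have "(1 - \<eta>) * power_mass t \<le> (1 + \<eta>) * t" using A by simp
    then have "(1 - \<eta>) * (power_mass t / t) \<le> 1 + \<eta>" using elim(3) by (simp add: pos_divide_le_eq)
    also have "1 + \<eta> \<le> (1 - \<eta>) * (1 + 4 * \<eta>)"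
    proof -
      have "\<eta> * (4 * \<eta>) \<le> \<eta> * 1" using \<eta> by (intro mult_left_mono) auto
      then show ?thesis using \<eta> by (simp add: algebra_simps)
    qed
    finally have U: "power_mass t / t \<le> 1 + 4 * \<eta>"
      by (rule mult_left_le_imp_le) (use \<eta> in auto)
    \<comment> \<open>By monotonicity the main terms are all enlarged to the same
      \<open>power_mass t\<close>, so that only the increments depend on \<open>i\<close> and
      telescope.\<close>
    have "(\<Sum>i<n. \<tau> (t + - (real i * y0))) \<le>
      (\<Sum>i<n. A * (1 + \<eta>) * power_mass t + C * (power_mass (t - real i * y0) - power_mass (t - real (Suc i) * y0)))"
    proof (rule sum_mono)
      fix i assume "i \<in> {..<n}"
      have "A * (1 + \<eta>) * power_mass (t - real i * y0) \<le> A * (1 + \<eta>) * power_mass t"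
        using A \<eta> y0 by (intro mult_left_mono power_mass_mono) auto
      then show "\<tau> (t + - (real i * y0)) \<le> A * (1 + \<eta>) * power_mass t + C * (power_mass (t - real i * y0) - power_mass (t - real (Suc i) * y0))"
        using lower[of "t - real i * y0"] by (simp add: algebra_simps)
    qed
    also have "\<dots> = real n * A * (1 + \<eta>) * power_mass t + C * (power_mass t - power_mass (t - real n * y0))"
      by (simp add: sum.distrib sum_distrib_left[symmetric] sum_lessThan_telescope' [of "\<lambda>i. power_mass (t - real i * y0)", simplified])
    also have "\<dots> \<le> real n * A * (1 + \<eta>) * power_mass t + C * power_mass t"
      using C power_mass_nonneg by (intro add_left_mono mult_left_mono) auto
    also have "\<dots> \<le> real n * A * (1 + \<eta>) * power_mass t + real n * A * \<eta> * power_mass t"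
      using nC power_mass_nonneg by (intro add_left_mono mult_right_mono) auto
    finally have 1: "(\<Sum>i<n. \<tau> (t + - (real i * y0))) \<le> real n * A * ((1 + 2 * \<eta>) * power_mass t)"
      by (simp add: algebra_simps)
    have "real n * A * (1 - \<eta>) \<le> (\<Sum>i<n. \<tau> (t + - (real i * y0))) / t"
      using elim(2) by (simp add: dist_real_def abs_less_iff algebra_simps sum_divide_distrib)
    then have "real n * A * ((1 - \<eta>) * t) \<le> (\<Sum>i<n. \<tau> (t + - (real i * y0)))"
      using elim(3) by (simp add: pos_le_divide_eq mult_ac)
    with 1 have "real n * A * ((1 - \<eta>) * t) \<le> real n * A * ((1 + 2 * \<eta>) * power_mass t)" by linarith
    then have "(1 - \<eta>) * t \<le> (1 + 2 * \<eta>) * power_mass t" using npos A by simp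
    then have "1 - \<eta> \<le> (1 + 2 * \<eta>) * (power_mass t / t)" using elim(3) by (simp add: pos_le_divide_eq)
    moreover have "(1 + 2 * \<eta>) * (1 - 4 * \<eta>) \<le> 1 - \<eta>" using \<eta> by (simp add: algebra_simps)
    ultimately have "(1 + 2 * \<eta>) * (1 - 4 * \<eta>) \<le> (1 + 2 * \<eta>) * (power_mass t / t)" by linarith
    then have L: "1 - 4 * \<eta> \<le> power_mass t / t"
      by (rule mult_left_le_imp_le) (use \<eta> in auto)
    show ?case using U L \<eta> by (simp add: dist_real_def abs_less_iff)
  qed
qed

text \<open>Higher powers exceed \<open>prime_mass\<close> by at most the sum of
  \<open>exp (- lam p)\<close>. Primes with \<open>lam p > K\<close> contribute at most
  \<open>prime_mass t / K\<close> to it, the finitely many others a constant.\<close>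

lemma prime_mass_lim_A:
  assumes A: "A > 0" and lim: "((\<lambda>t. exp (- t) * N t) \<longlongrightarrow> A) at_top"
  shows "((\<lambda>t. prime_mass t / t) \<longlongrightarrow> 1) at_top"
proof (rule tendstoI)
  fix e :: real assume e: "e > 0"
  note pl = power_mass_lim_A[OF assms]
  have small: "step P lam (\<lambda>p. exp (- lam p)) t \<le> real (card {p \<in> P. lam p \<le> K}) + prime_mass t / K"
    if K: "K > 0" for K t
  proof -
    have "step P lam (\<lambda>p. exp (- lam p)) t \<le> (\<Sum>p | p \<in> P \<and> lam p \<le> t. (if lam p \<le> K then 1 else 0) + lam p * exp (- lam p) / K)"
      unfolding step_def
    proof (rule sum_mono)
      fix p assume p: "p \<in> {p \<in> P. lam p \<le> t}"
      have l: "lam p > 0" using p lam_pos by auto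
      show "exp (- lam p) \<le> (if lam p \<le> K then 1 else 0) + lam p * exp (- lam p) / K"
      proof (cases "lam p \<le> K")
        case True
        have "exp (- lam p) \<le> 1" "0 \<le> lam p * exp (- lam p) / K" using l K by auto
        then have "exp (- lam p) \<le> 1 + lam p * exp (- lam p) / K" by linarith
        then show ?thesis using True by simp
      next
        case False
        then have "K * exp (- lam p) \<le> lam p * exp (- lam p)" by (intro mult_right_mono) auto
        then show ?thesis using False K by (simp add: pos_le_divide_eq mult.commute)
      qed
    qed
    also have "\<dots> = (\<Sum>p | p \<in> P \<and> lam p \<le> t. if lam p \<le> K then 1 else 0) + prime_mass t / K"
      by (simp add: sum.distrib prime_mass_def step_def sum_divide_distrib)
    also have "(\<Sum>p | p \<in> P \<and> lam p \<le> t. if lam p \<le> K then 1 else 0) = (\<Sum>p | p \<in> P \<and> lam p \<le> t \<and> lam p \<le> K. 1::real)"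
      by (rule sum.mono_neutral_cong_right) auto
    also have "\<dots> \<le> real (card {p \<in> P. lam p \<le> K})"
      by (simp, intro card_mono) auto
    finally show ?thesis by simp
  qed
  \<comment> \<open>With this value \<open>1 / (1 + 1 / K)\<close> is
    \<open>1 / (1 + e / 2)\<close>, which exceeds \<open>1 - e\<close>.\<close>
  define K where "K = 2 / e"
  have K: "K > 0" using e by (simp add: K_def)
  have "1 / (1 + 1 / K) > 1 - e"
  proof -
    have "1 > (1 - e) * (1 + e / 2)"
      using e by (simp add: algebra_simps add_pos_pos)
    then show ?thesis using e by (simp add: K_def pos_less_divide_eq)
  qed
  moreover have "((\<lambda>t. (power_mass t / t - real (card {p \<in> P. lam p \<le> K}) / t) / (1 + 1 / K)) \<longlongrightarrow> (1 - 0) / (1 + 1 / K)) at_top"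
  proof -
    have "((\<lambda>t. real (card {p \<in> P. lam p \<le> K}) / t) \<longlongrightarrow> 0) at_top"
      by (intro real_tendsto_divide_at_top[OF tendsto_const] filterlim_ident)
    moreover have "1 + 1 / K \<noteq> 0" using K by (simp add: add_nonneg_eq_0_iff)
    ultimately show ?thesis by (intro tendsto_divide tendsto_diff pl tendsto_const)
  qed
  ultimately have "\<forall>\<^sub>F t in at_top. (power_mass t / t - real (card {p \<in> P. lam p \<le> K}) / t) / (1 + 1 / K) > 1 - e"
    by (intro order_tendstoD(1)) auto
  then show "\<forall>\<^sub>F t in at_top. dist (prime_mass t / t) 1 < e"
    using tendstoD[OF pl e] eventually_gt_at_top[of 0]
  proof eventually_elim
    case (elim t)
    have "power_mass t \<le> prime_mass t + real (card {p \<in> P. lam p \<le> K}) + prime_mass t / K"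
      using power_mass_le[of t] small[OF K, of t] by simp
    then have "power_mass t / t \<le> (prime_mass t + real (card {p \<in> P. lam p \<le> K}) + prime_mass t / K) / t"
      using elim(3) by (intro divide_right_mono) auto
    then have "power_mass t / t - real (card {p \<in> P. lam p \<le> K}) / t \<le> prime_mass t / t * (1 + 1 / K)"
      by (simp add: add_divide_distrib algebra_simps)
    moreover have "1 + 1 / K > 0" using K by (simp add: add_pos_pos)
    ultimately have "(power_mass t / t - real (card {p \<in> P. lam p \<le> K}) / t) / (1 + 1 / K) \<le> prime_mass t / t"
      by (simp add: pos_divide_le_eq)
    moreover have "prime_mass t / t \<le> power_mass t / t"
      using elim(3) prime_mass_le_power_mass by (intro divide_right_mono) auto
    ultimately show ?case using elim(1,2) unfolding dist_real_def by linarith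
  qed
qed

end


subsection \<open>Size-biased picks\<close>

definition unit_cube :: "(nat \<Rightarrow> real) set" where
  "unit_cube = {x. \<forall>i. 0 \<le> x i \<and> x i \<le> 1}"

text \<open>A stick of length 1 is broken at \<open>x\<close> and the remainder according to \<open>y\<close>.\<close>

definition scons :: "real \<Rightarrow> (nat \<Rightarrow> real) \<Rightarrow> nat \<Rightarrow> real" where
  "scons x y = case_nat x (\<lambda>i. (1 - x) * y i)"

lemma scons_simps [simp]: "scons x y 0 = x" "scons x y (Suc i) = (1 - x) * y i"
  by (simp_all add: scons_def)

lemma scons_in_unit_cube:
  assumes "0 \<le> x" "x \<le> 1" "y \<in> unit_cube"
  shows "scons x y \<in> unit_cube"
proof -
  have "0 \<le> scons x y i \<and> scons x y i \<le> 1" for i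
    using assms by (cases i) (auto simp: unit_cube_def mult_le_one)
  then show ?thesis by (simp add: unit_cube_def)
qed

lemma zero_in_unit_cube: "(\<lambda>_. 0) \<in> unit_cube"
  by (simp add: unit_cube_def)

context weighted_primes
begin

text \<open>\<open>N t\<close> times the expectation of \<open>F\<close> at the first
  \<open>K\<close> picks, with weight \<open>lam p / t\<close> in place of the share of
  \<open>p\<close> in the actual size of the element. This makes the cofactor exactly uniform on the
  scale \<open>t - lam p\<close>; some mass is lost, but a vanishing proportion in the
  limit.\<close>

primrec pick_sum :: "nat \<Rightarrow> real \<Rightarrow> ((nat \<Rightarrow> real) \<Rightarrow> real) \<Rightarrow> real" where
  "pick_sum 0 t F = N t * F (\<lambda>_. 0)"
| "pick_sum (Suc K) t F = (\<Sum>p | p \<in> P \<and> lam p < t.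
      lam p / t * pick_sum K (t - lam p) (\<lambda>y. F (scons (lam p / t) y)))"

definition padded :: "real \<Rightarrow> 'a list \<Rightarrow> nat \<Rightarrow> real" where
  "padded t ps i = (if i < length ps then lam (ps ! i) / t else 0)"

lemma finite_primes_below [simp, intro]: "finite {p \<in> P. lam p < t}"
  by (rule finite_subset[OF _ finite_primes_upto[of t]]) auto

lemma pick_sum_zero: "pick_sum K t (\<lambda>_. 0) = 0"
  by (induction K arbitrary: t) simp_all

lemma pick_sum_mono:
  assumes "\<And>x. x \<in> unit_cube \<Longrightarrow> F x \<le> G x"
  shows "pick_sum K t F \<le> pick_sum K t G"
  using assms
proof (induction K arbitrary: t F G)
  case 0
  then show ?case by (simp add: mult_left_mono zero_in_unit_cube)
next
  case (Suc K)
  show ?case unfolding pick_sum.simps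
  proof (rule sum_mono)
    fix p assume p: "p \<in> {p \<in> P. lam p < t}"
    then have "0 < lam p" "lam p < t" by (auto intro: lam_pos)
    then have x: "0 \<le> lam p / t" "lam p / t \<le> 1" by (auto simp: divide_le_eq)
    show "lam p / t * pick_sum K (t - lam p) (\<lambda>y. F (scons (lam p / t) y))
      \<le> lam p / t * pick_sum K (t - lam p) (\<lambda>y. G (scons (lam p / t) y))"
      by (intro mult_left_mono x Suc.IH Suc.prems scons_in_unit_cube)
  qed
qed

lemma pick_sum_nonneg:
  assumes "\<And>x. x \<in> unit_cube \<Longrightarrow> 0 \<le> F x"
  shows "0 \<le> pick_sum K t F"
  using pick_sum_mono[of "\<lambda>_. 0" F K t] assms by (simp add: pick_sum_zero)

text \<open>Split the weight of each \<open>m\<close> over its prime factors in proportion to \<open>lam p / t\<close>, which are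
  at most 1 in total, and remove the chosen factor. Only this inequality is needed, since the
  limit has total mass 1; in particular multiplicities of prime factors may be ignored.\<close>

lemma pick_sum_le:
  assumes "\<And>m. m \<in> upto t \<Longrightarrow> 0 \<le> H m"
    and "\<And>m ps. m \<in> upto t \<Longrightarrow> length ps = K \<Longrightarrow> mset ps \<subseteq># m \<Longrightarrow> F (padded t ps) \<le> H m"
  shows "pick_sum K t F \<le> (\<Sum>m\<in>upto t. H m)"
  using assms
proof (induction K arbitrary: t F H)
  case 0
  have "pick_sum 0 t F = (\<Sum>m\<in>upto t. F (\<lambda>_. 0))" by (simp add: N_def)
  also have "\<dots> \<le> (\<Sum>m\<in>upto t. H m)"
  proof (rule sum_mono)
    fix m assume "m \<in> upto t"
    then show "F (\<lambda>_. 0) \<le> H m" using 0(2)[of m "[]"] by (simp add: padded_def)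
  qed
  finally show ?case .
next
  case (Suc K)
  have le: "(\<Sum>p | p \<in> {p \<in> P. lam p < t} \<and> p \<in># m. lam p / t * H m) \<le> H m" if m: "m \<in> upto t" for m
  proof (cases "t > 0")
    case True
    have "(\<Sum>p | p \<in> {p \<in> P. lam p < t} \<and> p \<in># m. lam p) \<le> (\<Sum>p\<in>set_mset m. lam p)"
      using m by (intro sum_mono2) (auto simp: upto_def less_imp_le[OF lam_pos])
    also have "\<dots> \<le> (\<Sum>p\<in>set_mset m. real (count m p) * lam p)"
    proof (rule sum_mono)
      fix p assume "p \<in># m"
      then have "1 * lam p \<le> real (count m p) * lam p"
        using m lam_pos[of p] by (intro mult_right_mono) (auto simp: upto_def Suc_le_eq)
      then show "lam p \<le> real (count m p) * lam p" by simp
    qed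
    also have "\<dots> = size_of m" unfolding size_of_def by (rule sum_mset_eq_sum_count[symmetric])
    also have "\<dots> \<le> t" using m by (simp add: upto_def)
    finally have "(\<Sum>p | p \<in> {p \<in> P. lam p < t} \<and> p \<in># m. lam p) / t \<le> 1" using True by simp
    then have "(\<Sum>p | p \<in> {p \<in> P. lam p < t} \<and> p \<in># m. lam p) / t * H m \<le> 1 * H m"
      using Suc.prems(1)[OF m] by (intro mult_right_mono)
    then show ?thesis by (simp add: sum_distrib_right sum_divide_distrib)
  next
    case False
    then have "(\<Sum>p | p \<in> {p \<in> P. lam p < t} \<and> p \<in># m. lam p / t * H m) = 0"
      by (intro sum.neutral) (use lam_pos in force)
    then show ?thesis using Suc.prems(1)[OF m] by simp
  qed
  have "pick_sum (Suc K) t F \<le> (\<Sum>p | p \<in> P \<and> lam p < t. lam p / t * (\<Sum>m\<in>upto (t - lam p). H (add_mset p m)))"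
    unfolding pick_sum.simps
  proof (rule sum_mono)
    fix p assume p: "p \<in> {p \<in> P. lam p < t}"
    then have l: "0 < lam p" "lam p < t" by (auto intro: lam_pos)
    show "lam p / t * pick_sum K (t - lam p) (\<lambda>y. F (scons (lam p / t) y))
      \<le> lam p / t * (\<Sum>m\<in>upto (t - lam p). H (add_mset p m))"
    proof (rule mult_left_mono[OF Suc.IH])
      fix m assume m: "m \<in> upto (t - lam p)"
      then have m': "add_mset p m \<in> upto t" using p by (auto simp: upto_def)
      then show "0 \<le> H (add_mset p m)" by (rule Suc.prems(1))
      fix ps assume ps: "length ps = K" "mset ps \<subseteq># m"
      \<comment> \<open>The later picks are normalised by \<open>t - lam p\<close>; the factor
        \<open>1 - lam p / t\<close> in \<open>scons\<close> converts this to
        \<open>t\<close>.\<close>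
      have "scons (lam p / t) (padded (t - lam p) ps) = padded t (p # ps)"
      proof
        fix i
        have "1 - lam p / t = (t - lam p) / t" using l by (simp add: diff_divide_distrib)
        then show "scons (lam p / t) (padded (t - lam p) ps) i = padded t (p # ps) i"
          using l by (cases i) (simp_all add: padded_def)
      qed
      then show "F (scons (lam p / t) (padded (t - lam p) ps)) \<le> H (add_mset p m)"
        using Suc.prems(2)[OF m', of "p # ps"] ps by simp
    qed (use l in auto)
  qed
  also have "\<dots> = (\<Sum>p | p \<in> P \<and> lam p < t. \<Sum>m | m \<in> upto t \<and> p \<in># m. lam p / t * H m)"
  proof (intro sum.cong refl)
    fix p assume p: "p \<in> {p \<in> P. lam p < t}"
    have "(\<Sum>m\<in>upto (t - lam p). H (add_mset p m)) = (\<Sum>m | m \<in> upto t \<and> p \<in># m. H m)"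
    proof (rule sum.reindex_bij_witness[of _ "\<lambda>m. m - {#p#}" "add_mset p"])
      fix m assume m: "m \<in> {m. m \<in> upto t \<and> p \<in># m}"
      then have eq: "add_mset p (m - {#p#}) = m" by simp
      from arg_cong[OF this, of size_of]
      have "size_of m = lam p + size_of (m - {#p#})" by simp
      then show "m - {#p#} \<in> upto (t - lam p)" using m by (auto simp: upto_def dest: in_diffD)
      show "add_mset p (m - {#p#}) = m" by (rule eq)
    qed (use p in \<open>auto simp: upto_def\<close>)
    then show "lam p / t * (\<Sum>m\<in>upto (t - lam p). H (add_mset p m)) =
      (\<Sum>m | m \<in> upto t \<and> p \<in># m. lam p / t * H m)"
      by (simp add: sum_distrib_left)
  qed
  also have "\<dots> = (\<Sum>m\<in>upto t. \<Sum>p | p \<in> {p \<in> P. lam p < t} \<and> p \<in># m. lam p / t * H m)"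
    by (rule sum.swap_restrict) auto
  also have "\<dots> \<le> (\<Sum>m\<in>upto t. H m)" by (intro sum_mono le)
  finally show ?case .
qed

end


subsection \<open>Truncated stick-breaking sequences\<close>

definition uniform01 :: "real measure" where
  "uniform01 = restrict_space lborel {0<..<1}"

lemma prob_space_uniform01: "prob_space uniform01"
  unfolding uniform01_def
  by (intro prob_spaceI) (simp add: emeasure_restrict_space space_restrict_space)

lemma uniform_sequence_eq: "uniform_sequence = (\<Pi>\<^sub>M i\<in>UNIV. uniform01)"
  by (simp add: uniform_sequence_def uniform01_def)

lemma space_uniform01: "space uniform01 = {0<..<1}"
  by (simp add: uniform01_def space_restrict_space)

lemma prob_space_uniform_sequence: "prob_space uniform_sequence"
  unfolding uniform_sequence_eq by (intro prob_space_PiM prob_space_uniform01)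

text \<open>The Griffiths-Engen-McCloskey sequence with zeros after \<open>K\<close> sticks, the
  shape of a padded list of \<open>K\<close> picks.\<close>

definition gem :: "real \<Rightarrow> nat \<Rightarrow> (nat \<Rightarrow> real) \<Rightarrow> nat \<Rightarrow> real" where
  "gem \<theta> K u i = (if i < K then stick_breaking \<theta> u i else 0)"

definition gem_exp :: "real \<Rightarrow> nat \<Rightarrow> ((nat \<Rightarrow> real) \<Rightarrow> real) \<Rightarrow> real" where
  "gem_exp \<theta> K F = (\<integral>u. F (gem \<theta> K u) \<partial>uniform_sequence)"

text \<open>The last clause is uniform continuity on the cube in quantitative form. It survives
  fixing the first stick and cutting at 0, which makes the class suitable for induction on
  \<open>K\<close>. Nonnegativity allows terms to be dropped.\<close>

definition test_fun :: "nat \<Rightarrow> ((nat \<Rightarrow> real) \<Rightarrow> real) \<Rightarrow> bool" where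
  "test_fun K F \<longleftrightarrow> F \<in> borel_measurable (\<Pi>\<^sub>M i\<in>UNIV. borel) \<and>
     (\<exists>B. \<forall>x\<in>unit_cube. 0 \<le> F x \<and> F x \<le> B) \<and>
     (\<forall>\<epsilon>>0. \<exists>C\<ge>0. \<forall>x\<in>unit_cube. \<forall>y\<in>unit_cube. \<bar>F x - F y\<bar> \<le> \<epsilon> + C * (\<Sum>i<K. \<bar>x i - y i\<bar>))"

lemma sum_stick_breaking:
  "(\<Sum>i<n. stick_breaking \<theta> u i) = 1 - (\<Prod>j<n. u j powr (1 / \<theta>))"
  by (induction n) (auto simp: stick_breaking_def algebra_simps)

text \<open>Self-similarity: after the first break the remainder is broken in the same way, from the
  shifted variables.\<close>

lemma stick_breaking_case_nat:
  "stick_breaking \<theta> (case_nat s u) = scons (1 - s powr (1 / \<theta>)) (stick_breaking \<theta> u)"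
proof
  fix i
  show "stick_breaking \<theta> (case_nat s u) i = scons (1 - s powr (1 / \<theta>)) (stick_breaking \<theta> u) i"
    by (cases i) (simp_all add: stick_breaking_def prod.lessThan_Suc_shift mult_ac del: prod.lessThan_Suc)
qed

lemma gem_case_nat: "gem \<theta> (Suc K) (case_nat s u) = scons (1 - s powr (1 / \<theta>)) (gem \<theta> K u)"
proof
  fix i
  show "gem \<theta> (Suc K) (case_nat s u) i = scons (1 - s powr (1 / \<theta>)) (gem \<theta> K u) i"
    by (cases i) (simp_all add: gem_def stick_breaking_case_nat)
qed

lemma stick_breaking_in_unit_cube:
  assumes "\<theta> > 0" "u \<in> space uniform_sequence"
  shows "stick_breaking \<theta> u \<in> unit_cube"
proof -
  have u: "\<And>i. u i \<in> {0<..<1}" using assms(2) by (auto simp: space_uniform_sequence)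
  have "0 \<le> stick_breaking \<theta> u i" for i
    using stick_breaking_pos[OF assms(1) u] by (rule less_imp_le)
  moreover have "stick_breaking \<theta> u i \<le> 1" for i
  proof -
    have "stick_breaking \<theta> u i \<le> (\<Sum>i<Suc i. stick_breaking \<theta> u i)"
      using \<open>\<And>i. 0 \<le> stick_breaking \<theta> u i\<close> by (intro member_le_sum) auto
    also have "\<dots> \<le> 1" unfolding sum_stick_breaking by (simp add: prod_nonneg)
    finally show ?thesis .
  qed
  ultimately show ?thesis by (simp add: unit_cube_def)
qed

lemma gem_in_unit_cube:
  assumes "\<theta> > 0" "u \<in> space uniform_sequence"
  shows "gem \<theta> K u \<in> unit_cube"
  using stick_breaking_in_unit_cube[OF assms] by (auto simp: unit_cube_def gem_def)

lemma measurable_stick_breaking_seq [measurable]: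
  "stick_breaking \<theta> \<in> measurable uniform_sequence (\<Pi>\<^sub>M i\<in>UNIV. borel)"
  by (rule measurable_PiM_single') (auto intro: measurable_stick_breaking)

lemma measurable_gem [measurable]: "gem \<theta> K \<in> measurable uniform_sequence (\<Pi>\<^sub>M i\<in>UNIV. borel)"
proof (rule measurable_PiM_single')
  fix i show "(\<lambda>u. gem \<theta> K u i) \<in> borel_measurable uniform_sequence"
    by (cases "i < K") (simp_all add: gem_def measurable_stick_breaking)
qed auto

lemma measurable_scons [measurable]:
  "scons x \<in> measurable (\<Pi>\<^sub>M i\<in>UNIV. borel) (\<Pi>\<^sub>M i\<in>UNIV. borel)"
proof (rule measurable_PiM_single')
  fix i show "(\<lambda>y. scons x y i) \<in> borel_measurable (\<Pi>\<^sub>M i\<in>UNIV. borel)"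
    by (cases i) (simp_all add: measurable_component_singleton)
qed auto

lemma test_fun_measurable: "test_fun K F \<Longrightarrow> F \<in> borel_measurable (\<Pi>\<^sub>M i\<in>UNIV. borel)"
  by (simp add: test_fun_def)

lemma integrable_gem:
  fixes F :: "(nat \<Rightarrow> real) \<Rightarrow> real"
  assumes "\<theta> > 0" "F \<in> borel_measurable (\<Pi>\<^sub>M i\<in>UNIV. borel)" "\<And>x. x \<in> unit_cube \<Longrightarrow> \<bar>F x\<bar> \<le> B"
  shows "integrable uniform_sequence (\<lambda>u. F (gem \<theta> K u))"
proof -
  interpret prob_space uniform_sequence by (rule prob_space_uniform_sequence)
  show ?thesis
    by (rule integrable_const_bound[of _ B])
      (use assms gem_in_unit_cube in \<open>auto intro!: measurable_compose[OF measurable_gem]\<close>)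
qed

text \<open>Prepending an independent uniform variable to the uniform sequence reproduces its law,
  so Fubini's theorem integrates out the later sticks for a fixed first one.\<close>

lemma gem_exp_Suc:
  fixes F :: "(nat \<Rightarrow> real) \<Rightarrow> real"
  assumes \<theta>: "\<theta> > 0" and F: "F \<in> borel_measurable (\<Pi>\<^sub>M i\<in>UNIV. borel)"
    and B: "\<And>x. x \<in> unit_cube \<Longrightarrow> \<bar>F x\<bar> \<le> B"
  shows "gem_exp \<theta> (Suc K) F = (\<integral>s. gem_exp \<theta> K (\<lambda>y. F (scons (1 - s powr (1 / \<theta>)) y)) \<partial>uniform01)"
    and "integrable uniform01 (\<lambda>s. gem_exp \<theta> K (\<lambda>y. F (scons (1 - s powr (1 / \<theta>)) y)))"
proof -
  interpret U: prob_space uniform01 by (rule prob_space_uniform01)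
  interpret product_prob_space "\<lambda>_. uniform01" "UNIV :: nat set" ..
  interpret sequence_space uniform01 ..
  interpret S: prob_space S by (rule prob_space_PiM[OF prob_space_uniform01])
  interpret P: pair_prob_space uniform01 S ..
  note [simp] = uniform_sequence_eq[symmetric]
  have iter: "distr (uniform01 \<Otimes>\<^sub>M S) S (\<lambda>(s, \<omega>). case_nat s \<omega>) = S" by (rule PiM_iter)
  have cn: "(\<lambda>(s, \<omega>). case_nat s \<omega>) \<in> measurable (uniform01 \<Otimes>\<^sub>M S) S"
    by measurable
  have FS: "(\<lambda>u. F (gem \<theta> (Suc K) u)) \<in> borel_measurable S"
    using measurable_compose[OF measurable_gem F] by simp
  have meas: "(\<lambda>x. F (gem \<theta> (Suc K) (case x of (s, \<omega>) \<Rightarrow> case_nat s \<omega>))) \<in> borel_measurable (uniform01 \<Otimes>\<^sub>M S)"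
    by (rule measurable_compose[OF cn FS])
  have int: "integrable (uniform01 \<Otimes>\<^sub>M S) (\<lambda>x. F (gem \<theta> (Suc K) (case x of (s, \<omega>) \<Rightarrow> case_nat s \<omega>)))"
  proof (rule P.integrable_const_bound[of _ B])
    show "AE x in uniform01 \<Otimes>\<^sub>M S. norm (F (gem \<theta> (Suc K) (case x of (s, \<omega>) \<Rightarrow> case_nat s \<omega>))) \<le> B"
    proof (rule AE_I2)
      fix x assume "x \<in> space (uniform01 \<Otimes>\<^sub>M S)"
      then have "(case x of (s, \<omega>) \<Rightarrow> case_nat s \<omega>) \<in> space S" using measurable_space[OF cn] by auto
      then show "norm (F (gem \<theta> (Suc K) (case x of (s, \<omega>) \<Rightarrow> case_nat s \<omega>))) \<le> B"
        using gem_in_unit_cube[OF \<theta>] B by simp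
    qed
  qed (rule meas)
  have "gem_exp \<theta> (Suc K) F = (\<integral>u. F (gem \<theta> (Suc K) u) \<partial>distr (uniform01 \<Otimes>\<^sub>M S) S (\<lambda>(s, \<omega>). case_nat s \<omega>))"
    unfolding iter by (simp add: gem_exp_def)
  also have "\<dots> = (\<integral>x. F (gem \<theta> (Suc K) (case x of (s, \<omega>) \<Rightarrow> case_nat s \<omega>)) \<partial>(uniform01 \<Otimes>\<^sub>M S))"
    by (rule integral_distr[OF cn FS])
  also have "\<dots> = (\<integral>s. \<integral>\<omega>. F (gem \<theta> (Suc K) (case_nat s \<omega>)) \<partial>S \<partial>uniform01)"
    using P.integral_fst'[OF int] by simp
  also have "\<dots> = (\<integral>s. gem_exp \<theta> K (\<lambda>y. F (scons (1 - s powr (1 / \<theta>)) y)) \<partial>uniform01)"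
    by (simp add: gem_exp_def gem_case_nat)
  finally show "gem_exp \<theta> (Suc K) F = (\<integral>s. gem_exp \<theta> K (\<lambda>y. F (scons (1 - s powr (1 / \<theta>)) y)) \<partial>uniform01)" .
  show "integrable uniform01 (\<lambda>s. gem_exp \<theta> K (\<lambda>y. F (scons (1 - s powr (1 / \<theta>)) y)))"
    using P.integrable_fst'[OF int] by (simp add: gem_exp_def gem_case_nat)
qed

lemma measure_uniform01:
  assumes "0 \<le> a" "a \<le> b" "b \<le> 1"
  shows "measure uniform01 ({a<..b} \<inter> {0<..<1}) = b - a"
proof -
  have "emeasure uniform01 ({a<..b} \<inter> {0<..<1}) = emeasure lborel ({a<..b} \<inter> {0<..<1})"
    unfolding uniform01_def by (rule emeasure_restrict_space) auto
  also have "\<dots> = emeasure lborel {a<..<b}"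
  proof (rule emeasure_eq_AE)
    show "AE x in lborel. (x \<in> {a<..b} \<inter> {0<..<1}) = (x \<in> {a<..<b})"
      using AE_lborel_singleton[of a] AE_lborel_singleton[of b] 
      by eventually_elim (use assms in auto)
  qed auto
  also have "\<dots> = ennreal (b - a)" using assms by simp
  finally show ?thesis using assms by (simp add: measure_def)
qed

text \<open>Provides the test function for the induction hypothesis: the first stick is frozen at a
  grid point \<open>x\<close>, and \<open>c\<close> pays for the freezing. For the modulus, the
  entries at 0 cancel and the others are scaled by \<open>1 - x \<le> 1\<close>.\<close>

lemma test_fun_scons:
  assumes F: "test_fun (Suc K) F" and x: "0 \<le> x" "x \<le> 1" and c: "c \<ge> 0"
  shows "test_fun K (\<lambda>y. max 0 (F (scons x y) - c))"
  unfolding test_fun_def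
proof (intro conjI allI impI)
  have [measurable]: "F \<in> borel_measurable (\<Pi>\<^sub>M i\<in>UNIV. borel)" using F by (simp add: test_fun_def)
  show "(\<lambda>y. max 0 (F (scons x y) - c)) \<in> borel_measurable (\<Pi>\<^sub>M i\<in>UNIV. borel)"
    by measurable
  obtain B where B: "\<And>x. x \<in> unit_cube \<Longrightarrow> 0 \<le> F x \<and> F x \<le> B" using F unfolding test_fun_def by blast
  show "\<exists>B. \<forall>y\<in>unit_cube. 0 \<le> max 0 (F (scons x y) - c) \<and> max 0 (F (scons x y) - c) \<le> B"
  proof (intro exI ballI)
    fix y :: "nat \<Rightarrow> real" assume y: "y \<in> unit_cube"
    show "0 \<le> max 0 (F (scons x y) - c) \<and> max 0 (F (scons x y) - c) \<le> B"
      using B[OF scons_in_unit_cube[OF x y]] c by (auto simp: max_def)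
  qed
  fix \<epsilon> :: real assume "\<epsilon> > 0"
  then obtain C where C: "C \<ge> 0" "\<And>x y. x \<in> unit_cube \<Longrightarrow> y \<in> unit_cube \<Longrightarrow> \<bar>F x - F y\<bar> \<le> \<epsilon> + C * (\<Sum>i<Suc K. \<bar>x i - y i\<bar>)"
    using F unfolding test_fun_def by blast
  show "\<exists>C\<ge>0. \<forall>y\<in>unit_cube. \<forall>z\<in>unit_cube.
      \<bar>max 0 (F (scons x y) - c) - max 0 (F (scons x z) - c)\<bar> \<le> \<epsilon> + C * (\<Sum>i<K. \<bar>y i - z i\<bar>)"
  proof (intro exI[of _ C] conjI ballI C(1))
    fix y z :: "nat \<Rightarrow> real" assume yz: "y \<in> unit_cube" "z \<in> unit_cube"
    have "\<bar>max 0 (F (scons x y) - c) - max 0 (F (scons x z) - c)\<bar> \<le> \<bar>F (scons x y) - F (scons x z)\<bar>"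
      by (simp add: max_def)
    also have "\<dots> \<le> \<epsilon> + C * (\<Sum>i<Suc K. \<bar>scons x y i - scons x z i\<bar>)"
      using yz x by (intro C scons_in_unit_cube)
    also have "(\<Sum>i<Suc K. \<bar>scons x y i - scons x z i\<bar>) = (\<Sum>i<K. (1 - x) * \<bar>y i - z i\<bar>)"
      using x by (simp add: sum.lessThan_Suc_shift right_diff_distrib[symmetric] abs_mult del: sum.lessThan_Suc)
    also have "\<dots> \<le> (\<Sum>i<K. \<bar>y i - z i\<bar>)"
      using x by (intro sum_mono) (auto simp: mult_left_le_one_le)
    finally show "\<bar>max 0 (F (scons x y) - c) - max 0 (F (scons x z) - c)\<bar> \<le> \<epsilon> + C * (\<Sum>i<K. \<bar>y i - z i\<bar>)"
      using C(1) by (simp add: mult_left_mono)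
  qed
qed

lemma abs_scons_diff_le:
  assumes "y \<in> unit_cube"
  shows "\<bar>scons x y i - scons x' y i\<bar> \<le> \<bar>x - x'\<bar>"
proof (cases i)
  case (Suc k)
  have "scons x y i - scons x' y i = (x' - x) * y k" by (simp add: Suc algebra_simps)
  then have "\<bar>scons x y i - scons x' y i\<bar> = \<bar>x - x'\<bar> * y k"
    using assms by (simp add: abs_mult unit_cube_def abs_minus_commute)
  also have "\<dots> \<le> \<bar>x - x'\<bar>" using assms by (simp add: unit_cube_def mult_left_le)
  finally show ?thesis .
qed simp

lemma test_fun_scons_close:
  assumes F: "test_fun (Suc K) F" and \<delta>: "\<delta> > 0"
  obtains C where "C \<ge> 0" "\<And>x x' y. \<lbrakk>0 \<le> x; x \<le> 1; 0 \<le> x'; x' \<le> 1; y \<in> unit_cube\<rbrakk> \<Longrightarrow>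
    \<bar>F (scons x y) - F (scons x' y)\<bar> \<le> \<delta> + C * \<bar>x - x'\<bar>"
proof -
  obtain C where C: "C \<ge> 0" "\<And>x y. x \<in> unit_cube \<Longrightarrow> y \<in> unit_cube \<Longrightarrow> \<bar>F x - F y\<bar> \<le> \<delta> + C * (\<Sum>i<Suc K. \<bar>x i - y i\<bar>)"
    using F \<delta> unfolding test_fun_def by blast
  have "\<bar>F (scons x y) - F (scons x' y)\<bar> \<le> \<delta> + (C * real (Suc K)) * \<bar>x - x'\<bar>"
    if "0 \<le> x" "x \<le> 1" "0 \<le> x'" "x' \<le> 1" "y \<in> unit_cube" for x x' y
  proof -
    have "\<bar>F (scons x y) - F (scons x' y)\<bar> \<le> \<delta> + C * (\<Sum>i<Suc K. \<bar>scons x y i - scons x' y i\<bar>)"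
      using that by (intro C scons_in_unit_cube)
    also have "(\<Sum>i<Suc K. \<bar>scons x y i - scons x' y i\<bar>) \<le> (\<Sum>i<Suc K. \<bar>x - x'\<bar>)"
      using that by (intro sum_mono abs_scons_diff_le)
    finally show ?thesis using C(1) by (simp add: mult_left_mono mult.assoc)
  qed
  then show ?thesis using that[of "C * real (Suc K)"] C(1) by simp
qed


subsection \<open>Lower bound for the sums over picks\<close>

lemma gem_exp_mono:
  fixes F G :: "(nat \<Rightarrow> real) \<Rightarrow> real"
  assumes \<theta>: "\<theta> > 0"
    and "F \<in> borel_measurable (\<Pi>\<^sub>M i\<in>UNIV. borel)" "\<And>x. x \<in> unit_cube \<Longrightarrow> \<bar>F x\<bar> \<le> B"
    and "G \<in> borel_measurable (\<Pi>\<^sub>M i\<in>UNIV. borel)" "\<And>x. x \<in> unit_cube \<Longrightarrow> \<bar>G x\<bar> \<le> B'"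
    and le: "\<And>x. x \<in> unit_cube \<Longrightarrow> F x \<le> G x + c"
  shows "gem_exp \<theta> K F \<le> gem_exp \<theta> K G + c"
proof -
  interpret prob_space uniform_sequence by (rule prob_space_uniform_sequence)
  have i: "integrable uniform_sequence (\<lambda>u. F (gem \<theta> K u))" "integrable uniform_sequence (\<lambda>u. G (gem \<theta> K u))"
    using integrable_gem[OF \<theta>] assms by blast+
  have "gem_exp \<theta> K F \<le> (\<integral>u. G (gem \<theta> K u) + c \<partial>uniform_sequence)"
    unfolding gem_exp_def
    by (intro integral_mono) (use i gem_in_unit_cube[OF \<theta>] le in auto)
  also have "\<dots> = gem_exp \<theta> K G + c"
    using i by (simp add: gem_exp_def prob_space)
  finally show ?thesis .
qed

lemma gem_exp_le:
  fixes F :: "(nat \<Rightarrow> real) \<Rightarrow> real"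
  assumes \<theta>: "\<theta> > 0" and F: "F \<in> borel_measurable (\<Pi>\<^sub>M i\<in>UNIV. borel)" 
    and B: "\<And>x. x \<in> unit_cube \<Longrightarrow> \<bar>F x\<bar> \<le> B"
  shows "gem_exp \<theta> K F \<le> B"
proof -
  have "F x \<le> 0 + B" if "x \<in> unit_cube" for x using B[OF that] by simp
  moreover have "gem_exp \<theta> K (\<lambda>_. 0) = 0" by (simp add: gem_exp_def)
  ultimately show ?thesis
    using gem_exp_mono[OF \<theta> F B, of "\<lambda>_. 0" 0 B K] by simp
qed

text \<open>For the grid points \<open>1 - r ^ j\<close>, the cell \<open>j\<close> has limiting
  probability \<open>(1 - r powr \<theta>) * r powr (\<theta> * j)\<close>, whereas crude bounds
  inside the cell yield the right side times \<open>r powr (\<theta> * j)\<close>. Their quotient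
  does not depend on \<open>j\<close> and tends to 1 as \<open>r\<close> tends to 1. In the proof
  \<open>r\<close> is \<open>1 - 1 / x\<close> with \<open>x\<close> tending to infinity.\<close>

lemma grid_ratio:
  fixes \<theta> :: real and i :: nat
  assumes "\<theta> > 0" "\<delta> > 0"
  shows "\<exists>r. 0 < r \<and> r < 1 \<and> 1 - r < \<delta> \<and> (1 - \<delta>) * (1 - r powr \<theta>) \<le> \<theta> * (1 - r) * r powr (\<theta> - 1 + real i)"
proof -
  have "((\<lambda>x::real. \<theta> * (1 - (1 - 1 / x)) * (1 - 1 / x) powr (\<theta> - 1 + real i) / (1 - (1 - 1 / x) powr \<theta>)) \<longlongrightarrow> 1) at_top"
    using assms by real_asymp
  from order_tendstoD(1)[OF this, of "1 - \<delta>"] assms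
  have "\<forall>\<^sub>F x::real in at_top. 1 - \<delta> < \<theta> * (1 - (1 - 1 / x)) * (1 - 1 / x) powr (\<theta> - 1 + real i) / (1 - (1 - 1 / x) powr \<theta>)"
    by simp
  moreover have "\<forall>\<^sub>F x::real in at_top. 1 / x < \<delta>" using assms by real_asymp
  moreover note eventually_gt_at_top[of "1::real"]
  ultimately have "\<forall>\<^sub>F x::real in at_top. \<exists>r. 0 < r \<and> r < 1 \<and> 1 - r < \<delta> \<and> (1 - \<delta>) * (1 - r powr \<theta>) \<le> \<theta> * (1 - r) * r powr (\<theta> - 1 + real i)"
  proof eventually_elim
    case (elim x)
    define r where "r = 1 - 1 / x"
    have r: "0 < r" "r < 1" "1 - r < \<delta>" using elim(2,3) by (auto simp: r_def)
    have "r powr \<theta> < 1" using r assms powr_less_mono2[of \<theta> r 1] by simp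
    then have "(1 - \<delta>) * (1 - r powr \<theta>) \<le> \<theta> * (1 - r) * r powr (\<theta> - 1 + real i)"
      using elim(1) by (simp add: r_def[symmetric] pos_less_divide_eq)
    with r show ?case by blast
  qed
  then show ?thesis using eventually_happens by force
qed

context weighted_primes
begin

lemma prime_mass_scale:
  assumes "((\<lambda>t. prime_mass t / t) \<longlongrightarrow> \<theta>) at_top" "0 \<le> a"
  shows "((\<lambda>t. prime_mass (a * t) / t) \<longlongrightarrow> \<theta> * a) at_top"
proof (cases "a = 0")
  case True
  have "((\<lambda>t. prime_mass 0 / t) \<longlongrightarrow> 0) at_top"
    by (intro real_tendsto_divide_at_top[OF tendsto_const] filterlim_ident)
  then show ?thesis using True by simp
next
  case False
  then have a: "a > 0" using assms by simp
  have "filterlim (\<lambda>t. a * t) at_top at_top" using a by real_asymp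
  from filterlim_compose[OF assms(1) this]
  have "((\<lambda>t. prime_mass (a * t) / (a * t) * a) \<longlongrightarrow> \<theta> * a) at_top"
    by (intro tendsto_mult tendsto_const)
  then show ?thesis using a by simp
qed

text \<open>For \<open>p\<close> in the cell, the scale \<open>s = t - lam p\<close> of the cofactor
  lies between \<open>u * t\<close> and \<open>v * t\<close>, where \<open>u = r ^ Suc j\<close> and
  \<open>v = r ^ j\<close>. Hence \<open>W s\<close> is at least \<open>W (u * t)\<close> and
  \<open>s ^ i\<close> at most \<open>(v * t) ^ i\<close>, which bounds \<open>N s\<close> below by
  \<open>exp s\<close> times a constant of the cell. The remaining sum of
  \<open>lam p * exp (- lam p)\<close> is an increment of \<open>prime_mass\<close>, about
  \<open>\<theta> * (v - u) * t\<close>.\<close>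

lemma cell_mass:
  fixes W :: "real \<Rightarrow> real" and i j :: nat
  assumes \<theta>: "\<theta> > 0" and pm: "((\<lambda>t. prime_mass t / t) \<longlongrightarrow> \<theta>) at_top"
    and c: "c > 0" and W: "\<And>s t. 0 < s \<Longrightarrow> s \<le> t \<Longrightarrow> 0 < W s \<and> W s \<le> W t"
    and N_lim: "((\<lambda>t. exp (- t) * N t * t ^ i / W t) \<longlongrightarrow> c) at_top"
    and W_lim: "\<And>u. 0 < u \<Longrightarrow> u \<le> 1 \<Longrightarrow> ((\<lambda>t. W (u * t) / W t) \<longlongrightarrow> u powr (\<theta> - 1 + real i)) at_top"
    and r: "0 < r" "r < 1" and \<delta>: "\<delta> > 0"
  shows "\<forall>\<^sub>F t in at_top. N t * (\<theta> * (1 - r) * r powr (\<theta> - 1 + real i) * r powr (\<theta> * real j) - \<delta>)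
    \<le> (\<Sum>p | p \<in> P \<and> (1 - r ^ j) * t < lam p \<and> lam p \<le> (1 - r ^ Suc j) * t. lam p / t * N (t - lam p))"
proof -
  define u where "u = r ^ Suc j"
  define v where "v = r ^ j"
  have uv: "0 < u" "u \<le> 1" "0 < v" "v \<le> 1" "u < v" "u = r * v"
    using r by (auto simp: u_def v_def power_le_one mult_le_one)
  \<comment> \<open>Up to factors close to 1, a lower bound for the share of \<open>N t\<close> that
    falls to the cell: the ratio of the counts times the normalised prime mass.\<close>
  define L where "L = (\<lambda>t. W (u * t) / W t * (1 / v) ^ i * ((prime_mass ((1 - u) * t) - prime_mass ((1 - v) * t)) / t))"
  define L0 where "L0 = \<theta> * (1 - r) * r powr (\<theta> - 1 + real i) * r powr (\<theta> * real j)"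
  have L0: "L0 \<ge> 0" using \<theta> r by (simp add: L0_def)
  have "(L \<longlongrightarrow> u powr (\<theta> - 1 + real i) * (1 / v) ^ i * (\<theta> * (1 - u) - \<theta> * (1 - v))) at_top"
    unfolding L_def diff_divide_distrib
    using uv by (intro tendsto_mult tendsto_const tendsto_diff W_lim prime_mass_scale[OF pm]) auto
  also have "u powr (\<theta> - 1 + real i) * (1 / v) ^ i * (\<theta> * (1 - u) - \<theta> * (1 - v)) = L0"
  proof -
    have ru: "u = r powr (1 + real j)" and rv: "v = r powr real j" 
      using r by (auto simp: u_def v_def powr_realpow powr_add)
    have vi: "(1 / v) ^ i = r powr (- (real j * real i))"
      using r by (simp add: rv power_one_over powr_minus_divide powr_powr[symmetric] powr_realpow[symmetric])
    have "\<theta> * (1 - u) - \<theta> * (1 - v) = \<theta> * (1 - r) * r powr real j"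
      using uv(6) by (simp add: rv algebra_simps)
    then have "u powr (\<theta> - 1 + real i) * (1 / v) ^ i * (\<theta> * (1 - u) - \<theta> * (1 - v)) =
       \<theta> * (1 - r) * (r powr ((1 + real j) * (\<theta> - 1 + real i)) * r powr (- (real j * real i)) * r powr real j)"
      by (simp add: vi ru powr_powr mult_ac)
    also have "r powr ((1 + real j) * (\<theta> - 1 + real i)) * r powr (- (real j * real i)) * r powr real j =
       r powr ((1 + real j) * (\<theta> - 1 + real i) + - (real j * real i) + real j)"
      by (simp only: powr_add)
    also have "(1 + real j) * (\<theta> - 1 + real i) + - (real j * real i) + real j = (\<theta> - 1 + real i) + \<theta> * real j"
      by (simp add: algebra_simps)
    finally show ?thesis by (simp only: L0_def powr_add mult_ac)
  qed
  finally have L_lim: "(L \<longlongrightarrow> L0) at_top" .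
  \<comment> \<open>Half of \<delta> covers the convergence of \<open>L\<close>. The other half
    covers the factor \<open>(1 - \<eta>) / (1 + \<eta>)\<close>, which costs at most
    \<open>2 * \<eta> * L t\<close> with \<open>L t < L0 + 1\<close>.\<close>
  define \<eta> where "\<eta> = min (1 / 2) (\<delta> / (4 * (L0 + 1)))"
  have \<eta>: "0 < \<eta>" using \<delta> L0 by (simp add: \<eta>_def)
  have \<eta>1: "\<eta> \<le> 1 / 2" unfolding \<eta>_def by (rule min.cobounded1)
  have "\<eta> \<le> \<delta> / (4 * (L0 + 1))" by (simp add: \<eta>_def)
  then have \<eta>2: "2 * \<eta> * (L0 + 1) \<le> \<delta> / 2" using L0 by (simp add: pos_le_divide_eq algebra_simps)
  define g where "g = (\<lambda>t. exp (- t) * N t * t ^ i / W t)"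
  have "\<forall>\<^sub>F t in at_top. dist (g t) c < \<eta> * c"
    using \<eta> c N_lim by (intro tendstoD) (auto simp: g_def)
  then obtain t0 where t0: "\<And>t. t \<ge> t0 \<Longrightarrow> dist (g t) c < \<eta> * c"
    by (auto simp: eventually_at_top_linorder)
  have g: "(1 - \<eta>) * c \<le> g t" "g t \<le> (1 + \<eta>) * c" if "t \<ge> t0" for t
    using t0[OF that] by (auto simp: dist_real_def abs_less_iff algebra_simps)
  \<comment> \<open>The scales of all cofactors in the cell are at least \<open>u * t\<close>, so
    one threshold serves them simultaneously.\<close>
  have "\<forall>\<^sub>F t in at_top. u * t \<ge> max t0 1" using uv by real_asymp
  moreover have "\<forall>\<^sub>F t in at_top. L0 - \<delta> / 2 < L t" "\<forall>\<^sub>F t in at_top. L t < L0 + 1"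
    using \<delta> by (intro order_tendstoD[OF L_lim]; simp)+
  ultimately show ?thesis
    using eventually_gt_at_top[of 0] unfolding L0_def[symmetric]
  proof eventually_elim
    case (elim t)
    define cell where "cell = {p \<in> P. (1 - v) * t < lam p \<and> lam p \<le> (1 - u) * t}"
    have t: "t > 0" "u * t \<ge> t0" "u * t > 0" using elim(1,4) by auto
    have tt: "u * t \<le> t" using uv t by (simp add: mult_left_le_one_le)
    have N_eq: "N s = g s * exp s * W s / s ^ i" if "s > 0" for s
      using W[of s s] that by (simp add: g_def exp_minus field_simps)
    define \<beta> where "\<beta> = N t * ((1 - \<eta>) / (1 + \<eta>)) * (W (u * t) / W t * (1 / v) ^ i)"
    have Wt: "W t > 0" "W (u * t) > 0" using W[of t t] W[of "u * t" "u * t"] t by auto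
    have N_ge: "\<beta> * exp (- lam p) \<le> N (t - lam p)" if p: "p \<in> cell" for p
    proof -
      define s where "s = t - lam p"
      have s: "u * t \<le> s" "s < v * t" using p by (auto simp: cell_def s_def algebra_simps)
      have "N t = g t * exp t * W t / t ^ i" using t by (intro N_eq)
      also have "\<dots> \<le> (1 + \<eta>) * c * exp t * W t / t ^ i"
        using g(2)[of t] tt t Wt by (intro divide_right_mono mult_right_mono) auto
      finally have "\<beta> \<le> ((1 + \<eta>) * c * exp t * W t / t ^ i) * ((1 - \<eta>) / (1 + \<eta>)) * (W (u * t) / W t * (1 / v) ^ i)"
        unfolding \<beta>_def using \<eta> \<eta>1 Wt uv by (intro mult_right_mono) auto
      also have "\<dots> = (1 - \<eta>) * c * exp t * W (u * t) / (v * t) ^ i"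
      proof -
        have "(q * c' * e * w / a) * (x / q) * (wu / w * b) = x * c' * e * wu * b / a"
          if "q \<noteq> 0" "w \<noteq> 0" for q c' e w a x wu b :: real
          using that by simp
        from this[of "1 + \<eta>" "W t" c "exp t" "t ^ i" "1 - \<eta>" "W (u * t)" "(1 / v) ^ i"]
        show ?thesis using \<eta> Wt by (simp add: power_mult_distrib power_one_over mult_ac)
      qed
      finally have "\<beta> * exp (- lam p) \<le> (1 - \<eta>) * c * exp t * W (u * t) / (v * t) ^ i * exp (- lam p)"
        by (rule mult_right_mono) simp
      also have "\<dots> = (1 - \<eta>) * c * exp s * W (u * t) / (v * t) ^ i"
        by (simp add: s_def exp_diff exp_minus field_simps)
      also have "\<dots> \<le> g s * exp s * W s / s ^ i"
      proof -
        have "0 \<le> (1 - \<eta>) * c" using \<eta>1 c by simp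
        then have gs: "0 \<le> g s" using g(1)[of s] s t by linarith
        have Ws: "0 < W s" "W (u * t) \<le> W s" using W[of s s] W[of "u * t" s] s t by auto
        have "0 \<le> g s * exp s" using gs by simp
        moreover have "0 \<le> g s * exp s * W s" using gs Ws by simp
        ultimately show ?thesis
          using g(1)[of s] s t gs Ws Wt by (intro frac_le mult_mono power_mono) auto
      qed
      also have "\<dots> = N s" using s t by (intro N_eq[symmetric]) auto
      finally show ?thesis by (simp add: s_def)
    qed
    have fin: "finite cell" by (rule finite_subset[OF _ finite_primes_upto[of "(1 - u) * t"]]) (auto simp: cell_def)
    have cell_sum: "(\<Sum>p\<in>cell. lam p * exp (- lam p)) = prime_mass ((1 - u) * t) - prime_mass ((1 - v) * t)"
    proof -
      have le: "(1 - v) * t \<le> (1 - u) * t" using uv(5) t by (intro mult_right_mono) auto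
      have "cell = {p \<in> P. lam p \<le> (1 - u) * t} - {p \<in> P. lam p \<le> (1 - v) * t}"
        by (auto simp: cell_def)
      then show ?thesis unfolding prime_mass_def step_def
        using le by (subst sum_diff[symmetric]) auto
    qed
    have "N t * (L0 - \<delta>) \<le> N t * ((1 - \<eta>) / (1 + \<eta>) * L t)"
    proof (rule mult_left_mono)
      have "1 - 2 * \<eta> \<le> (1 - \<eta>) / (1 + \<eta>)"
      proof -
        have "(1 - 2 * \<eta>) * (1 + \<eta>) \<le> 1 - \<eta>" using \<eta> by (simp add: algebra_simps)
        then show ?thesis using \<eta> by (subst pos_le_divide_eq) auto
      qed
      moreover have "L t \<ge> 0"
      proof -
        have "0 \<le> prime_mass ((1 - u) * t) - prime_mass ((1 - v) * t)"
          unfolding cell_sum[symmetric] by (rule sum_nonneg) (auto simp: cell_def less_imp_le[OF lam_pos])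
        then show ?thesis using Wt uv t by (simp add: L_def)
      qed
      ultimately have "(1 - 2 * \<eta>) * L t \<le> (1 - \<eta>) / (1 + \<eta>) * L t" by (rule mult_right_mono)
      moreover have "2 * \<eta> * L t \<le> 2 * \<eta> * (L0 + 1)"
        using elim \<eta> by (intro mult_left_mono) auto
      moreover have "L0 - \<delta> / 2 < L t" using elim by simp
      ultimately show "L0 - \<delta> \<le> (1 - \<eta>) / (1 + \<eta>) * L t"
        using \<eta>2 by (simp add: algebra_simps)
    qed simp
    also have "\<dots> = (\<Sum>p\<in>cell. lam p / t * (\<beta> * exp (- lam p)))"
    proof -
      have "(\<Sum>p\<in>cell. lam p / t * (\<beta> * exp (- lam p))) = \<beta> / t * (\<Sum>p\<in>cell. lam p * exp (- lam p))"
        by (simp add: sum_distrib_left mult_ac)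
      then show ?thesis unfolding cell_sum by (simp add: \<beta>_def L_def mult_ac)
    qed
    also have "\<dots> \<le> (\<Sum>p\<in>cell. lam p / t * N (t - lam p))"
    proof (intro sum_mono mult_left_mono N_ge)
      fix p assume "p \<in> cell"
      then show "0 \<le> lam p / t" using t lam_pos[of p] by (simp add: cell_def less_imp_le)
    qed
    finally show ?case by (simp add: cell_def u_def v_def)
  qed
qed

text \<open>The first stick is discretised to finitely many cells. In each cell it is frozen at the
  left grid point, the induction hypothesis treats the remaining picks, and \<open>cell_mass\<close>
  supplies the weight of the cell. The limit expectation is bounded by the corresponding Riemann
  sum.\<close>

proposition pick_sum_lower:
  assumes \<theta>: "\<theta> > 0" and pm: "((\<lambda>t. prime_mass t / t) \<longlongrightarrow> \<theta>) at_top"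
    and reg: "regular_count \<theta>" and "test_fun K F" "\<epsilon> > 0"
  shows "\<forall>\<^sub>F t in at_top. N t * (gem_exp \<theta> K F - \<epsilon>) \<le> pick_sum K t F"
  using assms(4,5)
proof (induction K arbitrary: F \<epsilon>)
  case 0
  interpret prob_space uniform_sequence by (rule prob_space_uniform_sequence)
  have "gem \<theta> 0 u = (\<lambda>_. 0)" for u by (simp add: gem_def fun_eq_iff)
  then have "gem_exp \<theta> 0 F = F (\<lambda>_. 0)" by (simp add: gem_exp_def prob_space)
  then show ?case using 0 by (simp add: mult_left_mono)
next
  case (Suc K)
  note F = Suc.prems(1)
  note [measurable] = test_fun_measurable[OF F]
  obtain W :: "real \<Rightarrow> real" and i :: nat and c where c: "c > 0"
    and W: "\<And>s t. 0 < s \<Longrightarrow> s \<le> t \<Longrightarrow> 0 < W s \<and> W s \<le> W t"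
    and N_lim: "((\<lambda>t. exp (- t) * N t * t ^ i / W t) \<longlongrightarrow> c) at_top"
    and W_lim: "\<And>u. 0 < u \<Longrightarrow> u \<le> 1 \<Longrightarrow> ((\<lambda>t. W (u * t) / W t) \<longlongrightarrow> u powr (\<theta> - 1 + real i)) at_top"
    using reg unfolding regular_count_def by blast
  obtain B0 where B0: "\<And>x. x \<in> unit_cube \<Longrightarrow> 0 \<le> F x \<and> F x \<le> B0" 
    using F unfolding test_fun_def by blast
  define B where "B = max 1 B0"
  have B: "B \<ge> 1" "\<And>x. x \<in> unit_cube \<Longrightarrow> 0 \<le> F x \<and> F x \<le> B" "\<And>x. x \<in> unit_cube \<Longrightarrow> \<bar>F x\<bar> \<le> B"
    using B0 by (force simp: B_def)+
  \<comment> \<open>The final loss is at most \<open>2 * \<delta> * E + 6 * \<delta>\<close>; as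
    \<open>E \<le> B\<close> and \<open>1 \<le> B\<close>, this is at most
    \<open>8 * \<delta> * B\<close>.\<close>
  define \<delta> where "\<delta> = min (1 / 2) (\<epsilon> / (8 * B))"
  have \<delta>: "\<delta> > 0" using Suc.prems(2) B(1) by (simp add: \<delta>_def)
  have \<delta>_half: "\<delta> \<le> 1 / 2" unfolding \<delta>_def by (rule min.cobounded1)
  have "\<delta> \<le> \<epsilon> / (8 * B)" unfolding \<delta>_def by (rule min.cobounded2)
  then have \<delta>_B: "8 * \<delta> * B \<le> \<epsilon>" using B(1) by (simp add: pos_le_divide_eq mult_ac)
  obtain C where C: "C \<ge> 0" "\<And>x x' y. \<lbrakk>0 \<le> x; x \<le> 1; 0 \<le> x'; x' \<le> 1; y \<in> unit_cube\<rbrakk> \<Longrightarrow>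
      \<bar>F (scons x y) - F (scons x' y)\<bar> \<le> \<delta> + C * \<bar>x - x'\<bar>"
    using test_fun_scons_close[OF F \<delta>] by blast
  \<comment> \<open>One choice of \<open>r\<close> meets two demands: the weight of a cell is nearly
    exact, and moving the first stick within a cell changes \<open>F\<close> little.\<close>
  have "min \<delta> (\<delta> / (C + 1)) > 0" using \<delta> C(1) by simp
  from grid_ratio[OF \<theta> this, of i] obtain r where r: "0 < r" "r < 1" "1 - r < \<delta> / (C + 1)"
    and "(1 - min \<delta> (\<delta> / (C + 1))) * (1 - r powr \<theta>) \<le> \<theta> * (1 - r) * r powr (\<theta> - 1 + real i)" by auto
  have rth: "r powr \<theta> < 1" using r \<theta> powr_less_mono2[of \<theta> r 1] by simp
  have r_ratio: "(1 - \<delta>) * (1 - r powr \<theta>) \<le> \<theta> * (1 - r) * r powr (\<theta> - 1 + real i)"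
  proof -
    have "(1 - \<delta>) * (1 - r powr \<theta>) \<le> (1 - min \<delta> (\<delta> / (C + 1))) * (1 - r powr \<theta>)"
      using rth by (intro mult_right_mono) auto
    then show ?thesis using \<open>(1 - min \<delta> (\<delta> / (C + 1))) * (1 - r powr \<theta>) \<le> _\<close> by linarith
  qed
  have C_small: "C * (1 - r) \<le> \<delta>"
  proof -
    have "(C + 1) * (1 - r) \<le> \<delta>" using r(3) C(1) by (simp add: pos_less_divide_eq mult.commute)
    then show ?thesis using r by (simp add: algebra_simps)
  qed
  \<comment> \<open>For \<open>s = a j\<close> the first stick
    \<open>1 - s powr (1 / \<theta>)\<close> is the grid point \<open>1 - r ^ j\<close>. A uniform
    \<open>s\<close> in the interval from \<open>a (Suc j)\<close> to \<open>a j\<close> thus breaks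
    the stick in cell \<open>j\<close>.\<close>
  define a where "a = (\<lambda>j::nat. r powr (\<theta> * real j))"
  have a01: "0 < a j" "a j \<le> 1" for j
    using r \<theta> by (auto simp: a_def powr_le1)
  have a_Suc: "a (Suc j) = a j * r powr \<theta>" for j
    by (simp add: a_def powr_add[symmetric] algebra_simps)
  have a_dec: "a (Suc j) < a j" for j
    unfolding a_Suc using a01[of j] rth by simp
  have a_alt: "a j = (r powr \<theta>) ^ j" for j
    using r by (simp add: a_def powr_powr[symmetric] powr_realpow)
  have "(\<lambda>j. (r powr \<theta>) ^ j) \<longlonglongrightarrow> 0" using rth by (intro LIMSEQ_realpow_zero) auto
  then have "(\<lambda>j. B * a j) \<longlonglongrightarrow> B * 0" unfolding a_alt by (intro tendsto_mult tendsto_const)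
  then have "\<forall>\<^sub>F j in sequentially. B * a j < \<delta>" using \<delta> by (intro order_tendstoD(2)) auto
  then obtain J where J: "B * a J < \<delta>" by (auto simp: eventually_sequentially)
  \<comment> \<open>On a geometric grid all cells lose the same factor, which tends to 1 with \<open>r\<close>.\<close>
  define x where "x = (\<lambda>j. 1 - r ^ j)"
  have x01: "0 \<le> x j" "x j \<le> 1" for j using r by (auto simp: x_def power_le_one)
  have x_close: "C * \<bar>y - x j\<bar> \<le> \<delta>" if "x j \<le> y" "y \<le> x (Suc j)" for j y
  proof -
    have "\<bar>y - x j\<bar> \<le> r ^ j * (1 - r)" using that by (simp add: x_def algebra_simps)
    also have "\<dots> \<le> 1 * (1 - r)" using r by (intro mult_right_mono power_le_one) auto
    finally have "C * \<bar>y - x j\<bar> \<le> C * (1 - r)" using C(1) by (intro mult_left_mono) auto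
    then show ?thesis using C_small by linarith
  qed
  have F_close: "\<bar>F (scons y z) - F (scons (x j) z)\<bar> \<le> 2 * \<delta>"
    if "x j \<le> y" "y \<le> x (Suc j)" "z \<in> unit_cube" for j y z
    using C(2)[of y "x j" z] x_close[OF that(1,2)] x01[of j] x01[of "Suc j"] that by linarith
  \<comment> \<open>The limit expectation given that the first stick equals
    \<open>x j\<close>.\<close>
  define e where "e = (\<lambda>j. gem_exp \<theta> K (\<lambda>y. F (scons (x j) y)))"
  define G where "G = (\<lambda>j y. max 0 (F (scons (x j) y) - 2 * \<delta>))"
  define E where "E = gem_exp \<theta> (Suc K) F"
  have bound: "\<bar>F (scons y z)\<bar> \<le> B" if "0 \<le> y" "y \<le> 1" "z \<in> unit_cube" for y z
    using B(3)[OF scons_in_unit_cube[OF that]] .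
  \<comment> \<open>The summand \<delta> pays for first sticks beyond \<open>x J\<close>: they have
    probability \<open>a J\<close>, and \<open>F\<close> is at most \<open>B\<close>.\<close>
  have E_le: "E \<le> \<delta> + (\<Sum>j<J. (a j - a (Suc j)) * (e j + 2 * \<delta>))"
  proof -
    interpret U: prob_space uniform01 by (rule prob_space_uniform01)
    define h where "h = (\<lambda>s. gem_exp \<theta> K (\<lambda>y. F (scons (1 - s powr (1 / \<theta>)) y)))"
    define I where "I = (\<lambda>j. {a (Suc j)<..a j} \<inter> {0<..<1})"
    define I0 where "I0 = {0<..a J} \<inter> {0<..<1}"
    have sets: "I j \<in> sets uniform01" "I0 \<in> sets uniform01" for j
      by (auto simp: I_def I0_def uniform01_def sets_restrict_space_iff)
    have h_le: "h s \<le> B * indicator I0 s + (\<Sum>j<J. (e j + 2 * \<delta>) * indicator (I j) s)" if s: "s \<in> space uniform01" for s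
    proof -
      have s01: "0 < s" "s < 1" using s by (auto simp: space_uniform01)
      define y where "y = 1 - s powr (1 / \<theta>)"
      have y01: "0 \<le> y" "y \<le> 1" using s01 \<theta> by (auto simp: y_def powr_le1)
      have e_nonneg: "0 \<le> e j + 2 * \<delta>" for j
      proof -
        have "0 \<le> e j" unfolding e_def gem_exp_def
          by (intro integral_nonneg_AE AE_I2) (use B(2) scons_in_unit_cube x01 gem_in_unit_cube[OF \<theta>] in auto)
        then show ?thesis using \<delta> by simp
      qed
      have others: "0 \<le> (\<Sum>j\<in>A. (e j + 2 * \<delta>) * indicator (I j) s)" for A
        by (intro sum_nonneg mult_nonneg_nonneg e_nonneg) auto
      show ?thesis
      proof (cases "s \<le> a J")
        case True
        then have "indicator I0 s = (1::real)" using s01 by (simp add: I0_def)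
        moreover have "h s \<le> B"
          unfolding h_def y_def[symmetric] by (intro gem_exp_le \<theta> bound y01) measurable
        ultimately show ?thesis using others[of "{..<J}"] by simp
      next
        case False
        then have ex: "a J < s" by simp
        \<comment> \<open>The first grid value below \<open>s\<close>; it is not
          \<open>a 0 = 1\<close>, and its predecessor is the index of the cell.\<close>
        define k where "k = (LEAST k. a k < s)"
        have k: "a k < s" unfolding k_def using ex by (rule LeastI)
        have kJ: "k \<le> J" unfolding k_def using ex by (rule Least_le)
        have "k \<noteq> 0" using k s01 r by (cases k) (auto simp: a_def)
        then obtain j where j: "k = Suc j" by (cases k) auto
        have "\<not> a j < s" using not_less_Least[of j "\<lambda>k. a k < s"] j by (simp add: k_def[symmetric])
        then have sj: "a (Suc j) < s" "s \<le> a j" using k j by auto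
        have ap: "a j powr (1 / \<theta>) = r ^ j" for j
          using \<theta> r by (simp add: a_def powr_powr powr_realpow)
        have "r ^ Suc j \<le> s powr (1 / \<theta>)" "s powr (1 / \<theta>) \<le> r ^ j"
          unfolding ap[symmetric] using sj \<theta> a01[of "Suc j"] s01 by (simp_all add: powr_mono2)
        then have y: "x j \<le> y" "y \<le> x (Suc j)" by (auto simp: y_def x_def)
        have "h s \<le> e j + 2 * \<delta>"
          unfolding h_def e_def y_def[symmetric]
        proof (rule gem_exp_mono[OF \<theta>])
          fix z :: "nat \<Rightarrow> real" assume z: "z \<in> unit_cube"
          show "\<bar>F (scons y z)\<bar> \<le> B" "\<bar>F (scons (x j) z)\<bar> \<le> B" using bound y01 x01 z by auto
          show "F (scons y z) \<le> F (scons (x j) z) + 2 * \<delta>" using F_close[OF y z] by linarith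
        qed measurable
        also have "\<dots> = (\<Sum>j\<in>{j}. (e j + 2 * \<delta>) * indicator (I j) s)"
          using sj s01 by (simp add: I_def)
        also have "\<dots> \<le> (\<Sum>j<J. (e j + 2 * \<delta>) * indicator (I j) s)"
          using kJ j e_nonneg by (intro sum_mono2) auto
        finally show ?thesis using B(1) by (simp add: indicator_def)
      qed
    qed
    have i0: "integrable uniform01 (\<lambda>s. B * indicator I0 s)"
      and ij: "integrable uniform01 (\<lambda>s. (e j + 2 * \<delta>) * indicator (I j) s)" for j
      using sets by (auto intro!: integrable_mult_right integrable_real_indicator simp: U.emeasure_eq_measure)
    have "E = (\<integral>s. h s \<partial>uniform01)"
      unfolding E_def h_def by (rule gem_exp_Suc(1)[OF \<theta> _ B(3)]) measurable
    also have "(\<integral>s. h s \<partial>uniform01) \<le> (\<integral>s. B * indicator I0 s + (\<Sum>j<J. (e j + 2 * \<delta>) * indicator (I j) s) \<partial>uniform01)"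
    proof (rule integral_mono)
      show "integrable uniform01 h"
        unfolding h_def by (rule gem_exp_Suc(2)[OF \<theta> _ B(3)]) measurable
      show "integrable uniform01 (\<lambda>s. B * indicator I0 s + (\<Sum>j<J. (e j + 2 * \<delta>) * indicator (I j) s))"
        by (intro Bochner_Integration.integrable_add Bochner_Integration.integrable_sum i0 ij)
    qed (rule h_le)
    also have "\<dots> = B * measure uniform01 I0 + (\<Sum>j<J. (e j + 2 * \<delta>) * measure uniform01 (I j))"
      unfolding Bochner_Integration.integral_add[OF i0 Bochner_Integration.integrable_sum[OF ij]]
        Bochner_Integration.integral_sum[OF ij]
      using sets by simp
    also have "measure uniform01 I0 = a J" 
      unfolding I0_def using a01[of J] by (subst measure_uniform01) auto
    also have "(\<Sum>j<J. (e j + 2 * \<delta>) * measure uniform01 (I j)) = (\<Sum>j<J. (a j - a (Suc j)) * (e j + 2 * \<delta>))"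
      unfolding I_def using a01 a_dec by (intro sum.cong refl, subst measure_uniform01) (auto simp: less_imp_le mult.commute)
    finally show ?thesis using J by linarith
  qed
  have a_sum: "(\<Sum>j<J. a j - a (Suc j)) \<le> 1"
    using sum_lessThan_telescope'[of a J] a01[of J] r by (simp add: a_def)
  define cell where "cell = (\<lambda>j t. {p \<in> P. (1 - r ^ j) * t < lam p \<and> lam p \<le> (1 - r ^ Suc j) * t})"
  \<comment> \<open>One \<delta> is lost through \<open>r_ratio\<close>, the other through the error
    in \<open>cell_mass\<close>, which is taken proportional to the length of the cell.\<close>
  have ev1: "\<forall>\<^sub>F t in at_top. N t * ((1 - 2 * \<delta>) * (a j - a (Suc j))) \<le> (\<Sum>p\<in>cell j t. lam p / t * N (t - lam p))" for j
  proof -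
    have "\<delta> * (a j - a (Suc j)) > 0" using \<delta> a_dec[of j] by simp
    then have "\<forall>\<^sub>F t in at_top. N t * (\<theta> * (1 - r) * r powr (\<theta> - 1 + real i) * r powr (\<theta> * real j) - \<delta> * (a j - a (Suc j)))
      \<le> (\<Sum>p | p \<in> P \<and> (1 - r ^ j) * t < lam p \<and> lam p \<le> (1 - r ^ Suc j) * t. lam p / t * N (t - lam p))"
      by (intro cell_mass[OF \<theta> pm c _ N_lim _ r(1,2)] W W_lim)
    then show ?thesis
    proof eventually_elim
      case (elim t)
      have "(1 - 2 * \<delta>) * (a j - a (Suc j)) = (1 - \<delta>) * (1 - r powr \<theta>) * a j - \<delta> * (a j - a (Suc j))"
        by (simp add: a_Suc algebra_simps)
      also have "\<dots> \<le> \<theta> * (1 - r) * r powr (\<theta> - 1 + real i) * a j - \<delta> * (a j - a (Suc j))"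
        using r_ratio a01[of j] by (intro diff_right_mono mult_right_mono) auto
      finally have "N t * ((1 - 2 * \<delta>) * (a j - a (Suc j))) \<le> N t * (\<theta> * (1 - r) * r powr (\<theta> - 1 + real i) * a j - \<delta> * (a j - a (Suc j)))"
        by (rule mult_left_mono) simp
      then show ?case using elim by (simp add: cell_def a_def)
    qed
  qed
  \<comment> \<open>Of the \<open>3 * \<delta>\<close>, two compensate the subtraction in
    \<open>G\<close> and one is the error of the induction hypothesis. The bound is needed at the
    scales of all cofactors in the cell, hence for every \<open>s\<close> from
    \<open>r ^ Suc j * t\<close> on.\<close>
  have ev2: "\<forall>\<^sub>F t in at_top. \<forall>s\<ge>r ^ Suc j * t. N s * (e j - 3 * \<delta>) \<le> pick_sum K s (G j)" for j
  proof -
    have tf: "test_fun K (G j)"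
      unfolding G_def using \<delta> x01 by (intro test_fun_scons[OF F]) auto
    have "e j \<le> gem_exp \<theta> K (G j) + 2 * \<delta>"
      unfolding e_def
    proof (rule gem_exp_mono[OF \<theta>])
      fix z :: "nat \<Rightarrow> real" assume z: "z \<in> unit_cube"
      show "\<bar>F (scons (x j) z)\<bar> \<le> B" "\<bar>G j z\<bar> \<le> B" "F (scons (x j) z) \<le> G j z + 2 * \<delta>"
        using bound[OF x01 z, of j] \<delta> by (auto simp: G_def max_def)
    qed (measurable, use test_fun_measurable[OF tf] in simp)
    then have le: "e j - 3 * \<delta> \<le> gem_exp \<theta> K (G j) - \<delta>" by simp
    obtain t0 where t0: "\<And>s. s \<ge> t0 \<Longrightarrow> N s * (gem_exp \<theta> K (G j) - \<delta>) \<le> pick_sum K s (G j)"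
      using Suc.IH[OF tf \<delta>] by (auto simp: eventually_at_top_linorder)
    have "\<forall>\<^sub>F t in at_top. r ^ Suc j * t \<ge> t0" using r by real_asymp
    then show ?thesis
    proof eventually_elim
      case (elim t)
      show ?case
      proof (intro allI impI)
        fix s assume "r ^ Suc j * t \<le> s"
        then have "N s * (gem_exp \<theta> K (G j) - \<delta>) \<le> pick_sum K s (G j)" using elim by (intro t0) simp
        moreover have "N s * (e j - 3 * \<delta>) \<le> N s * (gem_exp \<theta> K (G j) - \<delta>)"
          using le by (rule mult_left_mono) simp
        ultimately show "N s * (e j - 3 * \<delta>) \<le> pick_sum K s (G j)" by linarith
      qed
    qed
  qed
  have "\<forall>\<^sub>F t in at_top. \<forall>j\<in>{..<J}. N t * ((1 - 2 * \<delta>) * (a j - a (Suc j))) \<le> (\<Sum>p\<in>cell j t. lam p / t * N (t - lam p))"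
    using ev1 by (intro eventually_ball_finite) auto
  moreover have "\<forall>\<^sub>F t in at_top. \<forall>j\<in>{..<J}. \<forall>s\<ge>r ^ Suc j * t. N s * (e j - 3 * \<delta>) \<le> pick_sum K s (G j)"
    using ev2 by (intro eventually_ball_finite) auto
  ultimately show ?case using eventually_gt_at_top[of 0]
  proof eventually_elim
    case (elim t)
    define T where "T = (\<lambda>p. lam p / t * pick_sum K (t - lam p) (\<lambda>y. F (scons (lam p / t) y)))"
    have frac: "0 \<le> lam p / t" "lam p / t \<le> 1" if "p \<in> P" "lam p < t" for p
      using that elim(3) lam_pos[of p] by auto
    have T_nonneg: "0 \<le> T p" if "p \<in> P" "lam p < t" for p
      unfolding T_def using frac[OF that] B(2) scons_in_unit_cube by (intro mult_nonneg_nonneg pick_sum_nonneg) auto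
    have cell_sub: "cell j t \<subseteq> {p \<in> P. lam p < t}" for j
    proof
      fix p assume p: "p \<in> cell j t"
      have "(1 - r ^ Suc j) * t < 1 * t" using r elim(3) by (intro mult_strict_right_mono) auto
      then show "p \<in> {p \<in> P. lam p < t}" using p by (auto simp: cell_def)
    qed
    have fin: "finite (cell j t)" for j by (rule finite_subset[OF cell_sub]) simp
    have cell_ge: "N t * ((1 - 2 * \<delta>) * (a j - a (Suc j)) * (e j - 3 * \<delta>)) \<le> (\<Sum>p\<in>cell j t. T p)" if j: "j < J" for j
    proof -
      \<comment> \<open>\<open>e j - 3 * \<delta>\<close> may be negative, and a lower bound for the
        weight of a cell can only be multiplied by something nonnegative.\<close>
      define f where "f = max 0 (e j - 3 * \<delta>)"
      have "N t * ((1 - 2 * \<delta>) * (a j - a (Suc j)) * (e j - 3 * \<delta>)) \<le> N t * ((1 - 2 * \<delta>) * (a j - a (Suc j)) * f)"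
        using \<delta>_half a_dec[of j] by (intro mult_left_mono) (auto simp: f_def)
      also have "\<dots> = N t * ((1 - 2 * \<delta>) * (a j - a (Suc j))) * f" by simp
      also have "\<dots> \<le> (\<Sum>p\<in>cell j t. lam p / t * N (t - lam p)) * f"
        using elim(1) j by (intro mult_right_mono) (auto simp: f_def)
      also have "\<dots> = (\<Sum>p\<in>cell j t. lam p / t * (N (t - lam p) * f))"
        by (simp only: sum_distrib_right mult.assoc)
      also have "\<dots> \<le> (\<Sum>p\<in>cell j t. T p)"
      proof (rule sum_mono)
        fix p assume p: "p \<in> cell j t"
        then have pP: "p \<in> P" "lam p < t" using cell_sub by auto
        have "x j \<le> lam p / t" "lam p / t \<le> x (Suc j)"
          using p elim(3) by (auto simp: cell_def x_def pos_le_divide_eq pos_divide_le_eq)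
        note close = F_close[OF this]
        have "pick_sum K (t - lam p) (G j) \<le> pick_sum K (t - lam p) (\<lambda>y. F (scons (lam p / t) y))"
        proof (rule pick_sum_mono)
          fix z :: "nat \<Rightarrow> real" assume z: "z \<in> unit_cube"
          show "G j z \<le> F (scons (lam p / t) z)"
            using close[OF z] B(2)[OF scons_in_unit_cube[OF frac[OF pP] z]] by (auto simp: G_def)
        qed
        moreover have "0 \<le> pick_sum K (t - lam p) (G j)"
          by (rule pick_sum_nonneg) (simp add: G_def)
        moreover have "N (t - lam p) * (e j - 3 * \<delta>) \<le> pick_sum K (t - lam p) (G j)"
          using elim(2) j p by (auto simp: cell_def algebra_simps)
        ultimately have "N (t - lam p) * f \<le> pick_sum K (t - lam p) (\<lambda>y. F (scons (lam p / t) y))"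
          by (auto simp: f_def max_def)
        then show "lam p / t * (N (t - lam p) * f) \<le> T p"
          unfolding T_def using frac[OF pP] by (intro mult_left_mono)
      qed
      finally show ?thesis .
    qed
    have disj: "cell j t \<inter> cell k t = {}" if "j < k" for j k
    proof -
      have "r ^ k \<le> r ^ Suc j" using that r by (intro power_decreasing) auto
      then have "(1 - r ^ Suc j) * t \<le> (1 - r ^ k) * t" using elim(3) by (intro mult_right_mono) auto
      then show ?thesis by (auto simp: cell_def)
    qed
    \<comment> \<open>Passing from \<open>+ 2 * \<delta>\<close> to \<open>- 3 * \<delta>\<close>
      costs five \<delta>, since the cells have total length at most 1; the sixth comes from
      \<open>E_le\<close>.\<close>
    have "(\<Sum>j<J. (a j - a (Suc j)) * (e j - 3 * \<delta>)) \<ge> E - 6 * \<delta>"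
    proof -
      have "(\<Sum>j<J. (a j - a (Suc j)) * (e j + 2 * \<delta>)) = (\<Sum>j<J. (a j - a (Suc j)) * (e j - 3 * \<delta>)) + 5 * \<delta> * (\<Sum>j<J. a j - a (Suc j))"
        by (simp add: sum_distrib_left sum.distrib[symmetric] algebra_simps)
      moreover have "5 * \<delta> * (\<Sum>j<J. a j - a (Suc j)) \<le> 5 * \<delta> * 1" using a_sum \<delta> by (intro mult_left_mono) auto
      ultimately show ?thesis using E_le by linarith
    qed
    then have "(1 - 2 * \<delta>) * (E - 6 * \<delta>) \<le> (1 - 2 * \<delta>) * (\<Sum>j<J. (a j - a (Suc j)) * (e j - 3 * \<delta>))"
      using \<delta>_half by (intro mult_left_mono) auto
    moreover have "E - \<epsilon> \<le> (1 - 2 * \<delta>) * (E - 6 * \<delta>)"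
    proof -
      have "E \<le> B" unfolding E_def by (rule gem_exp_le[OF \<theta> _ B(3)]) measurable
      then have "2 * \<delta> * E \<le> 2 * \<delta> * B" using \<delta> by (intro mult_left_mono) auto
      moreover have "6 * \<delta> * 1 \<le> 6 * \<delta> * B" using \<delta> B(1) by (intro mult_left_mono) auto
      moreover have "0 \<le> 12 * (\<delta> * \<delta>)" by simp
      moreover have "(1 - 2 * \<delta>) * (E - 6 * \<delta>) = E - 6 * \<delta> - 2 * \<delta> * E + 12 * (\<delta> * \<delta>)"
        by (simp add: algebra_simps)
      ultimately show ?thesis using \<delta>_B by linarith
    qed
    ultimately have "E - \<epsilon> \<le> (1 - 2 * \<delta>) * (\<Sum>j<J. (a j - a (Suc j)) * (e j - 3 * \<delta>))" by linarith
    then have "N t * (E - \<epsilon>) \<le> N t * ((1 - 2 * \<delta>) * (\<Sum>j<J. (a j - a (Suc j)) * (e j - 3 * \<delta>)))"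
      by (rule mult_left_mono) simp
    also have "\<dots> = (\<Sum>j<J. N t * ((1 - 2 * \<delta>) * (a j - a (Suc j)) * (e j - 3 * \<delta>)))"
      by (simp add: sum_distrib_left mult_ac)
    also have "\<dots> \<le> (\<Sum>j<J. \<Sum>p\<in>cell j t. T p)"
      by (intro sum_mono cell_ge) auto
    also have "\<dots> = (\<Sum>p\<in>(\<Union>j<J. cell j t). T p)"
      using fin disj by (intro sum.UNION_disjoint[symmetric]) (auto, metis disjoint_iff linorder_neqE_nat)
    also have "\<dots> \<le> (\<Sum>p | p \<in> P \<and> lam p < t. T p)"
      using cell_sub T_nonneg by (intro sum_mono2 finite_primes_below) blast+
    also have "\<dots> = pick_sum (Suc K) t F" by (simp add: T_def)
    finally show ?case by (simp add: E_def)
  qed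
qed

end


subsection \<open>Sorting sequences\<close>

definition clip :: "real \<Rightarrow> real" where
  "clip a = max 0 (min 1 a)"

text \<open>The \<open>i\<close>-th largest entry, counted from 0. Clipping makes the supremum bounded on all
  sequences, so that no junk value arises outside of the unit cube.\<close>

definition top_entry :: "(nat \<Rightarrow> real) \<Rightarrow> nat \<Rightarrow> real" where
  "top_entry x i = (SUP J\<in>{J. finite J \<and> card J = Suc i}. MIN j\<in>J. clip (x j))"

lemma clip_bounds: "0 \<le> clip a" "clip a \<le> 1"
  by (auto simp: clip_def)

lemma clip_unit_cube: "x \<in> unit_cube \<Longrightarrow> clip (x i) = x i"
  by (auto simp: clip_def unit_cube_def)

lemma Min_clip_bounds:
  assumes "finite J" "card J = Suc i"
  shows "0 \<le> (MIN j\<in>J. clip (x j))" "(MIN j\<in>J. clip (x j)) \<le> 1"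
proof -
  have ne: "finite ((\<lambda>j. clip (x j)) ` J)" "(\<lambda>j. clip (x j)) ` J \<noteq> {}" using assms by auto
  then show "0 \<le> (MIN j\<in>J. clip (x j))" by (simp add: clip_bounds)
  have "(MIN j\<in>J. clip (x j)) \<in> (\<lambda>j. clip (x j)) ` J" using ne by (rule Min_in)
  then show "(MIN j\<in>J. clip (x j)) \<le> 1" using clip_bounds by auto
qed

lemma index_sets_nonempty: "{J :: nat set. finite J \<and> card J = Suc i} \<noteq> {}"
  using finite_atMost[of i] card_atMost[of i] by blast

lemma bdd_above_top_entry:
  "bdd_above ((\<lambda>J. MIN j\<in>J. clip (x j)) ` {J. finite J \<and> card J = Suc i})"
  by (rule bdd_aboveI[of _ 1]) (auto intro: Min_clip_bounds)

lemma top_entry_gt_iff: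
  "top_entry x i > t \<longleftrightarrow> (\<exists>J. finite J \<and> card J = Suc i \<and> (\<forall>j\<in>J. clip (x j) > t))"
proof -
  have "top_entry x i > t \<longleftrightarrow> (\<exists>J\<in>{J. finite J \<and> card J = Suc i}. t < (MIN j\<in>J. clip (x j)))"
    unfolding top_entry_def by (rule less_cSUP_iff[OF index_sets_nonempty bdd_above_top_entry])
  also have "\<dots> \<longleftrightarrow> (\<exists>J. finite J \<and> card J = Suc i \<and> (\<forall>j\<in>J. clip (x j) > t))"
  proof -
    have "t < (MIN j\<in>J. clip (x j)) \<longleftrightarrow> (\<forall>j\<in>J. clip (x j) > t)" if "finite J" "card J = Suc i" for J
      using that by (subst Min_gr_iff) auto
    then show ?thesis by auto
  qed
  finally show ?thesis .
qed

lemma top_entry_bounds: "0 \<le> top_entry x i" "top_entry x i \<le> 1"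
proof -
  show "top_entry x i \<le> 1"
    unfolding top_entry_def by (rule cSUP_least[OF index_sets_nonempty]) (auto intro: Min_clip_bounds)
  have "0 \<le> (MIN j\<in>{..i}. clip (x j))" by (rule Min_clip_bounds) auto
  also have "\<dots> \<le> top_entry x i"
    unfolding top_entry_def by (rule cSUP_upper[OF _ bdd_above_top_entry]) auto
  finally show "0 \<le> top_entry x i" .
qed

lemma top_entry_in_unit_cube: "top_entry x \<in> unit_cube"
  by (simp add: unit_cube_def top_entry_bounds)

lemma eq_if_same_lower_bounds: "(\<And>t. t < a \<longleftrightarrow> t < b) \<Longrightarrow> a = (b::real)"
  by (metis less_irrefl linorder_neqE)

lemma measurable_top_entry [measurable]:
  "top_entry \<in> measurable (\<Pi>\<^sub>M i\<in>UNIV. borel) (\<Pi>\<^sub>M i\<in>UNIV. borel)"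
proof (rule measurable_PiM_single')
  fix i :: nat
  let ?M = "(\<Pi>\<^sub>M i\<in>UNIV. borel) :: (nat \<Rightarrow> real) measure"
  show "(\<lambda>x. top_entry x i) \<in> borel_measurable ?M"
    unfolding borel_measurable_iff_greater
  proof
    fix t
    have "{x \<in> space ?M. t < top_entry x i} =
      (\<Union>J\<in>{J. finite J \<and> card J = Suc i}. {x \<in> space ?M. \<forall>j\<in>J. t < clip (x j)})"
      by (auto simp: top_entry_gt_iff)
    also have "\<dots> \<in> sets ?M"
    proof (rule sets.countable_UN'')
      show "countable {J :: nat set. finite J \<and> card J = Suc i}"
        by (rule countable_subset[OF _ countable_Collect_finite]) auto
      show "{x \<in> space ?M. \<forall>j\<in>J. t < clip (x j)} \<in> sets ?M" if "J \<in> {J. finite J \<and> card J = Suc i}" for J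
        using that unfolding clip_def by (intro sets.sets_Collect_finite_All') auto
    qed
    finally show "{x \<in> space ?M. t < top_entry x i} \<in> sets ?M" .
  qed
qed auto

text \<open>If \<open>i + 1\<close> entries of \<open>x\<close> exceed \<open>t\<close>, then the
  entries of \<open>y\<close> at the same indices exceed \<open>t - d\<close>.\<close>

lemma top_entry_close:
  assumes "x \<in> unit_cube" "y \<in> unit_cube" "\<And>j. \<bar>x j - y j\<bar> \<le> d"
  shows "\<bar>top_entry x i - top_entry y i\<bar> \<le> d"
proof -
  have "top_entry x i \<le> top_entry y i + d"
    if xy: "x \<in> unit_cube" "y \<in> unit_cube" "\<And>j. \<bar>x j - y j\<bar> \<le> d" for x y
  proof (rule dense_le)
    fix t assume "t < top_entry x i"
    then obtain J where J: "finite J" "card J = Suc i" "\<forall>j\<in>J. clip (x j) > t"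
      unfolding top_entry_gt_iff by blast
    have "clip (y j) > t - d" if "j \<in> J" for j
      using J(3) that xy(3)[of j] clip_unit_cube[OF xy(1), of j] clip_unit_cube[OF xy(2), of j] by fastforce
    then have "t - d < top_entry y i" unfolding top_entry_gt_iff using J by blast
    then show "t \<le> top_entry y i + d" by simp
  qed
  from this[OF assms] this[OF assms(2,1)] assms(3) show ?thesis
    by (force simp: abs_le_iff abs_minus_commute)
qed

lemma top_entry_descending_sort:
  assumes "is_descending_sort g l" "g \<in> unit_cube"
  shows "l = top_entry g"
proof
  fix i
  show "l i = top_entry g i"
    by (rule eq_if_same_lower_bounds)
      (simp add: is_descending_sort_gt_iff[OF assms(1)] top_entry_gt_iff clip_unit_cube[OF assms(2)])
qed

definition zero_padded :: "real list \<Rightarrow> nat \<Rightarrow> real" where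
  "zero_padded xs i = (if i < length xs then xs ! i else 0)"

text \<open>For a nonnegative threshold the padding never counts, so the order of the list is
  immaterial. Negative thresholds are always exceeded.\<close>

lemma top_entry_zero_padded_gt_iff:
  assumes "0 \<le> t"
  shows "top_entry (zero_padded xs) i > t \<longleftrightarrow> i < size (filter_mset (\<lambda>a. clip a > t) (mset xs))"
proof -
  let ?A = "{j. j < length xs \<and> clip (xs ! j) > t}"
  have A: "?A = {j. clip (zero_padded xs j) > t}"
    using assms by (auto simp: zero_padded_def clip_def split: if_splits)
  have fin: "finite ?A" by simp
  have "size (filter_mset (\<lambda>a. clip a > t) (mset xs)) = card ?A"
    unfolding mset_filter[symmetric] size_mset length_filter_conv_card ..
  moreover have "top_entry (zero_padded xs) i > t \<longleftrightarrow> i < card ?A"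
  proof
    assume "top_entry (zero_padded xs) i > t"
    then obtain J where "card J = Suc i" "J \<subseteq> ?A" unfolding A top_entry_gt_iff by blast
    then show "i < card ?A" using card_mono[OF fin, of J] by simp
  next
    assume "i < card ?A"
    then have "Suc i \<le> card ?A" by simp
    then obtain J where "J \<subseteq> ?A" "card J = Suc i" "finite J"
      by (rule obtain_subset_with_card_n)
    then show "top_entry (zero_padded xs) i > t" unfolding A top_entry_gt_iff by blast
  qed
  ultimately show ?thesis by simp
qed

lemma top_entry_gt_negative: "t < 0 \<Longrightarrow> t < top_entry x i"
  using top_entry_bounds(1)[of x i] by linarith

lemma top_entry_mset_cong:
  assumes "mset xs = mset ys"
  shows "top_entry (zero_padded xs) = top_entry (zero_padded ys)"
proof
  fix i
  show "top_entry (zero_padded xs) i = top_entry (zero_padded ys) i"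
  proof (rule eq_if_same_lower_bounds)
    fix t :: real
    show "t < top_entry (zero_padded xs) i \<longleftrightarrow> t < top_entry (zero_padded ys) i"
      by (cases "0 \<le> t") (simp_all add: top_entry_zero_padded_gt_iff assms top_entry_gt_negative)
  qed
qed

lemma top_entry_sorted:
  assumes "sorted_wrt (\<ge>) xs" "zero_padded xs \<in> unit_cube"
  shows "top_entry (zero_padded xs) = zero_padded xs"
proof
  fix i
  have dec: "zero_padded xs j \<le> zero_padded xs k" if "k \<le> j" for j k
  proof (cases "j < length xs \<and> k < j")
    case True
    then show ?thesis using assms(1) by (simp add: zero_padded_def sorted_wrt_iff_nth_less)
  next
    case False
    have "0 \<le> zero_padded xs k" using assms(2) by (simp add: unit_cube_def)
    then show ?thesis using that False by (cases "j = k") (auto simp: zero_padded_def)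
  qed
  show "top_entry (zero_padded xs) i = zero_padded xs i"
  proof (rule eq_if_same_lower_bounds)
    fix t :: real
    show "t < top_entry (zero_padded xs) i \<longleftrightarrow> t < zero_padded xs i"
    proof
      assume "t < top_entry (zero_padded xs) i"
      then obtain J where J: "finite J" "card J = Suc i" "\<forall>j\<in>J. clip (zero_padded xs j) > t"
        unfolding top_entry_gt_iff by blast
      have "\<not> J \<subseteq> {..<i}" using card_mono[of "{..<i}" J] J(2) by auto
      then obtain j where "j \<in> J" "i \<le> j" by (auto simp: subset_eq not_less)
      then show "t < zero_padded xs i" using J(3) dec[of i j] by (auto simp: clip_unit_cube[OF assms(2)])
    next
      assume t: "t < zero_padded xs i"
      have "finite {..i}" "card {..i} = Suc i" by auto
      moreover have "\<forall>j\<in>{..i}. clip (zero_padded xs j) > t"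
        using t dec by (auto simp: clip_unit_cube[OF assms(2)] intro: less_le_trans)
      ultimately show "t < top_entry (zero_padded xs) i" unfolding top_entry_gt_iff by blast
    qed
  qed
qed

section \<open>Continuity and moduli on the unit cube\<close>

lemma unit_cube_compact: "compact unit_cube"
proof -
  have "unit_cube = PiE UNIV (\<lambda>_. {0..1::real})" by (auto simp: unit_cube_def PiE_def Pi_def)
  moreover have "compactin (product_topology (\<lambda>_. euclideanreal) UNIV) (PiE UNIV (\<lambda>_::nat. {0..1::real}))"
    by (simp add: compactin_PiE)
  ultimately show ?thesis by (simp add: euclidean_product_topology)
qed

definition trunc :: "nat \<Rightarrow> (nat \<Rightarrow> real) \<Rightarrow> nat \<Rightarrow> real" where
  "trunc K x i = (if i < K then x i else 0)"

lemma trunc_in_unit_cube: "x \<in> unit_cube \<Longrightarrow> trunc K x \<in> unit_cube"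
  by (auto simp: trunc_def unit_cube_def)

lemma continuous_restrict_UNIV:
  assumes "continuous_map (powertop_real {..<k}) euclideanreal f"
  shows "continuous_on UNIV (\<lambda>x :: nat \<Rightarrow> real. f (restrict x {..<k}))"
proof -
  have "continuous_map (powertop_real UNIV) (powertop_real {..<k}) (\<lambda>x. restrict x {..<k})"
    unfolding continuous_map_componentwise
    by (auto intro: continuous_map_product_projection)
  from continuous_map_compose[OF this assms]
  show ?thesis by (simp add: euclidean_product_topology o_def)
qed

lemma borel_measurable_restrict:
  fixes k :: nat
  assumes "continuous_map (powertop_real {..<k}) euclideanreal f"
  shows "(\<lambda>x. f (restrict x {..<k})) \<in> borel_measurable (\<Pi>\<^sub>M i\<in>UNIV. borel)"
  using borel_measurable_continuous_onI[OF continuous_restrict_UNIV[OF assms]]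
    measurable_cong_sets[OF sets_PiM_equal_borel refl] by blast

text \<open>Compactness gives uniform continuity, which settles small \<open>d\<close>; boundedness
  settles large \<open>d\<close>. The resulting bound is affine in \<open>d\<close>, as
  \<open>test_fun\<close> demands.\<close>

lemma uniform_modulus:
  fixes k :: nat
  assumes cont: "continuous_map (powertop_real {..<k}) euclideanreal f"
    and bdd: "\<And>x. \<bar>f (restrict x {..<k})\<bar> \<le> B" and \<epsilon>: "\<epsilon> > 0"
  obtains C where "C \<ge> 0" "\<And>x y d. \<lbrakk>x \<in> unit_cube; y \<in> unit_cube; \<And>i. \<bar>x i - y i\<bar> \<le> d\<rbrakk> \<Longrightarrow>
     \<bar>f (restrict x {..<k}) - f (restrict y {..<k})\<bar> \<le> \<epsilon> + C * d"
proof -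
  define f' where "f' = (\<lambda>x :: nat \<Rightarrow> real. f (restrict x {..<k}))"
  have "continuous_on unit_cube f'"
    using continuous_restrict_UNIV[OF cont] unfolding f'_def by (rule continuous_on_subset) auto
  then have "uniformly_continuous_on unit_cube f'" using unit_cube_compact by (rule compact_uniformly_continuous)
  then obtain \<delta> where \<delta>: "\<delta> > 0" "\<And>x y. x \<in> unit_cube \<Longrightarrow> y \<in> unit_cube \<Longrightarrow> dist y x < \<delta> \<Longrightarrow> dist (f' y) (f' x) < \<epsilon>"
    unfolding uniformly_continuous_on_def using \<epsilon> by blast
  have "\<forall>\<^sub>F n in sequentially. (1/2::real) ^ n < \<delta> / 2"
    using \<delta>(1) by (intro order_tendstoD(2)[OF LIMSEQ_realpow_zero]) auto
  then obtain n where n: "(1/2::real) ^ n < \<delta> / 2" by (auto simp: eventually_sequentially)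
  \<comment> \<open>The metric on sequences discounts later coordinates: finitely many of them
    contribute at most \<open>2 * (\<delta> / 4)\<close>, the tail less than
    \<open>\<delta> / 2\<close>.\<close>
  have close: "\<bar>f' x - f' y\<bar> \<le> \<epsilon>" if "x \<in> unit_cube" "y \<in> unit_cube" "\<And>i. \<bar>x i - y i\<bar> \<le> \<delta> / 4" for x y
  proof -
    let ?D = "{dist (x (from_nat m)) (y (from_nat m)) |m. m \<le> n}"
    have "dist x y \<le> 2 * Max ?D + (1/2) ^ n" by (rule dist_fun_le_dist_first_terms)
    also have "Max ?D \<le> \<delta> / 4"
      by (rule Max.boundedI) (use that(3) in \<open>auto simp: dist_real_def\<close>)
    finally have "dist x y < \<delta>" using n by simp
    then show ?thesis using \<delta>(2)[OF that(2,1)] by (simp add: dist_real_def less_imp_le)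
  qed
  have B: "B \<ge> 0" using bdd[of undefined] by linarith
  show ?thesis
  \<comment> \<open>For \<open>d\<close> above \<open>\<delta> / 4\<close> the slope makes the
    linear term exceed \<open>2 * B\<close>, the largest possible difference.\<close>
  proof (rule that[of "8 * B / \<delta>"])
    show "8 * B / \<delta> \<ge> 0" using B \<delta>(1) by simp
    fix x y d assume xy: "x \<in> unit_cube" "y \<in> unit_cube" "\<And>i. \<bar>x i - y i\<bar> \<le> d"
    have "0 \<le> d" using xy(3)[of 0] by linarith
    show "\<bar>f (restrict x {..<k}) - f (restrict y {..<k})\<bar> \<le> \<epsilon> + 8 * B / \<delta> * d"
    proof (cases "d \<le> \<delta> / 4")
      case True
      then have "\<bar>f' x - f' y\<bar> \<le> \<epsilon>" using xy(3) by (intro close xy order.trans[OF xy(3)])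
      moreover have "0 \<le> 8 * B / \<delta> * d" using B \<delta>(1) \<open>0 \<le> d\<close> by simp
      ultimately show ?thesis by (simp add: f'_def)
    next
      case False
      have "\<bar>f' x - f' y\<bar> \<le> 2 * B" using bdd[of x] bdd[of y] unfolding f'_def by linarith
      also have "\<dots> = 8 * B / \<delta> * (\<delta> / 4)" using \<delta>(1) by simp
      also have "\<dots> \<le> 8 * B / \<delta> * d" using False B \<delta>(1) by (intro mult_left_mono) auto
      finally show ?thesis using \<epsilon> by (simp add: f'_def)
    qed
  qed
qed


subsection \<open>Convergence for weighted primes\<close>

text \<open>The mean factor by which one break shortens the remainder, equal to
  \<open>\<theta> / (\<theta> + 1)\<close>. Being below 1, it makes the mass not covered by
  \<open>K\<close> sticks decay geometrically.\<close>

lemma mean_stick_less_1: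
  assumes "\<theta> > 0"
  shows "0 \<le> (\<integral>s. s powr (1 / \<theta>) \<partial>uniform01)" "(\<integral>s. s powr (1 / \<theta>) \<partial>uniform01) < 1"
proof -
  interpret U: prob_space uniform01 by (rule prob_space_uniform01)
  have b: "0 \<le> s powr (1 / \<theta>) \<and> s powr (1 / \<theta>) < 1" if "s \<in> space uniform01" for s
    using that assms powr_less_mono2[of "1 / \<theta>" s 1] by (auto simp: space_uniform01)
  have "(\<lambda>s. s powr (1 / \<theta>)) \<in> borel_measurable uniform01"
    unfolding uniform01_def by (rule measurable_restrict_space1) simp
  then have i: "integrable uniform01 (\<lambda>s. s powr (1 / \<theta>))"
    by (intro U.integrable_const_bound[of _ 1] AE_I2) (use b in \<open>auto simp: less_imp_le\<close>)
  show "0 \<le> (\<integral>s. s powr (1 / \<theta>) \<partial>uniform01)"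
    by (rule integral_nonneg_AE) simp
  show "(\<integral>s. s powr (1 / \<theta>) \<partial>uniform01) < 1"
    by (rule U.expectation_less[OF i AE_I2]) (use b in auto)
qed

definition rest :: "nat \<Rightarrow> (nat \<Rightarrow> real) \<Rightarrow> real" where
  "rest K x = 1 - (\<Sum>i<K. x i)"

lemma rest_scons: "rest (Suc K) (scons y z) = (1 - y) * rest K z"
proof -
  have "(\<Sum>i<Suc K. scons y z i) = y + (1 - y) * (\<Sum>i<K. z i)"
    by (simp add: sum.lessThan_Suc_shift sum_distrib_left del: sum.lessThan_Suc)
  then show ?thesis unfolding rest_def by (simp add: algebra_simps)
qed

lemma abs_rest_le: "x \<in> unit_cube \<Longrightarrow> \<bar>rest K x\<bar> \<le> 1 + real K"
proof -
  assume x: "x \<in> unit_cube"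
  have "(\<Sum>i<K. x i) \<le> (\<Sum>i<K. 1)" "0 \<le> (\<Sum>i<K. x i)"
    using x by (auto intro!: sum_mono sum_nonneg simp: unit_cube_def simp del: sum_constant)
  then show ?thesis by (simp add: rest_def)
qed

lemma measurable_rest [measurable]: "rest K \<in> borel_measurable (\<Pi>\<^sub>M i\<in>UNIV. borel)"
  unfolding rest_def by measurable

text \<open>The remainder after \<open>K\<close> breaks is a product of \<open>K\<close> independent
  factors with the same mean.\<close>

lemma gem_exp_rest:
  assumes "\<theta> > 0"
  shows "gem_exp \<theta> K (rest K) = (\<integral>s. s powr (1 / \<theta>) \<partial>uniform01) ^ K"
proof (induction K)
  case 0
  interpret prob_space uniform_sequence by (rule prob_space_uniform_sequence)
  show ?case by (simp add: gem_exp_def rest_def prob_space)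
next
  case (Suc K)
  have "gem_exp \<theta> (Suc K) (rest (Suc K)) =
    (\<integral>s. gem_exp \<theta> K (\<lambda>y. rest (Suc K) (scons (1 - s powr (1 / \<theta>)) y)) \<partial>uniform01)"
    by (rule gem_exp_Suc(1)[OF assms measurable_rest abs_rest_le])
  also have "\<dots> = (\<integral>s. s powr (1 / \<theta>) * gem_exp \<theta> K (rest K) \<partial>uniform01)"
    by (simp add: rest_scons gem_exp_def)
  finally show ?case by (simp add: Suc)
qed

lemma rest_gem: "rest K (gem \<theta> K u) = rest K (stick_breaking \<theta> u)"
  by (simp add: rest_def gem_def)

text \<open>Every later stick is a piece of what the first \<open>K\<close> leave over.\<close>

lemma gem_close_stick_breaking:
  assumes "\<theta> > 0" "u \<in> space uniform_sequence"
  shows "\<bar>gem \<theta> K u i - stick_breaking \<theta> u i\<bar> \<le> rest K (gem \<theta> K u)" "0 \<le> rest K (gem \<theta> K u)"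
proof -
  have sb: "\<And>i. 0 \<le> stick_breaking \<theta> u i" 
    using stick_breaking_in_unit_cube[OF assms] by (simp add: unit_cube_def)
  have le1: "(\<Sum>i<n. stick_breaking \<theta> u i) \<le> 1" for n
    unfolding sum_stick_breaking by (simp add: prod_nonneg)
  show nn: "0 \<le> rest K (gem \<theta> K u)" unfolding rest_gem using le1[of K] by (simp add: rest_def)
  show "\<bar>gem \<theta> K u i - stick_breaking \<theta> u i\<bar> \<le> rest K (gem \<theta> K u)"
  proof (cases "i < K")
    case True
    then show ?thesis using nn by (simp add: gem_def)
  next
    case False
    have "(\<Sum>i<K. stick_breaking \<theta> u i) + stick_breaking \<theta> u i = (\<Sum>i\<in>insert i {..<K}. stick_breaking \<theta> u i)"
      using False by simp
    also have "\<dots> \<le> (\<Sum>i<Suc i. stick_breaking \<theta> u i)"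
      using False sb by (intro sum_mono2) auto
    also have "\<dots> \<le> 1" by (rule le1)
    finally show ?thesis using False sb[of i] unfolding rest_gem by (simp add: gem_def rest_def)
  qed
qed

lemma integral_PD:
  assumes "\<theta> > 0" "g \<in> borel_measurable (\<Pi>\<^sub>M i\<in>UNIV. borel)"
  shows "(\<integral>x. g x \<partial>PD \<theta>) = (\<integral>u. (g (top_entry (stick_breaking \<theta> u)) :: real) \<partial>uniform_sequence)"
proof -
  have "(\<integral>x. g x \<partial>PD \<theta>) = (\<integral>u. g ((descending_sort \<circ> stick_breaking \<theta>) u) \<partial>uniform_sequence)"
    unfolding PD_def by (rule integral_distr[OF measurable_descending_sort[OF assms(1)] assms(2)])
  also have "\<dots> = (\<integral>u. g (top_entry (stick_breaking \<theta> u)) \<partial>uniform_sequence)"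
  proof (rule Bochner_Integration.integral_cong[OF refl])
    fix u assume u: "u \<in> space uniform_sequence"
    show "g ((descending_sort \<circ> stick_breaking \<theta>) u) = g (top_entry (stick_breaking \<theta> u))"
      using top_entry_descending_sort[OF is_descending_sort_descending_sort[OF assms(1) u]
        stick_breaking_in_unit_cube[OF assms(1) u]] by simp
  qed
  finally show ?thesis .
qed

context weighted_primes
begin

text \<open>By \<open>top_entry_mset_cong\<close> the choice of the list does not matter.\<close>

definition proc :: "real \<Rightarrow> 'a multiset \<Rightarrow> nat \<Rightarrow> real" where
  "proc t m = top_entry (padded t (SOME ps. mset ps = m))"

lemma padded_eq: "padded t ps = zero_padded (map (\<lambda>p. lam p / t) ps)"
  by (auto simp: padded_def zero_padded_def)

lemma proc_eq:
  assumes "mset ps = m"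
  shows "proc t m = top_entry (padded t ps)"
proof -
  have "mset (SOME ps. mset ps = m) = m" using assms by (rule someI)
  then show ?thesis
    unfolding proc_def padded_eq using assms by (intro top_entry_mset_cong) (metis mset_map)
qed

lemma sum_padded:
  assumes "length ps \<le> K"
  shows "(\<Sum>i<K. padded t ps i) = size_of (mset ps) / t"
proof -
  have "(\<Sum>i<K. padded t ps i) = (\<Sum>i<length ps. lam (ps ! i) / t)"
    using assms by (intro sum.mono_neutral_cong_right) (auto simp: padded_def)
  also have "\<dots> = size_of (mset ps) / t"
    by (simp add: size_of_def sum_mset_sum_list sum_list_sum_nth atLeast0LessThan sum_divide_distrib
        flip: mset_map)
  finally show ?thesis .
qed

lemma padded_in_unit_cube:
  assumes t: "t > 0" and m: "mset ps \<in> upto t"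
  shows "padded t ps \<in> unit_cube"
proof -
  have P: "set ps \<subseteq> P" using m by (auto simp: upto_def)
  have nonneg: "0 \<le> padded t ps i" for i
    using P t lam_pos by (auto simp: padded_def less_imp_le subset_iff)
  have "padded t ps i \<le> 1" for i
  proof (cases "i < length ps")
    case True
    then have "padded t ps i \<le> (\<Sum>i<length ps. padded t ps i)"
      using nonneg by (intro member_le_sum) auto
    also have "\<dots> \<le> 1" using m t by (subst sum_padded) (auto simp: upto_def)
    finally show ?thesis .
  qed (simp add: padded_def)
  with nonneg show ?thesis by (simp add: unit_cube_def)
qed

text \<open>\<open>g\<close> of the sorted sequence is bounded below by a function of
  \<open>K\<close> picks alone, minus a penalty for the unpicked mass. The same penalty, integrated
  over the limit law, is small for large \<open>K\<close>.\<close>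

proposition proc_lower:
  fixes f :: "(nat \<Rightarrow> real) \<Rightarrow> real" and k :: nat
  defines "g \<equiv> \<lambda>x. f (restrict x {..<k})"
  assumes \<theta>: "\<theta> > 0" and pm: "((\<lambda>t. prime_mass t / t) \<longlongrightarrow> \<theta>) at_top"
    and reg: "regular_count \<theta>"
    and cont: "continuous_map (powertop_real {..<k}) euclideanreal f"
    and bdd: "\<And>x. 0 \<le> g x" "\<And>x. g x \<le> B" and \<epsilon>: "\<epsilon> > 0"
  shows "\<forall>\<^sub>F t in at_top. N t * ((\<integral>x. g x \<partial>PD \<theta>) - \<epsilon>) \<le> (\<Sum>m\<in>upto t. g (proc t m))"
proof -
  \<comment> \<open>Three quarters go to the gap between the integral of \<open>g\<close> and
    \<open>gem_exp\<close>, the last to \<open>pick_sum_lower\<close>.\<close>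
  define e where "e = \<epsilon> / 4"
  have e: "e > 0" using \<epsilon> by (simp add: e_def)
  have g[measurable]: "g \<in> borel_measurable (\<Pi>\<^sub>M i\<in>UNIV. borel)"
    unfolding g_def by (rule borel_measurable_restrict[OF cont])
  have modulus: "\<exists>C\<ge>0. \<forall>x\<in>unit_cube. \<forall>y\<in>unit_cube. \<forall>d. (\<forall>i. \<bar>x i - y i\<bar> \<le> d) \<longrightarrow>
     \<bar>g (top_entry x) - g (top_entry y)\<bar> \<le> \<epsilon>' + C * d" if \<epsilon>': "\<epsilon>' > 0" for \<epsilon>'
  proof -
    obtain C where C: "C \<ge> 0" "\<And>x y d. \<lbrakk>x \<in> unit_cube; y \<in> unit_cube; \<And>i. \<bar>x i - y i\<bar> \<le> d\<rbrakk> \<Longrightarrow>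
       \<bar>f (restrict x {..<k}) - f (restrict y {..<k})\<bar> \<le> \<epsilon>' + C * d"
      by (rule uniform_modulus[OF cont _ \<epsilon>', of B]) (use bdd in \<open>auto simp: g_def\<close>)
    show ?thesis
      using C(1) C(2)[OF top_entry_in_unit_cube top_entry_in_unit_cube top_entry_close]
      unfolding g_def by blast
  qed
  obtain C where C: "C \<ge> 0" "\<And>x y d. \<lbrakk>x \<in> unit_cube; y \<in> unit_cube; \<And>i. \<bar>x i - y i\<bar> \<le> d\<rbrakk> \<Longrightarrow>
     \<bar>g (top_entry x) - g (top_entry y)\<bar> \<le> e + C * d"
    using modulus[OF e] by blast
  define \<rho> where "\<rho> = (\<integral>s. s powr (1 / \<theta>) \<partial>uniform01)"
  \<comment> \<open>The penalty occurs twice: inside \<open>F\<close>, and in the passage from the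
    truncated to the full stick-breaking sequence.\<close>
  have "(\<lambda>K. 2 * C * \<rho> ^ K) \<longlonglongrightarrow> 2 * C * 0"
    using mean_stick_less_1[OF \<theta>] by (intro tendsto_mult tendsto_const LIMSEQ_realpow_zero) (auto simp: \<rho>_def)
  then have "\<forall>\<^sub>F K in sequentially. 2 * C * \<rho> ^ K < e" using e by (intro order_tendstoD(2)) auto
  then obtain K where K: "2 * C * \<rho> ^ K < e" by (auto simp: eventually_sequentially)
  \<comment> \<open>The absolute value is taken because on the cube the first \<open>K\<close>
    entries may sum to more than 1. The cut at 0 makes \<open>F\<close> a test function.\<close>
  define F where "F = (\<lambda>x. max 0 (g (top_entry (trunc K x)) - e - C * \<bar>rest K x\<bar>))"
  have [measurable]: "trunc K \<in> measurable (\<Pi>\<^sub>M i\<in>UNIV. borel) (\<Pi>\<^sub>M i\<in>UNIV. borel)"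
  proof (rule measurable_PiM_single')
    fix i show "(\<lambda>x. trunc K x i) \<in> borel_measurable (\<Pi>\<^sub>M i\<in>UNIV. borel)"
      by (cases "i < K") (simp_all add: trunc_def)
  qed auto
  have Fm: "F \<in> borel_measurable (\<Pi>\<^sub>M i\<in>UNIV. borel)"
    unfolding F_def by measurable
  have B0: "B \<ge> 0" using bdd[of undefined] by linarith
  have FB: "0 \<le> F x" "F x \<le> B" for x
  proof -
    show "0 \<le> F x" by (simp add: F_def)
    have "0 \<le> C * \<bar>rest K x\<bar>" using C(1) by simp
    then show "F x \<le> B" using bdd(2)[of "top_entry (trunc K x)"] e B0 unfolding F_def by linarith
  qed
  have tf: "test_fun K F"
    unfolding test_fun_def
  proof (intro conjI allI impI Fm)
    show "\<exists>B. \<forall>x\<in>unit_cube. 0 \<le> F x \<and> F x \<le> B" using FB by blast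
    fix \<epsilon>' :: real assume "\<epsilon>' > 0"
    from modulus[OF this] obtain D where D: "D \<ge> 0" "\<And>x y d. \<lbrakk>x \<in> unit_cube; y \<in> unit_cube; \<And>i. \<bar>x i - y i\<bar> \<le> d\<rbrakk> \<Longrightarrow>
       \<bar>g (top_entry x) - g (top_entry y)\<bar> \<le> \<epsilon>' + D * d"
      by blast
    show "\<exists>C\<ge>0. \<forall>x\<in>unit_cube. \<forall>y\<in>unit_cube. \<bar>F x - F y\<bar> \<le> \<epsilon>' + C * (\<Sum>i<K. \<bar>x i - y i\<bar>)"
    proof (intro exI[of _ "D + C"] conjI ballI)
      show "0 \<le> D + C" using D C by simp
      fix x y :: "nat \<Rightarrow> real" assume xy: "x \<in> unit_cube" "y \<in> unit_cube"
      let ?d = "\<Sum>i<K. \<bar>x i - y i\<bar>"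
      have "\<bar>trunc K x i - trunc K y i\<bar> \<le> ?d" for i
        by (cases "i < K") (auto simp: trunc_def intro!: member_le_sum[of _ _ "\<lambda>i. \<bar>x i - y i\<bar>"] sum_nonneg)
      then have 1: "\<bar>g (top_entry (trunc K x)) - g (top_entry (trunc K y))\<bar> \<le> \<epsilon>' + D * ?d"
        by (intro D trunc_in_unit_cube xy)
      have "\<bar>rest K x - rest K y\<bar> = \<bar>\<Sum>i<K. y i - x i\<bar>"
        by (simp add: rest_def sum_subtractf)
      also have "\<dots> \<le> (\<Sum>i<K. \<bar>y i - x i\<bar>)" by (rule sum_abs)
      also have "\<dots> = ?d" by (simp add: abs_minus_commute)
      finally have "\<bar>\<bar>rest K x\<bar> - \<bar>rest K y\<bar>\<bar> \<le> ?d" by linarith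
      then have "C * \<bar>\<bar>rest K x\<bar> - \<bar>rest K y\<bar>\<bar> \<le> C * ?d" using C(1) by (rule mult_left_mono)
      then have 2: "\<bar>C * \<bar>rest K x\<bar> - C * \<bar>rest K y\<bar>\<bar> \<le> C * ?d"
        using C(1) by (simp add: right_diff_distrib[symmetric] abs_mult)
      show "\<bar>F x - F y\<bar> \<le> \<epsilon>' + (D + C) * ?d"
        using 1 2 unfolding F_def distrib_right by linarith
    qed
  qed
  have lower: "pick_sum K t F \<le> (\<Sum>m\<in>upto t. g (proc t m))" if t: "t > 0" for t
  proof (rule pick_sum_le)
    fix m ps assume m: "m \<in> upto t" and ps: "length ps = K" "mset ps \<subseteq># m"
    obtain qs where qs: "mset qs = m - mset ps" using ex_mset by blast
    have all: "mset (ps @ qs) = m" using ps(2) qs by simp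
    have "set_mset (mset ps) \<subseteq> set_mset m" using ps(2) by (rule set_mset_mono)
    have sz: "size_of m = size_of (mset ps) + size_of (mset qs)" unfolding all[symmetric] by simp
    have "0 \<le> size_of (mset qs)"
      using m qs by (intro size_of_nonneg) (auto simp: upto_def dest: in_diffD)
    then have ps_upto: "mset ps \<in> upto t"
      using m sz \<open>set_mset (mset ps) \<subseteq> set_mset m\<close> by (auto simp: upto_def)
    have c1: "padded t (ps @ qs) \<in> unit_cube" "padded t ps \<in> unit_cube"
      using t m ps_upto by (auto intro!: padded_in_unit_cube simp: all simp del: mset_append)
    have tr: "trunc K (padded t ps) = padded t ps"
      using ps(1) by (auto simp: trunc_def padded_def)
    have rest: "rest K (padded t ps) = 1 - size_of (mset ps) / t"
      using ps(1) by (simp add: rest_def sum_padded)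
    have "size_of (mset ps) / t \<le> 1" using ps_upto t by (simp add: upto_def)
    then have r0: "0 \<le> rest K (padded t ps)" by (simp add: rest)
    \<comment> \<open>An unpicked factor fits into what the picks leave of the normalised size of
      \<open>m\<close>, which is at most 1.\<close>
    have "\<bar>padded t (ps @ qs) i - padded t ps i\<bar> \<le> rest K (padded t ps)" for i
    proof (cases "i < K \<or> i \<ge> length (ps @ qs)")
      case True
      then have "padded t (ps @ qs) i = padded t ps i" using ps(1) by (auto simp: padded_def nth_append)
      then show ?thesis using r0 by simp
    next
      case False
      define n where "n = length (ps @ qs)"
      have "(\<Sum>j<K. padded t ps j) + padded t (ps @ qs) i = (\<Sum>j\<in>insert i {..<K}. padded t (ps @ qs) j)"
        using False ps(1) by (simp add: padded_def nth_append)
      also have "\<dots> \<le> (\<Sum>j<n. padded t (ps @ qs) j)"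
        using False ps(1) c1(1) by (intro sum_mono2) (auto simp: n_def unit_cube_def)
      also have "\<dots> = size_of m / t" unfolding n_def by (subst sum_padded) (simp_all only: all order_refl)
      also have "\<dots> \<le> 1" using m t by (simp add: upto_def)
      finally have "padded t (ps @ qs) i \<le> rest K (padded t ps)" by (simp add: rest_def)
      moreover have "padded t ps i = 0" using False ps(1) by (simp add: padded_def)
      moreover have "0 \<le> padded t (ps @ qs) i" using c1(1) by (simp add: unit_cube_def)
      ultimately show ?thesis by simp
    qed
    then have "\<bar>g (top_entry (padded t (ps @ qs))) - g (top_entry (padded t ps))\<bar> \<le> e + C * rest K (padded t ps)"
      by (intro C c1)
    then have "g (top_entry (padded t ps)) - e - C * \<bar>rest K (padded t ps)\<bar> \<le> g (proc t m)"
      using r0 unfolding proc_eq[OF all] by simp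
    then show "F (padded t ps) \<le> g (proc t m)"
      using bdd(1)[of "proc t m"] by (simp add: F_def tr)
  qed (rule bdd(1))
  have "(\<integral>x. g x \<partial>PD \<theta>) \<le> gem_exp \<theta> K F + 3 * e"
  proof -
    interpret prob_space uniform_sequence by (rule prob_space_uniform_sequence)
    have iF: "integrable uniform_sequence (\<lambda>u. F (gem \<theta> K u))"
      by (rule integrable_gem[OF \<theta> Fm, of B]) (use FB in auto)
    have iR: "integrable uniform_sequence (\<lambda>u. rest K (gem \<theta> K u))"
      by (rule integrable_gem[OF \<theta> measurable_rest abs_rest_le])
    have "(\<integral>x. g x \<partial>PD \<theta>) = (\<integral>u. g (top_entry (stick_breaking \<theta> u)) \<partial>uniform_sequence)"
      by (rule integral_PD[OF \<theta> g])
    also have "\<dots> \<le> (\<integral>u. F (gem \<theta> K u) + 2 * C * rest K (gem \<theta> K u) + 2 * e \<partial>uniform_sequence)"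
    proof (rule integral_mono)
      show "integrable uniform_sequence (\<lambda>u. g (top_entry (stick_breaking \<theta> u)))"
        by (rule integrable_const_bound[of _ B]) (use bdd in auto)
      show "integrable uniform_sequence (\<lambda>u. F (gem \<theta> K u) + 2 * C * rest K (gem \<theta> K u) + 2 * e)"
        using iF iR by simp
      fix u assume u: "u \<in> space uniform_sequence"
      have tr: "trunc K (gem \<theta> K u) = gem \<theta> K u" by (auto simp: trunc_def gem_def)
      have "\<bar>g (top_entry (gem \<theta> K u)) - g (top_entry (stick_breaking \<theta> u))\<bar> \<le> e + C * rest K (gem \<theta> K u)"
        by (intro C gem_in_unit_cube stick_breaking_in_unit_cube gem_close_stick_breaking \<theta> u)
      moreover have "g (top_entry (gem \<theta> K u)) - e - C * rest K (gem \<theta> K u) \<le> F (gem \<theta> K u)"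
        using gem_close_stick_breaking(2)[OF \<theta> u, of K] by (simp add: F_def tr)
      ultimately show "g (top_entry (stick_breaking \<theta> u)) \<le> F (gem \<theta> K u) + 2 * C * rest K (gem \<theta> K u) + 2 * e"
        by linarith
    qed
    also have "\<dots> = gem_exp \<theta> K F + 2 * C * gem_exp \<theta> K (rest K) + 2 * e"
      using iF iR by (simp add: gem_exp_def prob_space)
    also have "\<dots> \<le> gem_exp \<theta> K F + 3 * e"
      using K by (simp add: gem_exp_rest[OF \<theta>] \<rho>_def)
    finally show ?thesis .
  qed
  then have le: "(\<integral>x. g x \<partial>PD \<theta>) - \<epsilon> \<le> gem_exp \<theta> K F - e" by (simp add: e_def)
  from pick_sum_lower[OF \<theta> pm reg tf e] eventually_gt_at_top[of 0]
  show ?thesis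
  proof eventually_elim
    case (elim t)
    have "N t * ((\<integral>x. g x \<partial>PD \<theta>) - \<epsilon>) \<le> N t * (gem_exp \<theta> K F - e)"
      using le by (rule mult_left_mono) simp
    then show ?case using elim(1) lower[OF elim(2)] by linarith
  qed
qed

text \<open>With \<open>B\<close> bounding the absolute value of \<open>f\<close>, both
  \<open>f + B\<close> and \<open>B - f\<close> are nonnegative. The lower bound for the second is
  the upper bound for \<open>f\<close>.\<close>

proposition proc_limit:
  fixes f :: "(nat \<Rightarrow> real) \<Rightarrow> real" and k :: nat
  assumes \<theta>: "\<theta> > 0" and pm: "((\<lambda>t. prime_mass t / t) \<longlongrightarrow> \<theta>) at_top"
    and reg: "regular_count \<theta>"
    and cont: "continuous_map (powertop_real {..<k}) euclideanreal f"
    and bdd: "bounded (f ` topspace (powertop_real {..<k}))"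
  shows "((\<lambda>t. (\<Sum>m\<in>upto t. f (restrict (proc t m) {..<k})) / N t) \<longlongrightarrow>
    (\<integral>x. f (restrict x {..<k}) \<partial>PD \<theta>)) at_top"
proof (rule tendstoI)
  fix \<epsilon> :: real assume \<epsilon>: "\<epsilon> > 0"
  interpret PD: prob_space "PD \<theta>" by (rule prob_space_PD[OF \<theta>])
  obtain B where B: "\<And>x. \<bar>f (restrict x {..<k})\<bar> \<le> B"
    using bdd unfolding bounded_iff by (auto simp: PiE_def)
  define I where "I = (\<integral>x. f (restrict x {..<k}) \<partial>PD \<theta>)"
  have sets_PD: "sets (PD \<theta>) = sets (\<Pi>\<^sub>M i\<in>UNIV. borel)" by (simp add: PD_def)
  have int: "integrable (PD \<theta>) (\<lambda>x. f (restrict x {..<k}))"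
    by (rule PD.integrable_const_bound[of _ B])
      (use B borel_measurable_restrict[OF cont] measurable_cong_sets[OF sets_PD refl] in auto)
  have up: "\<forall>\<^sub>F t in at_top. N t * ((\<integral>x. f (restrict x {..<k}) + B \<partial>PD \<theta>) - \<epsilon> / 2) \<le> (\<Sum>m\<in>upto t. f (restrict (proc t m) {..<k}) + B)"
  proof (rule proc_lower[OF \<theta> pm reg, of k "\<lambda>x. f x + B" "2 * B"])
    show "continuous_map (powertop_real {..<k}) euclideanreal (\<lambda>x. f x + B)"
      using cont by (intro continuous_map_add) auto
    show "0 \<le> f (restrict x {..<k}) + B" "f (restrict x {..<k}) + B \<le> 2 * B" for x
      using B[of x] by (auto simp: abs_le_iff)
  qed (use \<epsilon> in auto)
  have dn: "\<forall>\<^sub>F t in at_top. N t * ((\<integral>x. B - f (restrict x {..<k}) \<partial>PD \<theta>) - \<epsilon> / 2) \<le> (\<Sum>m\<in>upto t. B - f (restrict (proc t m) {..<k}))"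
  proof (rule proc_lower[OF \<theta> pm reg, of k "\<lambda>x. B - f x" "2 * B"])
    show "continuous_map (powertop_real {..<k}) euclideanreal (\<lambda>x. B - f x)"
      using cont by (intro continuous_map_diff) auto
    show "0 \<le> B - f (restrict x {..<k})" "B - f (restrict x {..<k}) \<le> 2 * B" for x
      using B[of x] by (auto simp: abs_le_iff)
  qed (use \<epsilon> in auto)
  have I: "(\<integral>x. f (restrict x {..<k}) + B \<partial>PD \<theta>) = I + B" "(\<integral>x. B - f (restrict x {..<k}) \<partial>PD \<theta>) = B - I"
    using int by (simp_all add: I_def PD.prob_space)
  show "\<forall>\<^sub>F t in at_top. dist ((\<Sum>m\<in>upto t. f (restrict (proc t m) {..<k})) / N t) (\<integral>x. f (restrict x {..<k}) \<partial>PD \<theta>) < \<epsilon>"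
    using up dn eventually_gt_at_top[of 0] unfolding I I_def[symmetric]
  proof eventually_elim
    case (elim t)
    have Np: "N t > 0" using N_ge_1[of t] elim(3) by simp
    define Z where "Z = (\<Sum>m\<in>upto t. f (restrict (proc t m) {..<k}))"
    have "N t * (I + B - \<epsilon> / 2) \<le> Z + N t * B" "N t * (B - I - \<epsilon> / 2) \<le> N t * B - Z"
      using elim by (simp_all add: Z_def N_def sum.distrib sum_subtractf)
    then have "(I - \<epsilon> / 2) * N t \<le> Z" "Z \<le> (I + \<epsilon> / 2) * N t" by (simp_all add: algebra_simps)
    then have "I - \<epsilon> / 2 \<le> Z / N t" "Z / N t \<le> I + \<epsilon> / 2"
      using Np by (simp_all add: pos_le_divide_eq pos_divide_le_eq)
    then show ?case using \<epsilon> by (simp add: dist_real_def Z_def abs_less_iff)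
  qed
qed

end


subsection \<open>Normed arithmetic semigroups\<close>

context normed_arithmetic_semigroup
begin

lemma primes_carrier: "p \<in> primes_of S \<Longrightarrow> p \<in> carrier S"
  by (simp add: primes_of_def)

lemma prime_not_unit: "p \<in> primes_of S \<Longrightarrow> p \<notin> Units S"
  by (simp add: primes_of_def Divisibility.prime_def)

lemma inj_prime_powers:
  assumes "p \<in> primes_of S"
  shows "inj (\<lambda>n::nat. p [^] n)"
proof (rule linorder_injI)
  have pc: "p \<in> carrier S" using assms by (rule primes_carrier)
  fix m n :: nat assume "m < n"
  then obtain k where k: "n = m + Suc k" using less_iff_Suc_add by auto
  show "p [^] m \<noteq> p [^] n"
  proof
    assume "p [^] m = p [^] n"
    then have "p [^] m = p [^] m \<otimes> p [^] Suc k" unfolding nat_pow_mult[OF pc] k .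
    then have "p [^] m \<otimes> \<one> = p [^] m \<otimes> p [^] Suc k"
      by (simp only: r_one[OF nat_pow_closed[OF pc]])
    then have "\<one> = p [^] Suc k" by (rule l_cancel) (use pc in simp_all)
    then have "p [^] k \<otimes> p = \<one>" by simp
    then have "p \<in> Units S" using pc m_comm[of "p [^] k" p] unfolding Units_def by (auto intro!: exI[of _ "p [^] k"])
    then show False using prime_not_unit[OF assms] by simp
  qed
qed

lemma nrm_prime_gt_1:
  assumes "p \<in> primes_of S"
  shows "1 < nrm p"
proof (rule ccontr)
  assume "\<not> 1 < nrm p"
  have pc: "p \<in> carrier S" using assms by (rule primes_carrier)
  have "nrm (p [^] n) \<le> nrm \<one>" for n :: nat
  proof (induction n)
    case (Suc n)
    have "nrm (p [^] n) * nrm p \<le> nrm (p [^] n) * 1"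
      using \<open>\<not> 1 < nrm p\<close> pc nrm_nonneg by (intro mult_left_mono) auto
    then show ?case using Suc pc by (simp add: nrm_mult)
  qed simp
  then have "range (\<lambda>n::nat. p [^] n) \<subseteq> {s \<in> carrier S. nrm s \<le> nrm \<one>}" using pc by auto
  then have "finite (range (\<lambda>n::nat. p [^] n))" using finite_nrm_le finite_subset by blast
  then show False using inj_prime_powers[OF assms] by (simp add: finite_image_iff)
qed

text \<open>Multiplicativity alone leaves 0 and 1 as possible values; a prime, having a positive
  norm, decides.\<close>

lemma nrm_one:
  assumes "primes_of S \<noteq> {}"
  shows "nrm \<one> = 1"
proof -
  obtain p where p: "p \<in> primes_of S" using assms by blast
  have "nrm p = nrm p * nrm \<one>" using nrm_mult[of p \<one>] primes_carrier[OF p] by simp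
  then show ?thesis using nrm_prime_gt_1[OF p] by simp
qed

lemma mset_prime_factors_unique:
  assumes "set ps \<subseteq> primes_of S" "set qs \<subseteq> primes_of S" "foldr (\<otimes>) ps \<one> = foldr (\<otimes>) qs \<one>"
  shows "mset ps = mset qs"
proof -
  have c: "set ps \<subseteq> carrier S" "set qs \<subseteq> carrier S" using assms primes_carrier by auto
  have w: "wfactors S xs (foldr (\<otimes>) xs \<one>)" if "set xs \<subseteq> primes_of S" for xs
  proof -
    have "set xs \<subseteq> carrier S" using that primes_carrier by auto
    then have "foldr (\<otimes>) xs \<one> \<in> carrier S" by (rule multlist_closed)
    moreover have "\<forall>x\<in>set xs. irreducible S x"
      using that prime_irreducible by (auto simp: primes_of_def)
    ultimately show ?thesis by (simp add: wfactors_def)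
  qed
  have "essentially_equal S ps qs"
    using wfactors_unique[OF w[OF assms(1)]] w[OF assms(2)] assms(3) c multlist_closed[OF c(1)] by simp
  then obtain rs where rs: "mset ps = mset rs" "list_all2 (\<sim>\<^bsub>S\<^esub>) rs qs"
    by (auto simp: essentially_equal_def)
  have assoc_eq: "x = y" if "x \<sim> y" "x \<in> carrier S" "y \<in> carrier S" for x y
    using that Units_eq by (metis associatedE2 singletonD r_one)
  have "set rs \<subseteq> carrier S" using c(1) rs(1) by (metis set_mset_mset)
  then have "rs = qs"
    using rs(2) assoc_eq c(2)
    by (auto simp: list_all2_conv_all_nth in_mono intro!: nth_equalityI assoc_eq)
  then show ?thesis using rs(1) by simp
qed

text \<open>Literally the choice made in \<open>L_process\<close>, so that both refer to the same
  list.\<close>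

definition factor_list :: "'a \<Rightarrow> 'a list" where
  "factor_list s = (SOME ps. sorted_prime_factors S nrm s ps)"

definition factor_mset :: "'a \<Rightarrow> 'a multiset" where
  "factor_mset s = mset (factor_list s)"

lemma factor_list:
  assumes "s \<in> carrier S"
  shows "set (factor_list s) \<subseteq> primes_of S" "foldr (\<otimes>) (factor_list s) \<one> = s"
    "sorted_wrt (\<lambda>p q. nrm p \<ge> nrm q) (factor_list s)"
  using someI_ex[OF ex_sorted_prime_factors[OF assms]]
  unfolding factor_list_def sorted_prime_factors_def by auto

lemma bij_factor_mset: "bij_betw factor_mset (carrier S) {m. set_mset m \<subseteq> primes_of S}"
proof (rule bij_betw_imageI)
  show "inj_on factor_mset (carrier S)"
  proof (rule inj_onI)
    fix s t assume st: "s \<in> carrier S" "t \<in> carrier S" "factor_mset s = factor_mset t"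
    have "foldr (\<otimes>) (factor_list s) \<one> = foldr (\<otimes>) (factor_list t) \<one>"
      using st factor_list(1)[OF st(1)] primes_carrier
      by (intro multlist_perm_cong) (auto simp: factor_mset_def)
    then show "s = t" using factor_list(2) st by simp
  qed
  show "factor_mset ` carrier S = {m. set_mset m \<subseteq> primes_of S}"
  proof (intro equalityI subsetI)
    fix m assume "m \<in> factor_mset ` carrier S"
    then show "m \<in> {m. set_mset m \<subseteq> primes_of S}" using factor_list(1) by (fastforce simp: factor_mset_def)
  next
    fix m assume m: "m \<in> {m. set_mset m \<subseteq> primes_of S}"
    obtain ps where ps: "mset ps = m" using ex_mset by blast
    then have sub: "set ps \<subseteq> primes_of S" using m by auto
    define s where "s = foldr (\<otimes>) ps \<one>"
    have s: "s \<in> carrier S" unfolding s_def using sub primes_carrier by (intro multlist_closed) auto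
    have "mset (factor_list s) = mset ps"
      by (rule mset_prime_factors_unique) (use sub factor_list[OF s] s_def in auto)
    then show "m \<in> factor_mset ` carrier S" using s ps by (auto simp: factor_mset_def)
  qed
qed

lemma nrm_foldr:
  assumes "primes_of S \<noteq> {}" "set ps \<subseteq> primes_of S"
  shows "0 < nrm (foldr (\<otimes>) ps \<one>)" "ln (nrm (foldr (\<otimes>) ps \<one>)) = (\<Sum>p\<in>#mset ps. ln (nrm p))"
proof -
  have "0 < nrm (foldr (\<otimes>) ps \<one>) \<and> ln (nrm (foldr (\<otimes>) ps \<one>)) = (\<Sum>p\<in>#mset ps. ln (nrm p))"
    using assms(2)
  proof (induction ps)
    case Nil
    then show ?case by (simp add: nrm_one[OF assms(1)])
  next
    case (Cons p ps)
    have "foldr (\<otimes>) ps \<one> \<in> carrier S" using Cons.prems primes_carrier by (intro multlist_closed) auto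
    moreover have "1 < nrm p" "p \<in> carrier S" using Cons.prems nrm_prime_gt_1 primes_carrier by auto
    ultimately show ?case using Cons by (simp add: nrm_mult ln_mult)
  qed
  then show "0 < nrm (foldr (\<otimes>) ps \<one>)" "ln (nrm (foldr (\<otimes>) ps \<one>)) = (\<Sum>p\<in>#mset ps. ln (nrm p))" by auto
qed

end

section \<open>Transfer to the logarithmic model and conclusion\<close>

locale normed_semigroup_with_primes = normed_arithmetic_semigroup +
  assumes ne: "primes_of S \<noteq> {}"
begin

lemma nrm_le_iff:
  assumes "s \<in> carrier S" "x > 0"
  shows "nrm s \<le> x \<longleftrightarrow> (\<Sum>p\<in>#factor_mset s. ln (nrm p)) \<le> ln x"
proof -
  note fl = factor_list[OF assms(1)]
  have "0 < nrm s" "ln (nrm s) = (\<Sum>p\<in>#factor_mset s. ln (nrm p))"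
    using nrm_foldr[OF ne fl(1)] unfolding fl(2) factor_mset_def by auto
  then show ?thesis using ln_le_cancel_iff[of "nrm s" x] assms(2) by simp
qed

lemma bij_factor_mset_upto:
  assumes "x > 0"
  shows "bij_betw factor_mset (elements_upto S nrm x)
    {m. set_mset m \<subseteq> primes_of S \<and> (\<Sum>p\<in>#m. ln (nrm p)) \<le> ln x}"
proof (rule bij_betw_subset[OF bij_factor_mset])
  show "elements_upto S nrm x \<subseteq> carrier S" by (auto simp: elements_upto_def)
  show "factor_mset ` elements_upto S nrm x = {m. set_mset m \<subseteq> primes_of S \<and> (\<Sum>p\<in>#m. ln (nrm p)) \<le> ln x}"
  proof -
    have "elements_upto S nrm x = {s \<in> carrier S. (\<Sum>p\<in>#factor_mset s. ln (nrm p)) \<le> ln x}"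
      using nrm_le_iff[OF _ assms] by (auto simp: elements_upto_def)
    then have "factor_mset ` elements_upto S nrm x =
        {m \<in> factor_mset ` carrier S. (\<Sum>p\<in>#m. ln (nrm p)) \<le> ln x}" by auto
    then show ?thesis unfolding bij_betw_imp_surj_on[OF bij_factor_mset] by simp
  qed
qed

lemma finite_elements_upto: "finite (elements_upto S nrm x)"
  unfolding elements_upto_def by (rule finite_nrm_le)

sublocale W: weighted_primes "primes_of S" "\<lambda>p. ln (nrm p)"
proof
  show "0 < ln (nrm p)" if "p \<in> primes_of S" for p
    using nrm_prime_gt_1[OF that] by simp
  show "finite {m. set_mset m \<subseteq> primes_of S \<and> (\<Sum>p\<in>#m. ln (nrm p)) \<le> t}" for t
    using bij_betw_finite[OF bij_factor_mset_upto[of "exp t"]] finite_elements_upto by simp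
qed

lemma bij_upto: "x > 0 \<Longrightarrow> bij_betw factor_mset (elements_upto S nrm x) (W.upto (ln x))"
  using bij_factor_mset_upto by (simp add: W.upto_def W.size_of_def)

lemma N_eq_nu: "W.N t = nu S nrm (exp t)"
  using bij_betw_same_card[OF bij_upto[of "exp t"]] by (simp add: W.N_def nu_def)

lemma prime_count_eq: "real (card {p \<in> primes_of S. ln (nrm p) \<le> t}) = prime_count S nrm (exp t)"
proof -
  have "ln (nrm p) \<le> t \<longleftrightarrow> nrm p \<le> exp t" if "p \<in> primes_of S" for p
    using nrm_prime_gt_1[OF that] by (metis exp_gt_zero ln_exp ln_le_cancel_iff less_trans zero_less_one)
  then show ?thesis unfolding prime_count_def by (metis (mono_tags, lifting) Collect_cong)
qed

text \<open>\<open>proc\<close> sorts a list of the prime factors; the chosen list is sorted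
  already, hence a fixed point of \<open>top_entry\<close>.\<close>

lemma L_process_eq:
  assumes n: "n > 1" and s: "s \<in> elements_upto S nrm n"
  shows "L_process S nrm n s = W.proc (ln n) (factor_mset s)"
proof -
  have sc: "s \<in> carrier S" using s by (simp add: elements_upto_def)
  define t where "t = ln n"
  have t: "t > 0" using n by (simp add: t_def)
  have up: "mset (factor_list s) \<in> W.upto t"
    using bij_betwE[OF bij_upto[of n]] s n by (auto simp: factor_mset_def t_def)
  have gt: "1 < nrm p" if "p \<in> set (factor_list s)" for p
    using factor_list(1)[OF sc] that nrm_prime_gt_1 by auto
  have "sorted_wrt (\<lambda>p q. ln (nrm q) / t \<le> ln (nrm p) / t) (factor_list s)"
    using factor_list(3)[OF sc]
  proof (rule sorted_wrt_mono_rel[rotated])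
    fix p q assume "p \<in> set (factor_list s)" "q \<in> set (factor_list s)" "nrm p \<ge> nrm q"
    then show "ln (nrm q) / t \<le> ln (nrm p) / t"
      using gt[of p] gt[of q] t by (intro divide_right_mono) auto
  qed
  then have sorted: "sorted_wrt (\<ge>) (map (\<lambda>p. ln (nrm p) / t) (factor_list s))"
    by (simp add: sorted_wrt_map)
  have "W.proc t (factor_mset s) = top_entry (W.padded t (factor_list s))"
    by (rule W.proc_eq) (simp add: factor_mset_def)
  also have "\<dots> = W.padded t (factor_list s)"
    using top_entry_sorted[OF sorted] W.padded_in_unit_cube[OF t up] by (simp add: W.padded_eq)
  also have "\<dots> = L_process S nrm n s"
    by (auto simp: fun_eq_iff W.padded_def L_process_def t_def factor_list_def Let_def)
  finally show ?thesis by (simp add: t_def)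
qed

lemma integral_L_law:
  fixes f :: "(nat \<Rightarrow> real) \<Rightarrow> real" and k :: nat
  assumes n: "n > 1" and cont: "continuous_map (powertop_real {..<k}) euclideanreal f"
  shows "(\<integral>x. f (restrict x {..<k}) \<partial>L_law S nrm n) =
    (\<Sum>m\<in>W.upto (ln n). f (restrict (W.proc (ln n) m) {..<k})) / W.N (ln n)"
proof -
  have bij: "bij_betw factor_mset (elements_upto S nrm n) (W.upto (ln n))" using n by (intro bij_upto) simp
  have "{#} \<in> W.upto (ln n)" using n by (intro W.empty_in_upto) simp
  then have ne': "elements_upto S nrm n \<noteq> {}" using bij by (auto simp: bij_betw_def)
  have "(\<integral>x. f (restrict x {..<k}) \<partial>L_law S nrm n) =
    (\<integral>s. f (restrict (L_process S nrm n s) {..<k}) \<partial>measure_pmf (pmf_of_set (elements_upto S nrm n)))"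
    unfolding L_law_def
    by (rule integral_distr[OF _ borel_measurable_restrict[OF cont]]) (simp add: space_PiM)
  also have "\<dots> = (\<Sum>s\<in>elements_upto S nrm n. f (restrict (L_process S nrm n s) {..<k})) / card (elements_upto S nrm n)"
    by (rule integral_pmf_of_set[OF ne' finite_elements_upto])
  also have "card (elements_upto S nrm n) = card (W.upto (ln n))"
    by (rule bij_betw_same_card[OF bij])
  also have "(\<Sum>s\<in>elements_upto S nrm n. f (restrict (L_process S nrm n s) {..<k})) =
    (\<Sum>s\<in>elements_upto S nrm n. f (restrict (W.proc (ln n) (factor_mset s)) {..<k}))"
    using L_process_eq[OF n] by simp
  also have "\<dots> = (\<Sum>m\<in>W.upto (ln n). f (restrict (W.proc (ln n) m) {..<k}))"
    by (rule sum.reindex_bij_betw[OF bij])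
  finally show ?thesis by (simp only: W.N_def)
qed

lemma converges_L_law:
  assumes "\<theta> > 0" "((\<lambda>t. W.prime_mass t / t) \<longlongrightarrow> \<theta>) at_top" "W.regular_count \<theta>"
  shows "converges_in_distribution (L_law S nrm) (PD \<theta>) at_top"
  unfolding converges_in_distribution_def
proof (intro allI impI)
  fix k :: nat and f :: "(nat \<Rightarrow> real) \<Rightarrow> real"
  assume f: "continuous_map (powertop_real {..<k}) euclideanreal f \<and> bounded (f ` topspace (powertop_real {..<k}))"
  from f have "((\<lambda>t. (\<Sum>m\<in>W.upto t. f (restrict (W.proc t m) {..<k})) / W.N t) \<longlongrightarrow>
    (\<integral>x. f (restrict x {..<k}) \<partial>PD \<theta>)) at_top"
    by (intro W.proc_limit assms) auto
  from filterlim_compose[OF this ln_at_top]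
  show "((\<lambda>n. \<integral>x. f (restrict x {..<k}) \<partial>L_law S nrm n) \<longlongrightarrow> (\<integral>x. f (restrict x {..<k}) \<partial>PD \<theta>)) at_top"
    by (rule Lim_transform_eventually)
      (use eventually_gt_at_top[of 1] in eventually_elim, use f integral_L_law in auto)
qed

end

context normed_arithmetic_semigroup
begin

lemma carrier_trivial:
  assumes "primes_of S = {}"
  shows "carrier S = {\<one>}"
proof -
  have "s = \<one>" if "s \<in> carrier S" for s
    using factor_list(1,2)[OF that] assms by simp
  then show ?thesis by auto
qed

lemma growth_A_limit:
  assumes "growth_A S nrm"
  obtains A where "A > 0" "((\<lambda>x. nu S nrm x / x) \<longlongrightarrow> A) at_top"
proof -
  obtain A \<delta> E where A: "A > 0" "\<delta> > 0" "E \<in> O[at_top](\<lambda>x. 1 / x powr \<delta>)"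
    "\<forall>\<^sub>F x in at_top. nu S nrm x = A * x * (1 + E x)"
    using assms unfolding growth_A_def by blast
  have "(E \<longlongrightarrow> 0) at_top"
  proof (rule smalloD_tendsto[of _ _ "\<lambda>_. 1", simplified])
    have "(\<lambda>x. 1 / x powr \<delta>) \<in> o[at_top](\<lambda>_::real. 1::real)" using A(2) by real_asymp
    then show "E \<in> o[at_top](\<lambda>_. 1)" by (rule landau_o.big_small_trans[OF A(3)])
  qed
  then have "((\<lambda>x. A * (1 + E x)) \<longlongrightarrow> A * (1 + 0)) at_top" by (intro tendsto_intros)
  moreover have "\<forall>\<^sub>F x in at_top. A * (1 + E x) = nu S nrm x / x"
    using A(4) eventually_gt_at_top[of 0] by eventually_elim simp
  ultimately have "((\<lambda>x. nu S nrm x / x) \<longlongrightarrow> A * (1 + 0)) at_top" by (rule Lim_transform_eventually)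
  then show ?thesis using that A(1) by simp
qed

lemma growth_B_limit:
  assumes "growth_B S nrm \<theta>"
  shows "\<theta> > 0" "((\<lambda>x. prime_count S nrm x * ln x / x) \<longlongrightarrow> \<theta>) at_top"
proof -
  show "\<theta> > 0" using assms by (simp add: growth_B_def)
  obtain \<epsilon> E where E: "\<epsilon> > 0" "E \<in> O[at_top](\<lambda>x. 1 / ln x powr \<epsilon>)"
    "\<forall>\<^sub>F x in at_top. prime_count S nrm x = \<theta> * (x / ln x) * (1 + E x)"
    using assms unfolding growth_B_def by blast
  have "(E \<longlongrightarrow> 0) at_top"
  proof (rule smalloD_tendsto[of _ _ "\<lambda>_. 1", simplified])
    have "(\<lambda>x. 1 / ln x powr \<epsilon>) \<in> o[at_top](\<lambda>_::real. 1::real)" using E(1) by real_asymp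
    then show "E \<in> o[at_top](\<lambda>_. 1)" by (rule landau_o.big_small_trans[OF E(2)])
  qed
  then have "((\<lambda>x. \<theta> * (1 + E x)) \<longlongrightarrow> \<theta> * (1 + 0)) at_top" by (intro tendsto_intros)
  moreover have "\<forall>\<^sub>F x in at_top. \<theta> * (1 + E x) = prime_count S nrm x * ln x / x"
    using E(3) eventually_gt_at_top[of 1] by eventually_elim simp
  ultimately have "((\<lambda>x. prime_count S nrm x * ln x / x) \<longlongrightarrow> \<theta> * (1 + 0)) at_top" by (rule Lim_transform_eventually)
  then show "((\<lambda>x. prime_count S nrm x * ln x / x) \<longlongrightarrow> \<theta>) at_top" by simp
qed

lemma convergence_A:
  assumes "growth_A S nrm"
  shows "converges_in_distribution (L_law S nrm) (PD 1) at_top"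
proof -
  obtain A where A: "A > 0" "((\<lambda>x. nu S nrm x / x) \<longlongrightarrow> A) at_top"
    using growth_A_limit[OF assms] .
  \<comment> \<open>Without primes only the identity remains and the count is at most 1, which
    contradicts linear growth.\<close>
  have ne: "primes_of S \<noteq> {}"
  proof
    assume "primes_of S = {}"
    then have "elements_upto S nrm x \<subseteq> {\<one>}" for x using carrier_trivial by (auto simp: elements_upto_def)
    then have le: "nu S nrm x \<le> 1" for x using card_mono[of "{\<one>}" "elements_upto S nrm x"] by (simp add: nu_def)
    have "((\<lambda>x. nu S nrm x / x) \<longlongrightarrow> 0) at_top"
    proof (rule tendsto_sandwich[of "\<lambda>_. 0" _ _ "\<lambda>x. 1 / x"])
      show "\<forall>\<^sub>F x in at_top. 0 \<le> nu S nrm x / x" "\<forall>\<^sub>F x in at_top. nu S nrm x / x \<le> 1 / x"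
        using eventually_gt_at_top[of 0] by (eventually_elim, use le in \<open>auto simp: nu_def intro!: divide_right_mono\<close>)+
      show "((\<lambda>x. 1 / x) \<longlongrightarrow> (0::real)) at_top" by real_asymp
    qed simp
    then show False using tendsto_unique[OF _ A(2)] A(1) by force
  qed
  interpret normed_semigroup_with_primes S nrm by unfold_locales (rule ne)
  have "((\<lambda>t. nu S nrm (exp t) / exp t) \<longlongrightarrow> A) at_top"
    by (rule filterlim_compose[OF A(2) exp_at_top])
  then have "((\<lambda>t. exp (- t) * W.N t) \<longlongrightarrow> A) at_top"
    by (simp add: N_eq_nu exp_minus field_simps)
  then show ?thesis
    by (intro converges_L_law W.prime_mass_lim_A[OF A(1)] W.regular_count_A[OF A(1)]) auto
qed

lemma convergence_B:
  assumes "growth_B S nrm \<theta>"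
  shows "converges_in_distribution (L_law S nrm) (PD \<theta>) at_top"
proof -
  note B = growth_B_limit[OF assms]
  have ne: "primes_of S \<noteq> {}"
  proof
    assume "primes_of S = {}"
    then have "prime_count S nrm = (\<lambda>_. 0)" by (simp add: prime_count_def fun_eq_iff)
    then have "((\<lambda>_::real. 0) \<longlongrightarrow> \<theta>) at_top" using B(2) by simp
    then show False using B(1) by (simp add: tendsto_const_iff)
  qed
  interpret normed_semigroup_with_primes S nrm by unfold_locales (rule ne)
  have "((\<lambda>t. prime_count S nrm (exp t) * ln (exp t) / exp t) \<longlongrightarrow> \<theta>) at_top"
    by (rule filterlim_compose[OF B(2) exp_at_top])
  then have lim: "((\<lambda>t. real (card {p \<in> primes_of S. ln (nrm p) \<le> t}) * exp (- t) * t) \<longlongrightarrow> \<theta>) at_top"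
    by (simp add: prime_count_eq exp_minus field_simps)
  show ?thesis
    by (intro converges_L_law B W.prime_mass_lim_B W.regular_count_B) (rule lim)+
qed

end

theorem theorem2:
  fixes S :: "('a, 'b) monoid_scheme" and nrm :: "'a \<Rightarrow> real" and \<theta>\<^sub>0 :: real
  assumes "normed_arithmetic_semigroup S nrm"
    and "growth_A S nrm \<or> growth_B S nrm \<theta>\<^sub>0"
  shows "converges_in_distribution (L_law S nrm)
           (PD (if growth_A S nrm then 1 else \<theta>\<^sub>0)) at_top"
proof -
  interpret normed_arithmetic_semigroup S nrm by (rule assms(1))
  show ?thesis using assms(2) convergence_A convergence_B by auto
qed

end
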